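(* Let $d\ge1$, $0<\alpha<1$, let $\Lambda$ be a probability measure on $\mathbb{S}^{d-1}$, and let $(G_t)_{t>0}$ be the associated positive convolution kernel (defined in the context). Consider the problem $$\int_{\mathbb{S}^{d-1}}\left(\frac{\partial}{\partial t}+b\cdot\nabla\right)^\alpha u\,\Lambda(db)=f,\ t>0,\qquad \lim_{t\to0^+}\int_{\mathbb{S}^{d-1}}I_b^{1-\alpha}u(\cdot,t)\,\Lambda(db)=0,$$ with homogeneous Riemann-Liouville initial datum. Let $f:(0,\infty)\to\mathcal{M}(\mathbb{R}^d)$, $t\mapsto f(\cdot,t)$, be weak-$*$ measurable, and define $$u(\cdot,t)=\int_0^tG_{t-\tau}*f(\cdot,\tau)\,d\tau,\qquad t>0,$$ where the integral is understood in the weak-$*$ sense in $\mathcal{M}(\mathbb{R}^d)$. Assume that $$\int_0^t(t-\tau)^{\alpha-1}\|f(\cdot,\tau)\|_{\mathcal{M}(\mathbb{R}^d)}\,d\tau<\infty,\qquad t>0,$$ and set $m(t):=f(\cdot,t)(\mathbb{R}^d)$. Then: (a) For every $t>0$, $$u(\cdot,t)(\mathbb{R}^d)=\frac{1}{\Gamma(\alpha)}\int_0^t(t-\tau)^{\alpha-1}m(\tau)\,d\tau .$$ (b) Consequently, $u(\cdot,t)(\mathbb{R}^d)=1$ for all $t>0$ if and only if $$f(\cdot,t)(\mathbb{R}^d)=\frac{t^{-\alpha}}{\Gamma(1-\alpha)}\quad\text{for almost every }t>0.\qquad(1)$$ (c) If, in addition, $$f(\cdot,t)\text{ is a positive Borel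 measure for almost every }t>0,\qquad(2)$$ then $u(\cdot,t)$ is a positive Borel measure for every $t>0$. Therefore, under (1) and (2), $u(\cdot,t)$ is a probability measure on $\mathbb{R}^d$ for every $t>0$. (d) Assume (1) and (2), and define $\nu_t(dx):=\Gamma(1-\alpha)\,t^\alpha f(dx,t)$. After modifying $f(\cdot,t)$ on a set of times of Lebesgue measure zero, if necessary, the measures $\nu_t$ may be taken to be probability measures for every $t>0$. If $$\nu_t\rightharpoonup\delta_0\quad\text{as }t\to0^+,$$ then $$u(\cdot,t)\rightharpoonup\delta_0\quad\text{as }t\to0^+ .$$
   Context: $\mathbb{R}_+=[0,\infty)$; $\mathbb{S}^{d-1}$ is the unit sphere of $\mathbb{R}^d$; complex powers use the principal branch. $C_0(\mathbb{R}^d)$ is the space of continuous functions vanishing at infinity. $\mathcal{M}(\mathbb{R}^d)$ is the space of finite signed Borel measures on $\mathbb{R}^d$ with total variation norm $\|\mu\|_{\mathcal{M}(\mathbb{R}^d)}=|\mu|(\mathbb{R}^d)$. A map into $\mathcal{M}(\mathbb{R}^d)$ is weak-$*$ measurable if its pairing with each $\varphi\in C_0(\mathbb{R}^d)$ is measurable; weak-$*$ integrals are defined by pairing with $\varphi\in C_0(\mathbb{R}^d)$. Convolution: $\langle\mu*\nu,\varphi\rangle=\int\int\varphi(x+y)\,\mu(dx)\,\nu(dy)$. $\rightharpoonup$ is weak convergence of probability measures (tested against bounded continuous functions). Fractional material integral: $\langle I_b^{1-\alpha}u(\cdot,t),\varphi\rangle=\frac{1}{\Gamma(1-\alpha)}\int_0^t(t-\tau)^{-\alpha}\langle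 u(\cdot,\tau),\varphi(\cdot+b(t-\tau))\rangle\,d\tau$ for $\varphi\in C_0(\mathbb{R}^d)$; fractional material derivative: $\left(\frac{\partial}{\partial t}+b\cdot\nabla\right)^\alpha u=\left(\frac{\partial}{\partial t}+b\cdot\nabla\right)I_b^{1-\alpha}u$ in the distributional sense. The kernel $(G_t)_{t>0}$. Let $(\mu_r)_{r>0}$ be the weakly continuous convolution semigroup of probability measures on $\mathbb{R}_+\times\mathbb{R}^d$ with $$\int_0^\infty\int_{\mathbb{R}^d}e^{-st+i\xi\cdot x}\,\mu_r(dt,dx)=\exp\left(-r\int_{\mathbb{S}^{d-1}}(s-ib\cdot\xi)^\alpha\,\Lambda(db)\right).$$ Disintegrate $\mu_r(dt,dx)=h_\alpha(t,r)\,\nu_{r,t}(dx)\,dt$, where $\nu_{r,t}$ is a regular conditional probability measure on $\mathbb{R}^d$ supported in the closed ball $\overline{B_t(0)}$ and $h_\alpha(\cdot,r)$ is the $\alpha$-stable subordinator density, $\int_0^\infty e^{-\lambda y}h_\alpha(y,r)\,dy=e^{-r\lambda^\alpha}$ for $\Re\lambda>0$. Then $$G_t(dx)=\mathbf{1}_{\{|x|\le t\}}\int_0^\infty h_\alpha(t,r)\,\nu_{r,t}(dx)\,dr .$$ Each $G_t$ is a finite positive Borel measure with total mass $G_t(\mathbb{R}^d)=t^{\alpha-1}/\Gamma(\alpha)$, and the family is characterized by $$\int_0^\infty e^{-st}\int_{\mathbb{R}^d}e^{i\xi\cdot x}\,G_t(dx)\,dt=\left(\int_{\mathbb{S}^{d-1}}(s-ib\cdot\xi)^\alpha\,\Lambda(db)\right)^{-1},\quad\Re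 s>0.$$ (In the case $\Lambda=\delta_{b_0}$, $G_t=\frac{t^{\alpha-1}}{\Gamma(\alpha)}\delta_{tb_0}$.) *)

theory Defs
  imports "HOL-Probability.Probability"
begin

text \<open>
  Finite signed Borel measures are countably additive real set functions on the Borel sets. As for
  \<^const>\<open>measure\<close>, the value outside the \<open>\<sigma>\<close>-algebra is fixed to be \<open>0\<close>, so that equality of set
  functions is equality of signed measures; a finite Borel measure \<open>M\<close> is represented by
  \<open>measure M\<close>.
\<close>

definition signed_measure :: "('a::topological_space set \<Rightarrow> real) \<Rightarrow> bool" where
  "signed_measure \<mu> \<longleftrightarrow>
     \<mu> {} = 0 \<and>
     (\<forall>A::nat \<Rightarrow> 'a set. range A \<subseteq> sets borel \<longrightarrow> disjoint_family A \<longrightarrow>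
        (\<lambda>i. \<mu> (A i)) sums \<mu> (\<Union>i. A i)) \<and>
     (\<forall>A. A \<notin> sets borel \<longrightarrow> \<mu> A = 0)"

definition positive_measure :: "('a::topological_space set \<Rightarrow> real) \<Rightarrow> bool" where
  "positive_measure \<mu> \<longleftrightarrow> signed_measure \<mu> \<and> (\<forall>A\<in>sets borel. 0 \<le> \<mu> A)"

definition probability_measure :: "('a::topological_space set \<Rightarrow> real) \<Rightarrow> bool" where
  "probability_measure \<mu> \<longleftrightarrow> positive_measure \<mu> \<and> \<mu> UNIV = 1"

text \<open>
  The positive part of the Jordan decomposition; the negative part of \<open>\<mu>\<close> is the positive part of
  \<open>-\<mu>\<close>. Since \<open>\<mu> {} = 0\<close> and \<^const>\<open>ennreal\<close> sends negative numbers to \<open>0\<close>, this is the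
  supremum of \<open>\<mu> B\<close> over the Borel sets \<open>B \<subseteq> A\<close>.
\<close>

definition pos_variation :: "('a::topological_space set \<Rightarrow> real) \<Rightarrow> 'a measure" where
  "pos_variation \<mu> =
     measure_of UNIV (sets borel) (\<lambda>A. SUP B\<in>{B \<in> sets borel. B \<subseteq> A}. ennreal (\<mu> B))"

definition neg_variation :: "('a::topological_space set \<Rightarrow> real) \<Rightarrow> 'a measure" where
  "neg_variation \<mu> = pos_variation (\<lambda>A. - \<mu> A)"

definition tv_norm :: "('a::topological_space set \<Rightarrow> real) \<Rightarrow> ennreal" where
  "tv_norm \<mu> = emeasure (pos_variation \<mu>) UNIV + emeasure (neg_variation \<mu>) UNIV"

definition signed_integral :: "('a::topological_space set \<Rightarrow> real) \<Rightarrow> ('a \<Rightarrow> real) \<Rightarrow> real" where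
  "signed_integral \<mu> \<phi> =
     (\<integral>x. \<phi> x \<partial>pos_variation \<mu>) - (\<integral>x. \<phi> x \<partial>neg_variation \<mu>)"

definition C0 :: "('a::real_normed_vector \<Rightarrow> real) set" where
  "C0 = {\<phi>. continuous_on UNIV \<phi> \<and> (\<phi> \<longlongrightarrow> 0) at_infinity}"

definition signed_convolution ::
    "('a::euclidean_space set \<Rightarrow> real) \<Rightarrow> ('a set \<Rightarrow> real) \<Rightarrow> 'a set \<Rightarrow> real" where
  "signed_convolution \<mu> \<nu> = (THE \<rho>. signed_measure \<rho> \<and>
     (\<forall>\<phi>\<in>C0. signed_integral \<rho> \<phi> =
        signed_integral \<nu> (\<lambda>y. signed_integral \<mu> (\<lambda>x. \<phi> (x + y)))))"

definition weakly_converges ::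
    "('b \<Rightarrow> 'a::topological_space set \<Rightarrow> real) \<Rightarrow> ('a set \<Rightarrow> real) \<Rightarrow> 'b filter \<Rightarrow> bool" where
  "weakly_converges \<nu> \<mu> F \<longleftrightarrow>
     (\<forall>\<phi>. continuous_on UNIV \<phi> \<and> bounded (range \<phi>) \<longrightarrow>
        ((\<lambda>t. signed_integral (\<nu> t) \<phi>) \<longlongrightarrow> signed_integral \<mu> \<phi>) F)"

abbreviation dirac0 :: "'a::real_normed_vector set \<Rightarrow> real" where
  "dirac0 \<equiv> measure (return borel 0)"

definition weak_star_measurable ::
    "real set \<Rightarrow> (real \<Rightarrow> 'a::euclidean_space set \<Rightarrow> real) \<Rightarrow> bool" where
  "weak_star_measurable S F \<longleftrightarrow>
     (\<forall>\<phi>\<in>C0. (\<lambda>\<tau>. signed_integral (F \<tau>) \<phi>) \<in> borel_measurable (lebesgue_on S))"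

definition has_weak_star_integral ::
    "(real \<Rightarrow> 'a::euclidean_space set \<Rightarrow> real) \<Rightarrow> ('a set \<Rightarrow> real) \<Rightarrow> real set \<Rightarrow> bool" where
  "has_weak_star_integral F \<mu> S \<longleftrightarrow>
     signed_measure \<mu> \<and>
     (\<forall>\<phi>\<in>C0. set_integrable lebesgue S (\<lambda>\<tau>. signed_integral (F \<tau>) \<phi>) \<and>
        signed_integral \<mu> \<phi> = (LINT \<tau>:S|lebesgue. signed_integral (F \<tau>) \<phi>))"

definition weak_star_integral ::
    "real set \<Rightarrow> (real \<Rightarrow> 'a::euclidean_space set \<Rightarrow> real) \<Rightarrow> 'a set \<Rightarrow> real" where
  "weak_star_integral S F = (THE \<mu>. has_weak_star_integral F \<mu> S)"

definition sphere_probability :: "'a::euclidean_space measure \<Rightarrow> bool" where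
  "sphere_probability \<Lambda> \<longleftrightarrow>
     prob_space \<Lambda> \<and> sets \<Lambda> = sets (restrict_space borel (sphere 0 1))"

definition symbol :: "real \<Rightarrow> 'a::euclidean_space measure \<Rightarrow> complex \<Rightarrow> 'a \<Rightarrow> complex" where
  "symbol \<alpha> \<Lambda> s \<xi> = (\<integral>b. (s - \<i> * complex_of_real (b \<bullet> \<xi>)) powr complex_of_real \<alpha> \<partial>\<Lambda>)"

definition space_time_semigroup ::
    "real \<Rightarrow> (real ^ 'd) measure \<Rightarrow> (real \<Rightarrow> (real \<times> (real ^ 'd)) measure) \<Rightarrow> bool" where
  "space_time_semigroup \<alpha> \<Lambda> \<mu> \<longleftrightarrow>
     (\<forall>r>0. prob_space (\<mu> r) \<and> sets (\<mu> r) = sets borel \<and> (AE p in \<mu> r. 0 \<le> fst p)) \<and>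
     (\<forall>r>0. \<forall>r'>0. \<mu> (r + r') = convolution (\<mu> r) (\<mu> r')) \<and>
     (\<forall>r>0. weakly_converges (\<lambda>q. measure (\<mu> q)) (measure (\<mu> r)) (at r)) \<and>
     weakly_converges (\<lambda>q. measure (\<mu> q)) dirac0 (at_right 0) \<and>
     (\<forall>r>0. \<forall>s \<xi>. 0 < Re s \<longrightarrow>
        (\<integral>p. exp (- s * complex_of_real (fst p) + \<i> * complex_of_real (\<xi> \<bullet> snd p)) \<partial>\<mu> r) =
        exp (- complex_of_real r * symbol \<alpha> \<Lambda> s \<xi>))"

text \<open>
  The Laplace transform fixes \<open>h(\<cdot>, r)\<close> only almost everywhere; joint continuity selects the usual
  version \<open>h(t, r) = r\<^bsup>-1/\<alpha>\<^esup> h(r\<^bsup>-1/\<alpha>\<^esup> t, 1)\<close> of the stable density.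
\<close>

definition stable_subordinator_density :: "real \<Rightarrow> (real \<Rightarrow> real \<Rightarrow> real) \<Rightarrow> bool" where
  "stable_subordinator_density \<alpha> h \<longleftrightarrow>
     (\<forall>t>0. \<forall>r>0. 0 \<le> h t r) \<and>
     continuous_on ({0<..} \<times> {0<..}) (\<lambda>(t, r). h t r) \<and>
     (\<forall>r>0. \<forall>z. 0 < Re z \<longrightarrow>
        set_integrable lborel {0<..} (\<lambda>t. exp (- z * complex_of_real t) * complex_of_real (h t r)) \<and>
        (LINT t:{0<..}|lborel. exp (- z * complex_of_real t) * complex_of_real (h t r)) =
        exp (- complex_of_real r * z powr complex_of_real \<alpha>))"

text \<open>
  \<open>\<mu>\<^sub>r(dt, dx) = h(t, r) \<nu>\<^sub>r\<^sub>,\<^sub>t(dx) dt\<close>. The conditional laws are taken jointly measurable in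
  \<open>(r, t)\<close>, as is needed for integrating them over \<open>r\<close>.
\<close>

definition disintegrates ::
    "(real \<Rightarrow> (real \<times> 'a::euclidean_space) measure) \<Rightarrow> (real \<Rightarrow> real \<Rightarrow> real) \<Rightarrow>
     (real \<Rightarrow> real \<Rightarrow> 'a measure) \<Rightarrow> bool" where
  "disintegrates \<mu> h \<nu> \<longleftrightarrow>
     (\<lambda>(r, t). \<nu> r t) \<in> restrict_space borel ({0<..} \<times> {0<..}) \<rightarrow>\<^sub>M prob_algebra borel \<and>
     (\<forall>r>0. \<forall>t>0. emeasure (\<nu> r t) (cball 0 t) = 1) \<and>
     (\<forall>r>0. \<forall>A\<in>sets borel. emeasure (\<mu> r) A =
        (\<integral>\<^sup>+t\<in>{0<..}. ennreal (h t r) * emeasure (\<nu> r t) {x. (t, x) \<in> A} \<partial>lborel))"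

definition convolution_kernel ::
    "real \<Rightarrow> (real ^ 'd) measure \<Rightarrow> (real \<Rightarrow> (real ^ 'd) measure) \<Rightarrow> bool" where
  "convolution_kernel \<alpha> \<Lambda> G \<longleftrightarrow>
     (\<exists>\<mu> h \<nu>. space_time_semigroup \<alpha> \<Lambda> \<mu> \<and> stable_subordinator_density \<alpha> h \<and>
        disintegrates \<mu> h \<nu> \<and>
        (\<forall>t>0. G t = measure_of UNIV (sets borel)
           (\<lambda>A. \<integral>\<^sup>+r\<in>{0<..}. ennreal (h t r) * emeasure (\<nu> r t) (A \<inter> cball 0 t) \<partial>lborel)))"

end

theory Submission
  imports Defs
begin

text \<open>
  Two facts about the kernel carry the result. Its mass is \<open>G\<^sub>s(\<real>\<^sup>d) = s\<^bsup>\<alpha>-1\<^esup> / \<Gamma>(\<alpha>)\<close>, and it lives on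
  the ball of radius \<open>s\<close>; that is, \<open>G\<^sub>s = (s\<^bsup>\<alpha>-1\<^esup> / \<Gamma>(\<alpha>)) K\<^sub>s\<close> for a measurable family of probability
  measures \<open>K\<^sub>s\<close> with \<open>K\<^sub>s(cball 0 s) = 1\<close> (\<open>convolution_kernel_normalized\<close>). Since the conditional
  laws \<open>\<nu>\<^sub>r\<^sub>,\<^sub>t\<close> are probability measures, the mass is \<open>H(t) = \<integral> h(t, r) dr\<close>. Uniqueness of Laplace
  transforms gives the scaling \<open>h(t, r) = c h(ct, c\<^sup>\<alpha>r)\<close>, so \<open>H(t) = t\<^bsup>\<alpha>-1\<^esup> H(1)\<close>, and integrating
  against \<open>e\<^sup>-\<^sup>t\<close> identifies \<open>H(1) = 1 / \<Gamma>(\<alpha>)\<close>.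

  The convolution being linear in \<open>f\<close>, the solution acts on bounded Borel functions by
  \<open>\<langle>u(t), \<phi>\<rangle> = \<integral>\<^sub>0\<^sup>t w(t - \<tau>) \<langle>f(\<tau>), K\<^sub>t\<^sub>-\<^sub>\<tau> \<phi>\<rangle> d\<tau>\<close> with \<open>w(s) = s\<^bsup>\<alpha>-1\<^esup> / \<Gamma>(\<alpha>)\<close> and
  \<open>(K\<^sub>s \<phi>)(y) = \<integral> \<phi>(x + y) K\<^sub>s(dx)\<close>. The difficulty is measure-theoretic: \<open>f\<close> is measurable only
  against fixed functions vanishing at infinity, whereas \<open>K\<^sub>t\<^sub>-\<^sub>\<tau> \<phi>\<close> moves with \<open>\<tau>\<close>. A functional
  monotone class theorem (\<open>C0_bounded_borel_induct\<close>) reaches all bounded Borel functions, also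
  those depending on a measurable parameter (\<open>signed_kernel_integral_measurable_param\<close>). The total
  variation is a countable supremum and hence measurable (\<open>signed_kernel_tv_norm_measurable\<close>), so
  the integrability hypothesis provides an honest dominating function. The functional above is then
  continuous under bounded pointwise convergence, which makes it integration against a signed measure.

  Testing with \<open>\<phi> = 1\<close> gives the mass formula, a Riemann-Liouville integral of \<open>m(\<tau>) = f(\<tau>)(\<real>\<^sup>d)\<close>.
  The Beta integral shows that \<open>m(\<tau>) = \<tau>\<^bsup>-\<alpha>\<^esup> / \<Gamma>(1-\<alpha>)\<close> produces mass \<open>1\<close>; conversely, convolving an Abel
  equation with \<open>t\<^bsup>-\<alpha>\<^esup>\<close> turns it into a vanishing primitive, so its solution is unique
  (\<open>Abel_equation_unique\<close>). Positivity is visible in the formula. For the initial behaviour, the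
  kernel moves mass by at most \<open>t - \<tau> \<le> t\<close>, so near \<open>t = 0\<close> the measure \<open>u(t)\<close> is an average of
  slightly displaced copies of the \<open>\<nu>\<^sub>\<tau>\<close> with \<open>\<tau> < t\<close>, weighted by a probability density in \<open>\<tau>\<close>
  (\<open>solution_tendsto_dirac\<close>).
\<close>

section \<open>Finite signed measures and their variations\<close>

lemma signed_measure_empty: "signed_measure \<mu> \<Longrightarrow> \<mu> {} = 0"
  by (simp add: signed_measure_def)

lemma signed_measure_outside: "signed_measure \<mu> \<Longrightarrow> A \<notin> sets borel \<Longrightarrow> \<mu> A = 0"
  by (simp add: signed_measure_def)

lemma signed_measure_sums:
  "signed_measure \<mu> \<Longrightarrow> range A \<subseteq> sets borel \<Longrightarrow> disjoint_family A \<Longrightarrow>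
     (\<lambda>i::nat. \<mu> (A i)) sums \<mu> (\<Union>i. A i)"
  by (simp add: signed_measure_def)

lemma signed_measure_Un:
  assumes \<mu>: "signed_measure \<mu>" and AB: "A \<in> sets borel" "B \<in> sets borel" "A \<inter> B = {}"
  shows "\<mu> (A \<union> B) = \<mu> A + \<mu> B"
proof -
  have "(\<lambda>i. \<mu> (binaryset A B i)) sums \<mu> (\<Union>i. binaryset A B i)"
    using AB by (intro signed_measure_sums[OF \<mu>])
      (auto simp: range_binaryset_eq disjoint_family_on_def binaryset_def)
  moreover have "(\<lambda>i. \<mu> (binaryset A B i)) sums (\<mu> A + \<mu> B)"
    by (rule binaryset_sums) (rule signed_measure_empty[OF \<mu>])
  ultimately show ?thesis
    by (simp add: UN_binaryset_eq sums_unique2)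
qed

lemma signed_measure_Diff:
  assumes "signed_measure \<mu>" "A \<in> sets borel" "B \<in> sets borel" "B \<subseteq> A"
  shows "\<mu> (A - B) = \<mu> A - \<mu> B"
  using signed_measure_Un[of \<mu> B "A - B"] assms by (simp add: Un_absorb1)

lemma signed_measure_cmult:
  assumes "signed_measure \<mu>"
  shows "signed_measure (\<lambda>A. c * \<mu> A)"
  using assms unfolding signed_measure_def by (auto intro: sums_mult)

lemma signed_measure_uminus:
  assumes "signed_measure \<mu>"
  shows "signed_measure (\<lambda>A. - \<mu> A)"
  using signed_measure_cmult[OF assms, of "-1"] by simp

text \<open>If \<open>\<mu>\<close> is unbounded on the subsets of \<open>A\<close>, then \<open>A\<close> splits into two pieces that both have
  measure at least \<open>1\<close> in absolute value, and \<open>\<mu>\<close> is again unbounded on one of them. Iterating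
  produces a disjoint sequence whose measures do not tend to \<open>0\<close>, against countable additivity.\<close>

lemma signed_measure_bounded:
  fixes \<mu> :: "'a::topological_space set \<Rightarrow> real"
  assumes \<mu>: "signed_measure \<mu>"
  obtains C where "0 \<le> C" "\<And>A. \<bar>\<mu> A\<bar> \<le> C"
proof -
  define bad where "bad A \<longleftrightarrow> A \<in> sets borel \<and> (\<forall>C. \<exists>B\<in>sets borel. B \<subseteq> A \<and> C < \<bar>\<mu> B\<bar>)" for A
  have split: "\<exists>B. bad B \<and> B \<subseteq> A \<and> 1 \<le> \<bar>\<mu> (A - B)\<bar>" if "bad A" for A
  proof -
    from that obtain B where B: "B \<in> sets borel" "B \<subseteq> A" "\<bar>\<mu> A\<bar> + 1 < \<bar>\<mu> B\<bar>"
      and A: "A \<in> sets borel"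
      unfolding bad_def by blast
    have AB: "A - B \<in> sets borel" using A B by auto
    have d: "\<mu> (A - B) = \<mu> A - \<mu> B" by (rule signed_measure_Diff[OF \<mu> A B(1,2)])
    have "bad B \<or> bad (A - B)"
    proof (rule ccontr)
      assume "\<not> ?thesis"
      then obtain C D where
        C: "\<And>E. E \<in> sets borel \<Longrightarrow> E \<subseteq> B \<Longrightarrow> \<bar>\<mu> E\<bar> \<le> C" and
        D: "\<And>E. E \<in> sets borel \<Longrightarrow> E \<subseteq> A - B \<Longrightarrow> \<bar>\<mu> E\<bar> \<le> D"
        using B(1) AB unfolding bad_def by (meson not_less)
      from that obtain E where E: "E \<in> sets borel" "E \<subseteq> A" "C + D < \<bar>\<mu> E\<bar>"
        unfolding bad_def by blast
      have "\<mu> E = \<mu> (E \<inter> B) + \<mu> (E - B)"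
        using signed_measure_Un[OF \<mu>, of "E \<inter> B" "E - B"] E B by (simp add: Int_Diff_Un Int_Diff_disjoint)
      moreover have "\<bar>\<mu> (E \<inter> B)\<bar> \<le> C" "\<bar>\<mu> (E - B)\<bar> \<le> D"
        using E B by (auto intro!: C D)
      ultimately show False using E(3) by linarith
    qed
    then show ?thesis
    proof
      assume "bad B"
      then show ?thesis using B d by (intro exI[of _ B]) auto
    next
      assume "bad (A - B)"
      moreover have "A - (A - B) = B" using B by auto
      ultimately show ?thesis using B by (intro exI[of _ "A - B"]) auto
    qed
  qed
  \<comment> \<open>a decreasing sequence of bad sets whose successive differences have measure at least 1\<close>
  have "\<not> bad UNIV"
  proof
    assume "bad UNIV"
    then obtain F :: "nat \<Rightarrow> 'a set" where
      F: "\<And>n. bad (F n)" "\<And>n. F (Suc n) \<subseteq> F n \<and> 1 \<le> \<bar>\<mu> (F n - F (Suc n))\<bar>"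
      using dependent_nat_choice[of "\<lambda>_. bad" "\<lambda>_ A B. B \<subseteq> A \<and> 1 \<le> \<bar>\<mu> (A - B)\<bar>"] split by metis
    have dec: "F m \<subseteq> F n" if "n \<le> m" for n m
      using that by (induction rule: dec_induct) (use F in auto)
    have "disjoint_family (\<lambda>n. F n - F (Suc n))"
      unfolding disjoint_family_on_def
    proof (intro ballI impI)
      fix m n :: nat assume "m \<noteq> n"
      then consider "Suc m \<le> n" | "Suc n \<le> m" by linarith
      then show "(F m - F (Suc m)) \<inter> (F n - F (Suc n)) = {}"
        by cases (use dec in blast)+
    qed
    moreover have "range (\<lambda>n. F n - F (Suc n)) \<subseteq> sets borel"
      using F unfolding bad_def by auto
    ultimately have "summable (\<lambda>n. \<mu> (F n - F (Suc n)))"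
      using signed_measure_sums[OF \<mu>, of "\<lambda>n. F n - F (Suc n)"] by (auto simp: sums_iff)
    then have "(\<lambda>n. \<mu> (F n - F (Suc n))) \<longlonglongrightarrow> 0"
      by (rule summable_LIMSEQ_zero)
    then have "eventually (\<lambda>n. \<bar>\<mu> (F n - F (Suc n))\<bar> < 1) sequentially"
      by (auto simp: tendsto_iff dist_real_def dest: spec[of _ 1])
    then obtain n where "\<bar>\<mu> (F n - F (Suc n))\<bar> < 1"
      by (auto simp: eventually_sequentially)
    then show False using F(2)[of n] by simp
  qed
  then obtain C where "\<And>B. B \<in> sets borel \<Longrightarrow> \<bar>\<mu> B\<bar> \<le> C"
    unfolding bad_def by (auto simp: not_less)
  then have "\<bar>\<mu> A\<bar> \<le> max 0 C" for A
    using signed_measure_outside[OF \<mu>, of A] by (cases "A \<in> sets borel") (auto simp: le_max_iff_disj)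
  then show thesis by (intro that[of "max 0 C"]) auto
qed

lemma space_pos_variation [simp]: "space (pos_variation \<mu>) = UNIV"
  and sets_pos_variation [measurable_cong, simp]: "sets (pos_variation \<mu>) = sets borel"
  and space_neg_variation [simp]: "space (neg_variation \<mu>) = UNIV"
  and sets_neg_variation [measurable_cong, simp]: "sets (neg_variation \<mu>) = sets borel"
  unfolding neg_variation_def pos_variation_def
  by (simp_all add: space_measure_of_conv sets_measure_of_conv sets.sigma_sets_eq[of borel, simplified])

lemma emeasure_pos_variation:
  fixes \<mu> :: "'a::topological_space set \<Rightarrow> real"
  assumes \<mu>: "signed_measure \<mu>" and A: "A \<in> sets borel"
  shows "emeasure (pos_variation \<mu>) A = (SUP B\<in>{B \<in> sets borel. B \<subseteq> A}. ennreal (\<mu> B))"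
    (is "_ = ?p A")
  unfolding pos_variation_def
proof (rule emeasure_measure_of_sigma[OF _ _ _ A])
  show "sigma_algebra UNIV (sets (borel :: 'a measure))"
    using sets.sigma_algebra_axioms[of "borel :: 'a measure"] by simp
  have "{B \<in> sets borel. B \<subseteq> ({}::'a set)} = {{}}" by auto
  then show "positive (sets borel) ?p"
    by (simp add: positive_def signed_measure_empty[OF \<mu>])
  show "countably_additive (sets borel) ?p"
    unfolding countably_additive_def
  proof (intro allI impI)
    fix A :: "nat \<Rightarrow> 'a set"
    assume A: "range A \<subseteq> sets borel" and dis: "disjoint_family A" and UA: "\<Union> (range A) \<in> sets borel"
    have Ai: "A i \<in> sets borel" for i using A by auto
    show "(\<Sum>i. ?p (A i)) = ?p (\<Union> (range A))"
    proof (rule antisym)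
      have fin: "(\<Sum>i<n. ?p (A i)) \<le> ?p (\<Union>i<n. A i)" for n
      proof (induction n)
        case 0
        then show ?case by simp
      next
        case (Suc n)
        let ?I = "{B \<in> sets borel. B \<subseteq> (\<Union>i<n. A i)}" and ?J = "{B \<in> sets borel. B \<subseteq> A n}"
        have ne: "?I \<noteq> {}" "?J \<noteq> {}" by auto
        have "?p (\<Union>i<n. A i) + ?p (A n) = (SUP B'\<in>?J. SUP B\<in>?I. ennreal (\<mu> B) + ennreal (\<mu> B'))"
          by (simp only: ennreal_SUP_add_left[OF ne(1), symmetric] ennreal_SUP_add_right[OF ne(2)])
        moreover have "(SUP B'\<in>?J. SUP B\<in>?I. ennreal (\<mu> B) + ennreal (\<mu> B')) \<le> ?p (\<Union>i<Suc n. A i)"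
        proof (intro SUP_least)
          fix B B' assume B: "B \<in> {B \<in> sets borel. B \<subseteq> (\<Union>i<n. A i)}" "B' \<in> {B \<in> sets borel. B \<subseteq> A n}"
          have "A i \<inter> A n = {}" if "i < n" for i
            using dis that by (auto simp: disjoint_family_on_def)
          then have "B \<inter> B' = {}"
            using B by blast
          then have add: "\<mu> (B \<union> B') = \<mu> B + \<mu> B'"
            using B by (intro signed_measure_Un[OF \<mu>]) auto
          consider "0 \<le> \<mu> B" "0 \<le> \<mu> B'" | "\<mu> B < 0" | "\<mu> B' < 0" by linarith
          then show "ennreal (\<mu> B) + ennreal (\<mu> B') \<le> ?p (\<Union>i<Suc n. A i)"
          proof cases
            case 1
            then have "ennreal (\<mu> B) + ennreal (\<mu> B') = ennreal (\<mu> (B \<union> B'))"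
              by (simp add: add)
            also have "\<dots> \<le> ?p (\<Union>i<Suc n. A i)"
              using B by (intro SUP_upper) (auto simp: lessThan_Suc)
            finally show ?thesis .
          next
            case 2
            then have "ennreal (\<mu> B) + ennreal (\<mu> B') = ennreal (\<mu> B')"
              by (simp add: ennreal_neg)
            also have "\<dots> \<le> ?p (\<Union>i<Suc n. A i)"
              using B by (intro SUP_upper) (auto simp: lessThan_Suc)
            finally show ?thesis .
          next
            case 3
            then have "ennreal (\<mu> B) + ennreal (\<mu> B') = ennreal (\<mu> B)"
              by (simp add: ennreal_neg)
            also have "\<dots> \<le> ?p (\<Union>i<Suc n. A i)"
              using B by (intro SUP_upper) (auto simp: lessThan_Suc)
            finally show ?thesis .
          qed
        qed
        moreover have "(\<Sum>i<Suc n. ?p (A i)) \<le> ?p (\<Union>i<n. A i) + ?p (A n)"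
          using Suc by (simp add: add_right_mono)
        ultimately show ?case by simp
      qed
      show "(\<Sum>i. ?p (A i)) \<le> ?p (\<Union> (range A))"
        unfolding suminf_eq_SUP
      proof (intro SUP_least)
        fix n
        have "?p (\<Union>i<n. A i) \<le> ?p (\<Union> (range A))"
          by (intro SUP_subset_mono) auto
        with fin show "(\<Sum>i<n. ?p (A i)) \<le> ?p (\<Union> (range A))"
          by (rule order_trans)
      qed
    next
      show "?p (\<Union> (range A)) \<le> (\<Sum>i. ?p (A i))"
      proof (intro SUP_least)
        fix B assume B: "B \<in> {B \<in> sets borel. B \<subseteq> \<Union> (range A)}"
        have BA: "B \<inter> A i \<in> sets borel" for i using B Ai by auto
        have "(\<lambda>i. \<mu> (B \<inter> A i)) sums \<mu> (\<Union>i. B \<inter> A i)"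
          using BA dis by (intro signed_measure_sums[OF \<mu>]) (auto simp: disjoint_family_on_def)
        moreover have "(\<Union>i. B \<inter> A i) = B" using B by auto
        ultimately have s: "(\<lambda>n. \<Sum>i<n. \<mu> (B \<inter> A i)) \<longlonglongrightarrow> \<mu> B"
          by (simp add: sums_def)
        have "ennreal (\<Sum>i<n. \<mu> (B \<inter> A i)) \<le> (\<Sum>i. ?p (A i))" for n
        proof -
          have "ennreal (\<Sum>i<n. \<mu> (B \<inter> A i)) \<le> ennreal (\<Sum>i<n. max 0 (\<mu> (B \<inter> A i)))"
            by (intro ennreal_leI sum_mono) auto
          also have "\<dots> = (\<Sum>i<n. ennreal (max 0 (\<mu> (B \<inter> A i))))"
            by (intro sum_ennreal[symmetric]) auto
          also have "\<dots> = (\<Sum>i<n. ennreal (\<mu> (B \<inter> A i)))"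
            by (intro sum.cong refl) (simp add: max_def ennreal_neg)
          also have "\<dots> \<le> (\<Sum>i<n. ?p (A i))"
            using BA by (intro sum_mono SUP_upper) auto
          also have "\<dots> \<le> (\<Sum>i. ?p (A i))"
            by (intro sum_le_suminf) auto
          finally show ?thesis .
        qed
        then show "ennreal (\<mu> B) \<le> (\<Sum>i. ?p (A i))"
          by (intro LIMSEQ_le_const2[OF tendsto_ennrealI[OF s]]) auto
      qed
    qed
  qed
qed

lemma emeasure_neg_variation:
  assumes "signed_measure \<mu>" "A \<in> sets borel"
  shows "emeasure (neg_variation \<mu>) A = (SUP B\<in>{B \<in> sets borel. B \<subseteq> A}. ennreal (- \<mu> B))"
  unfolding neg_variation_def using assms by (intro emeasure_pos_variation signed_measure_uminus)

lemma finite_measure_pos_variation: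
  assumes \<mu>: "signed_measure \<mu>"
  shows "finite_measure (pos_variation \<mu>)"
proof
  obtain C where C: "0 \<le> C" "\<And>A. \<bar>\<mu> A\<bar> \<le> C" using signed_measure_bounded[OF \<mu>] by blast
  have "emeasure (pos_variation \<mu>) UNIV \<le> ennreal C"
    by (subst emeasure_pos_variation[OF \<mu>])
       (auto intro!: SUP_least ennreal_leI intro: order_trans[OF abs_ge_self C(2)])
  then show "emeasure (pos_variation \<mu>) (space (pos_variation \<mu>)) \<noteq> \<infinity>"
    by (auto simp: top_unique)
qed

lemma finite_measure_neg_variation:
  assumes "signed_measure \<mu>"
  shows "finite_measure (neg_variation \<mu>)"
  unfolding neg_variation_def by (intro finite_measure_pos_variation signed_measure_uminus assms)

text \<open>The complementation \<open>B \<mapsto> A - B\<close> turns the supremum of \<open>\<mu> B\<close> over \<open>B \<subseteq> A\<close> into \<open>\<mu> A\<close> plus the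
  supremum of \<open>- \<mu> B\<close>, and both suprema are finite.\<close>

lemma Jordan_decomposition:
  assumes \<mu>: "signed_measure \<mu>" and A: "A \<in> sets borel"
  shows "\<mu> A = measure (pos_variation \<mu>) A - measure (neg_variation \<mu>) A"
proof -
  interpret P: finite_measure "pos_variation \<mu>" by (rule finite_measure_pos_variation[OF \<mu>])
  interpret N: finite_measure "neg_variation \<mu>" by (rule finite_measure_neg_variation[OF \<mu>])
  have P: "\<mu> B \<le> measure (pos_variation \<mu>) A" and N: "- \<mu> B \<le> measure (neg_variation \<mu>) A"
    if "B \<in> sets borel" "B \<subseteq> A" for B
  proof -
    have "ennreal (\<mu> B) \<le> emeasure (pos_variation \<mu>) A"
      using that by (subst emeasure_pos_variation[OF \<mu> A]) (auto intro: SUP_upper)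
    then show "\<mu> B \<le> measure (pos_variation \<mu>) A"
      by (simp add: P.emeasure_eq_measure ennreal_le_iff)
    have "ennreal (- \<mu> B) \<le> emeasure (neg_variation \<mu>) A"
      using that by (subst emeasure_neg_variation[OF \<mu> A]) (auto intro: SUP_upper)
    then show "- \<mu> B \<le> measure (neg_variation \<mu>) A"
      by (simp add: N.emeasure_eq_measure ennreal_le_iff)
  qed
  have d: "\<mu> (A - B) = \<mu> A - \<mu> B" if "B \<in> sets borel" "B \<subseteq> A" for B
    using that by (intro signed_measure_Diff[OF \<mu> A])
  have "emeasure (pos_variation \<mu>) A \<le> ennreal (\<mu> A + measure (neg_variation \<mu>) A)"
  proof (subst emeasure_pos_variation[OF \<mu> A], intro SUP_least ennreal_leI)
    fix B assume "B \<in> {B \<in> sets borel. B \<subseteq> A}"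
    then show "\<mu> B \<le> \<mu> A + measure (neg_variation \<mu>) A"
      using N[of "A - B"] d[of B] A by auto
  qed
  moreover have "emeasure (neg_variation \<mu>) A \<le> ennreal (- \<mu> A + measure (pos_variation \<mu>) A)"
  proof (subst emeasure_neg_variation[OF \<mu> A], intro SUP_least ennreal_leI)
    fix B assume "B \<in> {B \<in> sets borel. B \<subseteq> A}"
    then show "- \<mu> B \<le> - \<mu> A + measure (pos_variation \<mu>) A"
      using P[of "A - B"] d[of B] A by auto
  qed
  moreover have "0 \<le> \<mu> A + measure (neg_variation \<mu>) A" "0 \<le> - \<mu> A + measure (pos_variation \<mu>) A"
    using N[OF A] P[OF A] by auto
  ultimately show ?thesis
    by (simp add: P.emeasure_eq_measure N.emeasure_eq_measure)
qed

lemma signed_integral_integrable: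
  fixes \<phi> :: "'a::topological_space \<Rightarrow> real"
  assumes "signed_measure \<mu>" "\<phi> \<in> borel_measurable borel" "\<And>x. \<bar>\<phi> x\<bar> \<le> C"
  shows "integrable (pos_variation \<mu>) \<phi>" "integrable (neg_variation \<mu>) \<phi>"
  using assms
  by (auto intro!: finite_measure.integrable_const_bound[where B=C]
      finite_measure_pos_variation finite_measure_neg_variation)

lemma signed_integral_indicator:
  assumes "signed_measure \<mu>" "A \<in> sets borel"
  shows "signed_integral \<mu> (indicator A) = \<mu> A"
  using Jordan_decomposition[OF assms] assms(2) by (simp add: signed_integral_def)

lemma signed_integral_add:
  assumes "signed_measure \<mu>" "\<phi> \<in> borel_measurable borel" "\<And>x. \<bar>\<phi> x\<bar> \<le> C"
    "\<psi> \<in> borel_measurable borel" "\<And>x. \<bar>\<psi> x\<bar> \<le> D"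
  shows "signed_integral \<mu> (\<lambda>x. \<phi> x + \<psi> x) = signed_integral \<mu> \<phi> + signed_integral \<mu> \<psi>"
  using signed_integral_integrable[OF assms(1-3)] signed_integral_integrable[OF assms(1,4,5)]
  by (simp add: signed_integral_def)

lemma signed_integral_cmult: "signed_integral \<mu> (\<lambda>x. c * \<phi> x) = c * signed_integral \<mu> \<phi>"
  by (simp add: signed_integral_def right_diff_distrib)

lemma signed_integral_const:
  assumes "signed_measure \<mu>"
  shows "signed_integral \<mu> (\<lambda>x. c) = c * \<mu> UNIV"
  using signed_integral_cmult[of \<mu> c "indicator UNIV"] signed_integral_indicator[OF assms, of UNIV]
  by simp

lemma signed_integral_tendsto:
  fixes \<phi> :: "nat \<Rightarrow> 'a::topological_space \<Rightarrow> real"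
  assumes \<mu>: "signed_measure \<mu>"
    and \<phi>: "\<And>n. \<phi> n \<in> borel_measurable borel" "\<And>n x. \<bar>\<phi> n x\<bar> \<le> C"
    and lim: "\<And>x. (\<lambda>n. \<phi> n x) \<longlonglongrightarrow> \<psi> x"
  shows "(\<lambda>n. signed_integral \<mu> (\<phi> n)) \<longlonglongrightarrow> signed_integral \<mu> \<psi>"
proof -
  interpret P: finite_measure "pos_variation \<mu>" by (rule finite_measure_pos_variation[OF \<mu>])
  interpret N: finite_measure "neg_variation \<mu>" by (rule finite_measure_neg_variation[OF \<mu>])
  have [measurable]: "\<psi> \<in> borel_measurable borel"
    using borel_measurable_LIMSEQ_real[of borel \<phi> \<psi>] lim \<phi> by auto
  note [measurable] = \<phi>(1)
  show ?thesis
    unfolding signed_integral_def using \<phi> lim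
    by (intro tendsto_diff integral_dominated_convergence[where w="\<lambda>_. C"]) auto
qed

lemma tv_norm_finite:
  assumes "signed_measure \<mu>"
  shows "tv_norm \<mu> < \<infinity>"
  using finite_measure.emeasure_finite[OF finite_measure_pos_variation[OF assms], of UNIV]
    finite_measure.emeasure_finite[OF finite_measure_neg_variation[OF assms], of UNIV]
  by (simp add: tv_norm_def less_top)

lemma abs_signed_integral_le:
  fixes \<phi> :: "'a::topological_space \<Rightarrow> real"
  assumes \<mu>: "signed_measure \<mu>" and \<phi>: "\<phi> \<in> borel_measurable borel" "\<And>x. \<bar>\<phi> x\<bar> \<le> C"
  shows "\<bar>signed_integral \<mu> \<phi>\<bar> \<le> C * enn2real (tv_norm \<mu>)"
proof -
  interpret P: finite_measure "pos_variation \<mu>" by (rule finite_measure_pos_variation[OF \<mu>])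
  interpret N: finite_measure "neg_variation \<mu>" by (rule finite_measure_neg_variation[OF \<mu>])
  note int = signed_integral_integrable[OF \<mu> \<phi>]
  have "\<bar>\<integral>x. \<phi> x \<partial>pos_variation \<mu>\<bar> \<le> (\<integral>x. C \<partial>pos_variation \<mu>)"
    using int \<phi> by (intro order_trans[OF integral_abs_bound] integral_mono) auto
  moreover have "\<bar>\<integral>x. \<phi> x \<partial>neg_variation \<mu>\<bar> \<le> (\<integral>x. C \<partial>neg_variation \<mu>)"
    using int \<phi> by (intro order_trans[OF integral_abs_bound] integral_mono) auto
  moreover have "enn2real (tv_norm \<mu>) = measure (pos_variation \<mu>) UNIV + measure (neg_variation \<mu>) UNIV"
    by (simp add: tv_norm_def P.emeasure_eq_measure N.emeasure_eq_measure enn2real_plus)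
  ultimately show ?thesis
    unfolding signed_integral_def by (simp add: algebra_simps)
qed

lemma signed_measure_of_finite_measure:
  fixes M :: "'a::topological_space measure"
  assumes M: "finite_measure M" and [simp]: "sets M = sets borel"
  shows "signed_measure (measure M)"
  unfolding signed_measure_def
proof (intro conjI allI impI)
  interpret finite_measure M by fact
  show "measure M A = 0" if "A \<notin> sets borel" for A
    using that by (simp add: measure_notin_sets)
  show "(\<lambda>i. measure M (A i)) sums measure M (\<Union>i. A i)"
    if "range A \<subseteq> sets borel" "disjoint_family A" for A :: "nat \<Rightarrow> 'a set"
    using that by (intro finite_measure_UNION) auto
qed simp

lemma pos_variation_positive:
  assumes \<mu>: "positive_measure \<mu>" and A: "A \<in> sets borel"
  shows "emeasure (pos_variation \<mu>) A = ennreal (\<mu> A)" "emeasure (neg_variation \<mu>) A = 0"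
proof -
  have s: "signed_measure \<mu>" and p: "\<And>B. B \<in> sets borel \<Longrightarrow> 0 \<le> \<mu> B"
    using \<mu> by (auto simp: positive_measure_def)
  have mono: "\<mu> B \<le> \<mu> A" if "B \<in> sets borel" "B \<subseteq> A" for B
    using signed_measure_Diff[OF s A that] p[of "A - B"] A that by auto
  show "emeasure (pos_variation \<mu>) A = ennreal (\<mu> A)"
    by (subst emeasure_pos_variation[OF s A])
       (use A mono in \<open>auto intro!: antisym SUP_least SUP_upper ennreal_leI\<close>)
  have "ennreal (- \<mu> B) = 0" if "B \<in> sets borel" for B
    using p[OF that] by (simp add: ennreal_neg)
  then show "emeasure (neg_variation \<mu>) A = 0"
    by (subst emeasure_neg_variation[OF s A]) (auto intro!: antisym SUP_least)
qed

lemma positive_measure_of_finite_measure: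
  assumes "finite_measure M" "sets M = sets borel"
  shows "positive_measure (measure M)"
  using signed_measure_of_finite_measure[OF assms] by (simp add: positive_measure_def)

lemma signed_integral_positive:
  assumes \<mu>: "positive_measure \<mu>"
  shows "signed_integral \<mu> \<phi> = (\<integral>x. \<phi> x \<partial>pos_variation \<mu>)"
proof -
  have "neg_variation \<mu> = null_measure borel"
    by (rule measure_eqI) (auto simp: pos_variation_positive[OF \<mu>])
  then show ?thesis by (simp add: signed_integral_def integral_null_measure)
qed

lemma signed_integral_finite_measure:
  fixes M :: "'a::topological_space measure"
  assumes M: "finite_measure M" "sets M = sets borel"
  shows "signed_integral (measure M) \<phi> = (\<integral>x. \<phi> x \<partial>M)"
proof -
  interpret finite_measure M by fact
  have "pos_variation (measure M) = M"
    by (rule measure_eqI)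
       (auto simp: M emeasure_eq_measure pos_variation_positive[OF positive_measure_of_finite_measure[OF M]])
  then show ?thesis
    by (simp add: signed_integral_positive[OF positive_measure_of_finite_measure[OF M]])
qed

lemma signed_integral_mono_positive:
  fixes \<phi> \<psi> :: "'a::topological_space \<Rightarrow> real"
  assumes \<mu>: "positive_measure \<mu>"
    and "\<phi> \<in> borel_measurable borel" "\<And>x. \<bar>\<phi> x\<bar> \<le> C"
    and "\<psi> \<in> borel_measurable borel" "\<And>x. \<bar>\<psi> x\<bar> \<le> D"
    and "\<And>x. \<phi> x \<le> \<psi> x"
  shows "signed_integral \<mu> \<phi> \<le> signed_integral \<mu> \<psi>"
proof -
  have "signed_measure \<mu>" using \<mu> by (simp add: positive_measure_def)
  then show ?thesis
    unfolding signed_integral_positive[OF \<mu>] using assms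
    by (intro integral_mono signed_integral_integrable) auto
qed

lemma signed_integral_nonneg:
  assumes "positive_measure \<mu>" "\<And>x. 0 \<le> \<phi> x"
  shows "0 \<le> signed_integral \<mu> \<phi>"
  using assms by (simp add: signed_integral_positive)

section \<open>Monotone classes of bounded Borel functions\<close>

text \<open>The uniform bound in the limit case makes the rule applicable to functionals that are continuous
  under dominated convergence on a finite measure.\<close>

lemma bounded_borel_induct [consumes 2, case_names indicator add cmult lim]:
  fixes P :: "('a::topological_space \<Rightarrow> real) \<Rightarrow> bool"
  assumes \<phi>: "\<phi> \<in> borel_measurable borel" "\<And>x. \<bar>\<phi> x\<bar> \<le> C"
    and indicator: "\<And>A. A \<in> sets borel \<Longrightarrow> P (indicator A)"
    and add: "\<And>\<phi> \<psi> C D. \<phi> \<in> borel_measurable borel \<Longrightarrow> (\<And>x. \<bar>\<phi> x\<bar> \<le> C) \<Longrightarrow> P \<phi> \<Longrightarrow>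
      \<psi> \<in> borel_measurable borel \<Longrightarrow> (\<And>x. \<bar>\<psi> x\<bar> \<le> D) \<Longrightarrow> P \<psi> \<Longrightarrow> P (\<lambda>x. \<phi> x + \<psi> x)"
    and cmult: "\<And>\<phi> C c. \<phi> \<in> borel_measurable borel \<Longrightarrow> (\<And>x. \<bar>\<phi> x\<bar> \<le> C) \<Longrightarrow> P \<phi> \<Longrightarrow> P (\<lambda>x. c * \<phi> x)"
    and lim: "\<And>\<Phi> \<phi> C. (\<And>n::nat. \<Phi> n \<in> borel_measurable borel) \<Longrightarrow> (\<And>n x. \<bar>\<Phi> n x\<bar> \<le> C) \<Longrightarrow>
      (\<And>n. P (\<Phi> n)) \<Longrightarrow> (\<And>x. (\<lambda>n. \<Phi> n x) \<longlonglongrightarrow> \<phi> x) \<Longrightarrow> P \<phi>"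
  shows "P \<phi>"
proof -
  obtain F where F: "\<And>i. simple_function borel (F i)" "\<And>x. (\<lambda>i. F i x) \<longlonglongrightarrow> \<phi> x"
    "\<And>i x. dist (F i x) 0 \<le> 2 * dist (\<phi> x) 0"
    using borel_measurable_implies_sequence_metric[OF \<phi>(1), of 0] by auto
  have bd: "\<bar>F i x\<bar> \<le> 2 * C" for i x
    using F(3)[of i x] \<phi>(2)[of x] by simp
  have simple: "P g" if g: "simple_function borel g" "\<And>x. \<bar>g x\<bar> \<le> D" for g :: "'a \<Rightarrow> real" and D
  proof -
    have fin: "finite (range g)" using simple_functionD(1)[OF g(1)] by simp
    have meas: "g -` {y} \<in> sets borel" for y
      using simple_functionD(2)[OF g(1), of "{y}"] by simp
    have ind: "(indicator A :: 'a \<Rightarrow> real) \<in> borel_measurable borel" "\<And>x. \<bar>indicator A x :: real\<bar> \<le> 1"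
      if "A \<in> sets borel" for A :: "'a set"
      using that by (auto simp: indicator_def)
    define S where "S Y x = (\<Sum>y\<in>Y. y * indicator (g -` {y}) x)" for Y and x :: 'a
    have S_insert: "S (insert y Y) = (\<lambda>x. y * indicator (g -` {y}) x + S Y x)" if "finite Y" "y \<notin> Y" for y Y
      unfolding S_def by (rule ext, subst sum.insert[OF that]) (rule refl)
    have "P (S Y) \<and> S Y \<in> borel_measurable borel \<and> (\<forall>x. \<bar>S Y x\<bar> \<le> (\<Sum>y\<in>Y. \<bar>y\<bar>))" if "finite Y" for Y
      using that
    proof (induction Y)
      case empty
      show ?case using cmult[OF ind indicator[of "{}"], of 0] by (simp add: S_def[abs_def])
    next
      case (insert y Y)
      have 1: "(\<lambda>x. y * indicator (g -` {y}) x) \<in> borel_measurable borel"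
        "\<And>x. \<bar>y * indicator (g -` {y}) x\<bar> \<le> \<bar>y\<bar>"
        using ind[OF meas] by (auto intro!: borel_measurable_times simp: abs_mult mult_left_le)
      have "P (\<lambda>x. y * indicator (g -` {y}) x)"
        using meas by (intro cmult[OF ind indicator])
      from add[OF 1 this] insert
      have "P (\<lambda>x. y * indicator (g -` {y}) x + S Y x)"
        by blast
      moreover have "\<bar>y * indicator (g -` {y}) x + S Y x\<bar> \<le> \<bar>y\<bar> + (\<Sum>y\<in>Y. \<bar>y\<bar>)" for x
        using insert 1(2)[of x] by (intro order_trans[OF abs_triangle_ineq] add_mono) auto
      ultimately show ?case
        using insert 1 by (simp add: S_insert borel_measurable_add)
    qed
    from this[OF fin] have "P (S (range g))" by simp
    moreover have "S (range g) = g"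
    proof
      fix x
      have "S (range g) x = (\<Sum>y\<in>range g. if y = g x then y else 0)"
        unfolding S_def by (intro sum.cong) (auto simp: indicator_def)
      then show "S (range g) x = g x" using fin by simp
    qed
    ultimately show ?thesis by simp
  qed
  show ?thesis
  proof (rule lim[of F "2 * C"])
    show "P (F n)" for n by (rule simple[OF F(1) bd])
  qed (use F bd in \<open>auto intro: borel_measurable_simple_function\<close>)
qed

lemma C0_measurable: "\<phi> \<in> C0 \<Longrightarrow> \<phi> \<in> borel_measurable borel"
  unfolding C0_def by (auto intro: borel_measurable_continuous_onI)

lemma C0_bounded:
  fixes \<phi> :: "'a::euclidean_space \<Rightarrow> real"
  assumes "\<phi> \<in> C0"
  obtains C where "0 \<le> C" "\<And>x. \<bar>\<phi> x\<bar> \<le> C"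
proof -
  have c: "continuous_on UNIV \<phi>" and l: "(\<phi> \<longlongrightarrow> 0) at_infinity" using assms by (auto simp: C0_def)
  have "eventually (\<lambda>x. \<bar>\<phi> x\<bar> < 1) at_infinity"
    using tendstoD[OF l, of 1] by (simp add: dist_real_def)
  then obtain b where b: "\<And>x. b \<le> norm x \<Longrightarrow> \<bar>\<phi> x\<bar> < 1"
    by (auto simp: eventually_at_infinity)
  have "bounded (\<phi> ` cball 0 b)"
    by (intro compact_imp_bounded compact_continuous_image continuous_on_subset[OF c]) auto
  then obtain B where B: "\<And>x. norm x \<le> b \<Longrightarrow> \<bar>\<phi> x\<bar> \<le> B"
    unfolding bounded_iff by (metis imageI mem_cball_0 real_norm_def)
  have "\<bar>\<phi> x\<bar> \<le> max 1 B" for x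
    using b[of x] B[of x] by (cases "b \<le> norm x") (auto simp: le_max_iff_disj)
  then show thesis by (intro that[of "max 1 B"]) auto
qed

lemma C0_compact_support:
  fixes \<phi> :: "'a::euclidean_space \<Rightarrow> real"
  assumes "continuous_on UNIV \<phi>" "bounded U" "\<And>x. x \<notin> U \<Longrightarrow> \<phi> x = 0"
  shows "\<phi> \<in> C0"
proof -
  obtain b where b: "\<And>x. x \<in> U \<Longrightarrow> norm x \<le> b" using assms(2) by (auto simp: bounded_iff)
  have "\<phi> x = 0" if "b + 1 \<le> norm x" for x
    using b[of x] assms(3)[of x] that by fastforce
  then have "eventually (\<lambda>x. \<phi> x = 0) at_infinity"
    by (auto simp: eventually_at_infinity)
  then show ?thesis using assms(1) by (simp add: C0_def tendsto_eventually)
qed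

text \<open>Bounded boxes form an intersection-stable generator, and the indicator of a box \<open>U\<close> is the
  increasing limit of the functions \<open>min 1 (n * infdist x (- U))\<close>, which vanish at infinity.\<close>

lemma C0_bounded_borel_induct [consumes 2, case_names C0 add cmult lim]:
  fixes P :: "('a::euclidean_space \<Rightarrow> real) \<Rightarrow> bool"
  assumes \<phi>: "\<phi> \<in> borel_measurable borel" "\<And>x. \<bar>\<phi> x\<bar> \<le> C"
    and C0: "\<And>\<phi>. \<phi> \<in> C0 \<Longrightarrow> P \<phi>"
    and add: "\<And>\<phi> \<psi> C D. \<phi> \<in> borel_measurable borel \<Longrightarrow> (\<And>x. \<bar>\<phi> x\<bar> \<le> C) \<Longrightarrow> P \<phi> \<Longrightarrow>
      \<psi> \<in> borel_measurable borel \<Longrightarrow> (\<And>x. \<bar>\<psi> x\<bar> \<le> D) \<Longrightarrow> P \<psi> \<Longrightarrow> P (\<lambda>x. \<phi> x + \<psi> x)"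
    and cmult: "\<And>\<phi> C c. \<phi> \<in> borel_measurable borel \<Longrightarrow> (\<And>x. \<bar>\<phi> x\<bar> \<le> C) \<Longrightarrow> P \<phi> \<Longrightarrow> P (\<lambda>x. c * \<phi> x)"
    and lim: "\<And>\<Phi> \<phi> C. (\<And>n::nat. \<Phi> n \<in> borel_measurable borel) \<Longrightarrow> (\<And>n x. \<bar>\<Phi> n x\<bar> \<le> C) \<Longrightarrow>
      (\<And>n. P (\<Phi> n)) \<Longrightarrow> (\<And>x. (\<lambda>n. \<Phi> n x) \<longlonglongrightarrow> \<phi> x) \<Longrightarrow> P \<phi>"
  shows "P \<phi>"
proof -
  have ind: "(indicator A :: 'a \<Rightarrow> real) \<in> borel_measurable borel" "\<And>x. \<bar>indicator A x :: real\<bar> \<le> 1"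
    if "A \<in> sets borel" for A :: "'a set"
    using that by (auto simp: indicator_def)
  have box: "P (indicator (box a b))" for a b :: 'a
  proof (rule lim[of "\<lambda>n x. min 1 (real n * infdist x (- box a b))" 1])
    let ?U = "box a b"
    have ne: "- ?U \<noteq> {}"
      using bounded_box[of a b] not_bounded_UNIV[where 'a='a] by (metis Compl_UNIV_eq double_compl)
    fix n
    show "P (\<lambda>x. min 1 (real n * infdist x (- ?U)))"
      by (intro C0 C0_compact_support[where U="?U"] continuous_intros bounded_box) auto
    show "(\<lambda>x. min 1 (real n * infdist x (- ?U))) \<in> borel_measurable borel"
      by (intro borel_measurable_continuous_onI continuous_intros)
    fix x
    show "\<bar>min 1 (real n * infdist x (- ?U))\<bar> \<le> 1"
      using infdist_nonneg[of x "- ?U"] by (auto simp: abs_le_iff min_def)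
    show "(\<lambda>n. min 1 (real n * infdist x (- ?U))) \<longlonglongrightarrow> indicator ?U x"
    proof (cases "x \<in> ?U")
      case True
      have "0 < infdist x (- ?U)"
        using infdist_pos_not_in_closed[of "- ?U" x] ne True by (simp add: closed_Compl open_box)
      then obtain m where m: "1 < real m * infdist x (- ?U)" by (metis reals_Archimedean3)
      have "min 1 (real n * infdist x (- ?U)) = 1" if "m \<le> n" for n
      proof -
        have "real m * infdist x (- ?U) \<le> real n * infdist x (- ?U)"
          using that by (intro mult_right_mono infdist_nonneg) auto
        then show ?thesis using m by simp
      qed
      then have "eventually (\<lambda>n. min 1 (real n * infdist x (- ?U)) = 1) sequentially"
        by (auto simp: eventually_sequentially)
      then show ?thesis using True by (simp add: tendsto_eventually)
    qed simp
  qed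
  have one: "P (indicator UNIV)"
  proof (rule lim[of "\<lambda>n. indicator (box (- real n *\<^sub>R One) (real n *\<^sub>R One))" 1])
    fix x :: 'a
    obtain m where m: "norm x < real m" using reals_Archimedean2 by blast
    have "x \<in> box (- real n *\<^sub>R One) (real n *\<^sub>R One)" if "m \<le> n" for n
    proof -
      have "norm x < real n" using m that by (meson le_less_trans not_less of_nat_le_iff)
      then have "- real n < x \<bullet> i \<and> x \<bullet> i < real n" if "i \<in> Basis" for i
        using Basis_le_norm[OF that, of x] by linarith
      then show ?thesis by (simp add: mem_box)
    qed
    then have "eventually (\<lambda>n. indicator (box (- real n *\<^sub>R One) (real n *\<^sub>R One)) x = (1::real)) sequentially"
      unfolding eventually_sequentially by (intro exI[of _ m]) (auto simp: indicator_def)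
    then show "(\<lambda>n. indicator (box (- real n *\<^sub>R One) (real n *\<^sub>R One)) x) \<longlonglongrightarrow> (indicator UNIV x :: real)"
      by (simp add: tendsto_eventually)
  qed (use box ind in auto)
  have indicator: "P (indicator A)" if A: "A \<in> sets borel" for A :: "'a set"
  proof -
    have gen: "sets (borel :: 'a measure) = sigma_sets UNIV (range (\<lambda>(a, b). box a b))"
      by (subst borel_eq_box) simp
    have "Int_stable (range (\<lambda>(a, b). box a b :: 'a set))"
      by (auto simp: Int_stable_def box_Int_box)
    moreover have "range (\<lambda>(a, b). box a b :: 'a set) \<subseteq> Pow UNIV" by simp
    moreover note A[unfolded gen]
    ultimately show ?thesis
    proof (induction rule: sigma_sets_induct_disjoint)
      case (basic A)
      then show ?case using box by auto
    next
      case empty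
      have "box 0 0 = ({} :: 'a set)" by simp
      then show ?case using box[of 0 0] by (simp only:)
    next
      case (compl A)
      then have [measurable]: "A \<in> sets borel" by (simp add: gen)
      have "P (\<lambda>x. indicator UNIV x + (-1) * indicator A x)"
        using compl by (intro add[of _ 1 _ 1] cmult[of _ 1] one ind) (auto simp: indicator_def)
      moreover have "(\<lambda>x. indicator UNIV x + (-1) * indicator A x) = (indicator (UNIV - A) :: 'a \<Rightarrow> real)"
        by (auto simp: fun_eq_iff indicator_def)
      ultimately show ?case by simp
    next
      case (union A)
      then have A: "A i \<in> sets borel" for i by (auto simp: gen)
      have fin: "P (indicator (\<Union>i<n. A i))" for n
      proof (induction n)
        case 0
        have "box 0 0 = ({} :: 'a set)" by simp
        then show ?case using box[of 0 0] by (simp only: lessThan_0 UN_empty)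
      next
        case (Suc n)
        have "P (\<lambda>x. indicator (\<Union>i<n. A i) x + indicator (A n) x)"
          using A by (intro add[of _ 1 _ 1] Suc union ind) (auto simp: indicator_def)
        moreover have "(\<lambda>x. indicator (\<Union>i<n. A i) x + indicator (A n) x) = (indicator (\<Union>i<Suc n. A i) :: 'a \<Rightarrow> real)"
        proof
          fix x
          have "A i \<inter> A n = {}" if "i < n" for i
            using union(1) that by (auto simp: disjoint_family_on_def)
          then have "(\<Union>i<n. A i) \<inter> A n = {}" by blast
          then show "indicator (\<Union>i<n. A i) x + indicator (A n) x = (indicator (\<Union>i<Suc n. A i) x :: real)"
            by (auto simp: indicator_def lessThan_Suc)
        qed
        ultimately show ?case by simp
      qed
      show ?case
      proof (rule lim[of "\<lambda>n. indicator (\<Union>i<n. A i)" 1])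
        show "(\<lambda>n. indicator (\<Union>i<n. A i) x) \<longlonglongrightarrow> (indicator (\<Union>i. A i) x :: real)" for x
          by (rule LIMSEQ_indicator_UN)
      qed (use fin A in \<open>auto simp: indicator_def\<close>)
    qed
  qed
  show ?thesis
    using \<phi> by (induction rule: bounded_borel_induct) (fact indicator, fact add, fact cmult, fact lim)
qed

lemma signed_measure_eqI:
  assumes \<mu>: "signed_measure \<mu>" and \<nu>: "signed_measure \<nu>"
    and eq: "\<And>A. A \<in> sets borel \<Longrightarrow> \<mu> A = \<nu> A"
  shows "\<mu> = \<nu>"
proof
  fix A show "\<mu> A = \<nu> A"
    using eq[of A] signed_measure_outside[OF \<mu>, of A] signed_measure_outside[OF \<nu>, of A] by argo
qed

lemma signed_measure_eqI_C0:
  fixes \<mu> \<nu> :: "'a::euclidean_space set \<Rightarrow> real"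
  assumes \<mu>: "signed_measure \<mu>" and \<nu>: "signed_measure \<nu>"
    and eq: "\<And>\<phi>. \<phi> \<in> C0 \<Longrightarrow> signed_integral \<mu> \<phi> = signed_integral \<nu> \<phi>"
  shows "\<mu> = \<nu>"
proof (rule signed_measure_eqI[OF \<mu> \<nu>])
  fix A :: "'a set" assume A: "A \<in> sets borel"
  have "signed_integral \<mu> \<phi> = signed_integral \<nu> \<phi>"
    if "\<phi> \<in> borel_measurable borel" "\<And>x. \<bar>\<phi> x\<bar> \<le> C" for \<phi> :: "'a \<Rightarrow> real" and C
    using that
  proof (induction rule: C0_bounded_borel_induct)
    case (add \<phi> \<psi> C D)
    show ?case
      using signed_integral_add[OF \<mu> add.hyps] signed_integral_add[OF \<nu> add.hyps] add.IH by simp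
  next
    case (lim \<Phi> \<phi> C)
    show ?case
      using signed_integral_tendsto[OF \<mu> lim.hyps, unfolded lim.IH] signed_integral_tendsto[OF \<nu> lim.hyps]
      by (rule LIMSEQ_unique)
  qed (auto simp: eq signed_integral_cmult)
  from this[of "indicator A" 1] show "\<mu> A = \<nu> A"
    using A by (auto simp: signed_integral_indicator[OF \<mu>] signed_integral_indicator[OF \<nu>] indicator_def)
qed

text \<open>A Daniell-type representation: dominated continuity of \<open>L\<close> is countable additivity on
  indicators, and it extends the representation from indicators to bounded Borel functions.\<close>

lemma signed_measure_of_continuous_functional:
  fixes L :: "('a::topological_space \<Rightarrow> real) \<Rightarrow> real"
  assumes add: "\<And>\<phi> \<psi> C D. \<phi> \<in> borel_measurable borel \<Longrightarrow> (\<And>x. \<bar>\<phi> x\<bar> \<le> C) \<Longrightarrow>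
      \<psi> \<in> borel_measurable borel \<Longrightarrow> (\<And>x. \<bar>\<psi> x\<bar> \<le> D) \<Longrightarrow> L (\<lambda>x. \<phi> x + \<psi> x) = L \<phi> + L \<psi>"
    and cmult: "\<And>\<phi> C c. \<phi> \<in> borel_measurable borel \<Longrightarrow> (\<And>x. \<bar>\<phi> x\<bar> \<le> C) \<Longrightarrow> L (\<lambda>x. c * \<phi> x) = c * L \<phi>"
    and lim: "\<And>\<Phi> \<phi> C. (\<And>n::nat. \<Phi> n \<in> borel_measurable borel) \<Longrightarrow> (\<And>n x. \<bar>\<Phi> n x\<bar> \<le> C) \<Longrightarrow>
      (\<And>x. (\<lambda>n. \<Phi> n x) \<longlonglongrightarrow> \<phi> x) \<Longrightarrow> (\<lambda>n. L (\<Phi> n)) \<longlonglongrightarrow> L \<phi>"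
  defines "\<mu> \<equiv> \<lambda>A. if A \<in> sets borel then L (indicator A) else 0"
  shows "signed_measure \<mu>"
    and "\<And>\<phi> C. \<phi> \<in> borel_measurable borel \<Longrightarrow> (\<And>x. \<bar>\<phi> x\<bar> \<le> C) \<Longrightarrow> signed_integral \<mu> \<phi> = L \<phi>"
proof -
  have ind: "(indicator A :: 'a \<Rightarrow> real) \<in> borel_measurable borel" "\<And>x. \<bar>indicator A x :: real\<bar> \<le> 1"
    if "A \<in> sets borel" for A :: "'a set"
    using that by (auto simp: indicator_def)
  have L0: "L (indicator {}) = 0"
  proof -
    have "L (\<lambda>x. 0 * indicator {} x) = 0 * L (indicator {})" by (rule cmult[OF ind]) auto
    moreover have "(\<lambda>x. 0 * indicator {} x) = (indicator {} :: 'a \<Rightarrow> real)" by auto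
    ultimately show ?thesis by simp
  qed
  show \<mu>: "signed_measure \<mu>"
    unfolding signed_measure_def
  proof (intro conjI allI impI)
    show "\<mu> {} = 0" by (simp add: \<mu>_def L0)
    show "\<mu> A = 0" if "A \<notin> sets borel" for A using that by (simp add: \<mu>_def)
    fix A :: "nat \<Rightarrow> 'a set" assume "range A \<subseteq> sets borel" and dis: "disjoint_family A"
    then have A: "A i \<in> sets borel" for i by auto
    have fin: "(\<Sum>i<n. \<mu> (A i)) = L (indicator (\<Union>i<n. A i))" for n
    proof (induction n)
      case 0
      have "(\<Union>i<0. A i) = {}" by simp
      then show ?case using L0 by (simp only: lessThan_0 sum.empty UN_empty)
    next
      case (Suc n)
      have "A i \<inter> A n = {}" if "i < n" for i
        using dis that by (auto simp: disjoint_family_on_def)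
      then have "(\<Union>i<n. A i) \<inter> A n = {}" by blast
      then have "(indicator (\<Union>i<Suc n. A i) :: 'a \<Rightarrow> real) = (\<lambda>x. indicator (\<Union>i<n. A i) x + indicator (A n) x)"
        by (auto simp: indicator_def lessThan_Suc fun_eq_iff)
      moreover have "L (\<lambda>x. indicator (\<Union>i<n. A i) x + indicator (A n) x) = L (indicator (\<Union>i<n. A i)) + L (indicator (A n))"
        using A by (intro add[of _ 1 _ 1] ind) (auto simp: indicator_def)
      ultimately show ?case using Suc A by (simp add: \<mu>_def)
    qed
    have "(\<lambda>n. L (indicator (\<Union>i<n. A i))) \<longlonglongrightarrow> L (indicator (\<Union>i. A i))"
    proof (rule lim[of _ 1])
      show "(\<lambda>n. indicator (\<Union>i<n. A i) x) \<longlonglongrightarrow> (indicator (\<Union>i. A i) x :: real)" for x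
        by (rule LIMSEQ_indicator_UN)
    qed (use A in \<open>auto simp: indicator_def\<close>)
    then show "(\<lambda>i. \<mu> (A i)) sums \<mu> (\<Union>i. A i)"
      using A by (simp add: sums_def fin) (simp add: \<mu>_def)
  qed
  show "signed_integral \<mu> \<phi> = L \<phi>" if "\<phi> \<in> borel_measurable borel" "\<And>x. \<bar>\<phi> x\<bar> \<le> C" for \<phi> C
    using that
  proof (induction rule: bounded_borel_induct)
    case (indicator A)
    then show ?case by (simp add: signed_integral_indicator[OF \<mu>]) (simp add: \<mu>_def)
  next
    case (add \<phi> \<psi> C D)
    show ?case
      using signed_integral_add[OF \<mu> add.hyps] assms(1)[OF add.hyps] add.IH by simp
  next
    case (cmult \<phi> C c)
    show ?case
      using assms(2)[OF cmult.hyps] cmult.IH by (simp add: signed_integral_cmult)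
  next
    case (lim \<Phi> \<phi> C)
    show ?case
      using signed_integral_tendsto[OF \<mu> lim.hyps, unfolded lim.IH] assms(3)[OF lim.hyps]
      by (rule LIMSEQ_unique)
  qed
qed

lemma signed_integral_scale:
  assumes \<mu>: "signed_measure \<mu>" and \<phi>: "\<phi> \<in> borel_measurable borel" "\<And>x. \<bar>\<phi> x\<bar> \<le> C"
  shows "signed_integral (\<lambda>A. c * \<mu> A) \<phi> = c * signed_integral \<mu> \<phi>"
  using \<phi>
proof (induction rule: bounded_borel_induct)
  case (indicator A)
  then show ?case
    using signed_integral_indicator[OF signed_measure_cmult[OF \<mu>], of A c] signed_integral_indicator[OF \<mu>, of A] by simp
next
  case (add \<phi> \<psi> C D)
  show ?case
    using signed_integral_add[OF signed_measure_cmult[OF \<mu>, of c] add.hyps] signed_integral_add[OF \<mu> add.hyps] add.IH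
    by (simp add: distrib_left)
next
  case (cmult \<phi> C d)
  then show ?case by (simp add: signed_integral_cmult)
next
  case (lim \<Phi> \<phi> C)
  show ?case
    using signed_integral_tendsto[OF signed_measure_cmult[OF \<mu>, of c] lim.hyps, unfolded lim.IH]
      tendsto_mult_left[OF signed_integral_tendsto[OF \<mu> lim.hyps]]
    by (rule LIMSEQ_unique)
qed

lemma positive_measure_cmult:
  assumes "positive_measure \<mu>" "0 \<le> c"
  shows "positive_measure (\<lambda>A. c * \<mu> A)"
  using assms by (auto simp: positive_measure_def signed_measure_cmult)

section \<open>Convolution of a finite measure with a signed measure\<close>

lemma translation_average_measurable:
  fixes \<phi> :: "'a::euclidean_space \<Rightarrow> real"
  assumes M: "finite_measure M" and sets[measurable_cong]: "sets M = sets borel"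
    and \<phi>[measurable]: "\<phi> \<in> borel_measurable borel"
  shows "(\<lambda>y. \<integral>x. \<phi> (x + y) \<partial>M) \<in> borel_measurable borel"
proof -
  interpret finite_measure M by fact
  show ?thesis by measurable
qed

lemma translation_average_bounded:
  fixes \<phi> :: "'a::euclidean_space \<Rightarrow> real"
  assumes M: "finite_measure M" and sets[measurable_cong]: "sets M = sets borel"
    and \<phi>[measurable]: "\<phi> \<in> borel_measurable borel" and C: "\<And>x. \<bar>\<phi> x\<bar> \<le> C"
  shows "integrable M (\<lambda>x. \<phi> (x + y))" "\<bar>\<integral>x. \<phi> (x + y) \<partial>M\<bar> \<le> C * measure M UNIV"
proof -
  interpret finite_measure M by fact
  have [simp]: "space M = UNIV" using sets_eq_imp_space_eq[OF sets] by simp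
  show int: "integrable M (\<lambda>x. \<phi> (x + y))"
    using C by (intro integrable_const_bound[where B=C]) auto
  have "\<bar>\<integral>x. \<phi> (x + y) \<partial>M\<bar> \<le> (\<integral>x. C \<partial>M)"
    using int C by (intro order_trans[OF integral_abs_bound] integral_mono) auto
  then show "\<bar>\<integral>x. \<phi> (x + y) \<partial>M\<bar> \<le> C * measure M UNIV" by (simp add: mult.commute)
qed

text \<open>The defining property speaks of functions vanishing at infinity only. It determines the
  measure uniquely, and the functional on the right-hand side already defines a signed measure.\<close>

lemma signed_convolution:
  fixes M :: "'a::euclidean_space measure"
  assumes M: "finite_measure M" and sets: "sets M = sets borel" and \<mu>: "signed_measure \<mu>"
  shows "signed_measure (signed_convolution (measure M) \<mu>)"
    and "\<And>\<phi> C. \<phi> \<in> borel_measurable borel \<Longrightarrow> (\<And>x. \<bar>\<phi> x\<bar> \<le> C) \<Longrightarrow>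
      signed_integral (signed_convolution (measure M) \<mu>) \<phi> =
        signed_integral \<mu> (\<lambda>y. \<integral>x. \<phi> (x + y) \<partial>M)"
proof -
  define L where "L \<phi> = signed_integral \<mu> (\<lambda>y. \<integral>x. \<phi> (x + y) \<partial>M)" for \<phi> :: "'a \<Rightarrow> real"
  define \<rho> where "\<rho> A = (if A \<in> sets borel then L (indicator A) else 0)" for A
  note meas = translation_average_measurable[OF M sets]
  note bd = translation_average_bounded[OF M sets]
  have add: "L (\<lambda>x. \<phi> x + \<psi> x) = L \<phi> + L \<psi>"
    if "\<phi> \<in> borel_measurable borel" "\<And>x. \<bar>\<phi> x\<bar> \<le> C" "\<psi> \<in> borel_measurable borel" "\<And>x. \<bar>\<psi> x\<bar> \<le> D"
    for \<phi> \<psi> C D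
    unfolding L_def
    by (subst Bochner_Integration.integral_add[OF bd(1)[OF that(1,2)] bd(1)[OF that(3,4)]])
       (rule signed_integral_add[OF \<mu> meas[OF that(1)] bd(2)[OF that(1,2)] meas[OF that(3)] bd(2)[OF that(3,4)]])
  have cmult: "L (\<lambda>x. c * \<phi> x) = c * L \<phi>" for c \<phi>
    unfolding L_def by (simp add: signed_integral_cmult)
  have lim: "(\<lambda>n. L (\<Phi> n)) \<longlonglongrightarrow> L \<phi>"
    if \<Phi>: "\<And>n::nat. \<Phi> n \<in> borel_measurable borel" "\<And>n x. \<bar>\<Phi> n x\<bar> \<le> C" "\<And>x. (\<lambda>n. \<Phi> n x) \<longlonglongrightarrow> \<phi> x"
    for \<Phi> \<phi> C
    unfolding L_def
  proof (rule signed_integral_tendsto[OF \<mu>])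
    interpret finite_measure M by fact
    fix n show "(\<lambda>y. \<integral>x. \<Phi> n (x + y) \<partial>M) \<in> borel_measurable borel" by (rule meas[OF \<Phi>(1)])
    fix y
    show "\<bar>\<integral>x. \<Phi> n (x + y) \<partial>M\<bar> \<le> C * measure M UNIV" by (rule bd(2)[OF \<Phi>(1,2)])
    have [measurable]: "\<phi> \<in> borel_measurable borel"
      using borel_measurable_LIMSEQ_real[of borel \<Phi> \<phi>] \<Phi> by auto
    note [measurable] = \<Phi>(1) and [measurable_cong] = sets
    show "(\<lambda>n. \<integral>x. \<Phi> n (x + y) \<partial>M) \<longlonglongrightarrow> (\<integral>x. \<phi> (x + y) \<partial>M)"
      using \<Phi>(2,3) by (intro integral_dominated_convergence[where w="\<lambda>_. C"]) auto
  qed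
  have \<rho>1: "signed_measure \<rho>"
    unfolding \<rho>_def[abs_def]
    by (rule signed_measure_of_continuous_functional(1)[of L]) (fact add, rule cmult, fact lim)
  have \<rho>2: "signed_integral \<rho> \<phi> = L \<phi>" if "\<phi> \<in> borel_measurable borel" "\<And>x. \<bar>\<phi> x\<bar> \<le> C" for \<phi> C
    unfolding \<rho>_def[abs_def]
    by (rule signed_measure_of_continuous_functional(2)[of L]) (fact add, rule cmult, fact lim, fact that(1), fact that(2))
  have "signed_convolution (measure M) \<mu> = \<rho>"
    unfolding signed_convolution_def
  proof (rule the_equality)
    have *: "signed_integral (measure M) (\<lambda>x. \<phi> (x + y)) = (\<integral>x. \<phi> (x + y) \<partial>M)" for \<phi> y
      by (rule signed_integral_finite_measure[OF M sets])
    have L: "signed_integral \<rho> \<phi> = L \<phi>" if "\<phi> \<in> C0" for \<phi>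
      using C0_bounded[OF that] \<rho>2[OF C0_measurable[OF that]] by metis
    show "signed_measure \<rho> \<and> (\<forall>\<phi>\<in>C0. signed_integral \<rho> \<phi> =
        signed_integral \<mu> (\<lambda>y. signed_integral (measure M) (\<lambda>x. \<phi> (x + y))))"
      using \<rho>1 L by (simp add: * L_def)
    fix \<rho>' assume "signed_measure \<rho>' \<and> (\<forall>\<phi>\<in>C0. signed_integral \<rho>' \<phi> =
        signed_integral \<mu> (\<lambda>y. signed_integral (measure M) (\<lambda>x. \<phi> (x + y))))"
    then show "\<rho>' = \<rho>"
      using \<rho>1 L by (intro signed_measure_eqI_C0) (auto simp: * L_def)
  qed
  note eq = this
  show "signed_measure (signed_convolution (measure M) \<mu>)"
    unfolding eq by (rule \<rho>1)
  show "signed_integral (signed_convolution (measure M) \<mu>) \<phi> =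
      signed_integral \<mu> (\<lambda>y. \<integral>x. \<phi> (x + y) \<partial>M)"
    if "\<phi> \<in> borel_measurable borel" "\<And>x. \<bar>\<phi> x\<bar> \<le> C" for \<phi> C
    unfolding eq \<rho>2[OF that] L_def ..
qed

section \<open>Measurable families of signed measures\<close>

text \<open>Weak-* measurability of a family of signed measures over an arbitrary measurable space.\<close>

definition signed_kernel :: "'b measure \<Rightarrow> ('b \<Rightarrow> 'a::euclidean_space set \<Rightarrow> real) \<Rightarrow> bool" where
  "signed_kernel M F \<longleftrightarrow> (\<forall>\<tau>\<in>space M. signed_measure (F \<tau>)) \<and>
     (\<forall>\<phi>\<in>C0. (\<lambda>\<tau>. signed_integral (F \<tau>) \<phi>) \<in> borel_measurable M)"

lemma signed_kernelD: "signed_kernel M F \<Longrightarrow> \<tau> \<in> space M \<Longrightarrow> signed_measure (F \<tau>)"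
  by (simp add: signed_kernel_def)

lemma signed_kernel_integral_measurable:
  fixes F :: "'b \<Rightarrow> 'a::euclidean_space set \<Rightarrow> real"
  assumes F: "signed_kernel M F"
    and \<phi>: "\<phi> \<in> borel_measurable borel" "\<And>x. \<bar>\<phi> x\<bar> \<le> C"
  shows "(\<lambda>\<tau>. signed_integral (F \<tau>) \<phi>) \<in> borel_measurable M"
  using \<phi>
proof (induction rule: C0_bounded_borel_induct)
  case (C0 \<phi>)
  then show ?case using F by (simp add: signed_kernel_def)
next
  case (add \<phi> \<psi> C D)
  have "(\<lambda>\<tau>. signed_integral (F \<tau>) \<phi> + signed_integral (F \<tau>) \<psi>) \<in> borel_measurable M"
    using add.IH by (rule borel_measurable_add)
  then show ?case
    by (rule measurable_cong[THEN iffD1, rotated])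
       (rule signed_integral_add[OF signed_kernelD[OF F] add.hyps, symmetric])
next
  case (cmult \<phi> C c)
  show ?case unfolding signed_integral_cmult by (intro borel_measurable_times cmult.IH) simp
next
  case (lim \<Phi> \<phi> C)
  show ?case
    by (rule borel_measurable_LIMSEQ_real[OF signed_integral_tendsto[OF signed_kernelD[OF F] lim.hyps] lim.IH])
qed

text \<open>For continuous \<open>\<Psi>\<close>, the parameter \<open>T \<tau>\<close> may be replaced by simple functions; for a simple
  parameter, the integral is assembled from finitely many measurable functions. The monotone class
  theorem on the product space then removes the continuity.\<close>

lemma signed_kernel_integral_measurable_param:
  fixes F :: "'b \<Rightarrow> 'a::euclidean_space set \<Rightarrow> real" and T :: "'b \<Rightarrow> 'c::euclidean_space"
  assumes F: "signed_kernel M F" and T: "T \<in> borel_measurable M"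
    and \<Psi>: "\<Psi> \<in> borel_measurable borel" "\<And>x. \<bar>\<Psi> x\<bar> \<le> C"
  shows "(\<lambda>\<tau>. signed_integral (F \<tau>) (\<lambda>y. \<Psi> (T \<tau>, y))) \<in> borel_measurable M"
  using \<Psi>
proof (induction rule: C0_bounded_borel_induct)
  case (C0 \<Psi>)
  have cont: "continuous_on UNIV \<Psi>" using C0 by (simp add: C0_def)
  obtain C where C: "\<And>x. \<bar>\<Psi> x\<bar> \<le> C" using C0_bounded[OF C0] by blast
  have sec: "(\<lambda>y. \<Psi> (c, y)) \<in> borel_measurable borel" for c
    by (intro borel_measurable_continuous_onI continuous_on_compose2[OF cont] continuous_intros) auto
  obtain S where S: "\<And>i. simple_function M (S i)" "\<And>\<tau>. \<tau> \<in> space M \<Longrightarrow> (\<lambda>i. S i \<tau>) \<longlonglongrightarrow> T \<tau>"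
    using borel_measurable_implies_sequence_metric[OF T, of 0] by auto
  have step: "(\<lambda>\<tau>. signed_integral (F \<tau>) (\<lambda>y. \<Psi> (S i \<tau>, y))) \<in> borel_measurable M" for i
  proof (rule measurable_compose_countable'[where I="S i ` space M" and g="S i"
        and f="\<lambda>c \<tau>. signed_integral (F \<tau>) (\<lambda>y. \<Psi> (c, y))"])
    show "S i \<in> M \<rightarrow>\<^sub>M count_space (S i ` space M)"
      using simple_functionD(2)[OF S(1)] by (auto simp: measurable_def)
    show "countable (S i ` space M)"
      using simple_functionD(1)[OF S(1)] by (rule countable_finite)
    show "(\<lambda>\<tau>. signed_integral (F \<tau>) (\<lambda>y. \<Psi> (c, y))) \<in> borel_measurable M" for c
      by (rule signed_kernel_integral_measurable[OF F sec C])
  qed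
  show ?case
  proof (rule borel_measurable_LIMSEQ_real[OF _ step])
    fix \<tau> assume \<tau>: "\<tau> \<in> space M"
    have "(\<lambda>i. \<Psi> (S i \<tau>, y)) \<longlonglongrightarrow> \<Psi> (T \<tau>, y)" for y
      by (rule continuous_on_tendsto_compose[OF cont]) (auto intro!: tendsto_Pair S(2) \<tau>)
    then show "(\<lambda>i. signed_integral (F \<tau>) (\<lambda>y. \<Psi> (S i \<tau>, y))) \<longlonglongrightarrow> signed_integral (F \<tau>) (\<lambda>y. \<Psi> (T \<tau>, y))"
      by (rule signed_integral_tendsto[OF signed_kernelD[OF F \<tau>] sec C])
  qed
next
  case (add \<phi> \<psi> C D)
  have sec: "(\<lambda>y. \<phi> (c, y)) \<in> borel_measurable borel" "(\<lambda>y. \<psi> (c, y)) \<in> borel_measurable borel" for c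
    using add.hyps(1,3) by (auto intro: measurable_compose[rotated] simp: borel_prod[symmetric])
  have "(\<lambda>\<tau>. signed_integral (F \<tau>) (\<lambda>y. \<phi> (T \<tau>, y)) + signed_integral (F \<tau>) (\<lambda>y. \<psi> (T \<tau>, y))) \<in> borel_measurable M"
    using add.IH by (rule borel_measurable_add)
  then show ?case
    by (rule measurable_cong[THEN iffD1, rotated])
       (rule signed_integral_add[OF signed_kernelD[OF F] sec(1) add.hyps(2) sec(2) add.hyps(4), symmetric])
next
  case (cmult \<phi> C c)
  show ?case unfolding signed_integral_cmult by (intro borel_measurable_times cmult.IH) simp
next
  case (lim \<Phi> \<phi> C)
  have sec: "(\<lambda>y. \<Phi> n (c, y)) \<in> borel_measurable borel" for c n
    using lim.hyps(1)[of n] by (auto intro: measurable_compose[rotated] simp: borel_prod[symmetric])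
  show ?case
    by (rule borel_measurable_LIMSEQ_real[OF signed_integral_tendsto[OF signed_kernelD[OF F] sec lim.hyps(2) lim.hyps(3)] lim.IH])
qed

lemma abs_signed_measure_le:
  assumes "signed_measure \<mu>" "A \<in> sets borel"
  shows "\<bar>\<mu> A\<bar> \<le> measure (pos_variation \<mu>) A + measure (neg_variation \<mu>) A"
  using Jordan_decomposition[OF assms] measure_nonneg[of "pos_variation \<mu>" A]
    measure_nonneg[of "neg_variation \<mu>" A] by linarith

lemma finite_measure_compact_open_approx:
  fixes M :: "'a::euclidean_space measure"
  assumes "finite_measure M" and sets: "sets M = sets borel" and A: "A \<in> sets borel" and e: "0 < e"
  obtains K U where "compact K" "open U" "K \<subseteq> A" "A \<subseteq> U" "measure M (U - K) < e"
proof -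
  interpret finite_measure M by fact
  have fin: "emeasure M (space M) \<noteq> \<infinity>" by simp
  obtain K where K: "K \<subseteq> A" "compact K" "ennreal (measure M A) < emeasure M K + ennreal (e/2)"
  proof (cases "measure M A < e / 2")
    case True
    then show ?thesis by (intro that[of "{}"]) (auto simp: ennreal_lessI e)
  next
    case False
    then have "ennreal (measure M A - e/2) < emeasure M A"
      using e by (auto simp: emeasure_eq_measure intro!: ennreal_lessI)
    then obtain K where K: "K \<subseteq> A" "compact K" "ennreal (measure M A - e/2) < emeasure M K"
      unfolding inner_regular[OF sets fin A] less_SUP_iff by auto
    have "ennreal (measure M A) = ennreal (measure M A - e/2) + ennreal (e/2)"
      using False e by (simp flip: ennreal_plus)
    also have "\<dots> < emeasure M K + ennreal (e/2)"
      using K(3) by (simp add: ennreal_add_left_cancel_less add.commute[of _ "ennreal (e/2)"])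
    finally show ?thesis using K that by blast
  qed
  have "emeasure M A < ennreal (measure M A + e/2)"
    using e by (auto simp: emeasure_eq_measure intro!: ennreal_lessI)
  then obtain U where U: "A \<subseteq> U" "open U" "emeasure M U < ennreal (measure M A + e/2)"
    unfolding outer_regular[OF sets fin A] INF_less_iff by auto
  have [measurable]: "K \<in> sets M" "U \<in> sets M" using K U sets by (auto simp: borel_compact)
  have "measure M A < measure M K + e/2"
    using K(3) e by (simp add: emeasure_eq_measure ennreal_less_iff flip: ennreal_plus)
  moreover have "measure M U < measure M A + e/2"
    using U(3) by (simp add: emeasure_eq_measure ennreal_less_iff del: ennreal_plus)
  moreover have "measure M (U - K) = measure M U - measure M K"
    using K U by (intro finite_measure_Diff) auto
  ultimately show thesis using K U that by (simp add: field_sum_of_halves)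
qed

text \<open>Regularity of the two variations places every Borel set, up to small variation, between a
  compact set \<open>K\<close> and an open set \<open>U\<close>; finitely many members of a countable base cover \<open>K\<close> inside \<open>U\<close>.
  The countable family does not depend on \<open>\<mu>\<close>, which is what measurability in a parameter requires.\<close>

lemma pos_variation_eq_countable_SUP:
  obtains \<W> :: "'a::euclidean_space set set" where "countable \<W>" "\<W> \<subseteq> sets borel"
    "\<And>\<mu>. signed_measure \<mu> \<Longrightarrow> emeasure (pos_variation \<mu>) UNIV = (SUP W\<in>\<W>. ennreal (\<mu> W))"
proof -
  obtain B :: "'a set set" where B: "countable B" "topological_basis B"
    using ex_countable_basis by blast
  define \<W> where "\<W> = Union ` {F. finite F \<and> F \<subseteq> B}"
  have cW: "countable \<W>"
    unfolding \<W>_def using countable_Collect_finite_subset[OF B(1)] by (simp add: conj_commute)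
  have oW: "open W" if "W \<in> \<W>" for W
    using that topological_basis_open[OF B(2)] unfolding \<W>_def by auto
  have approx: "\<exists>W\<in>\<W>. K \<subseteq> W \<and> W \<subseteq> U" if KU: "compact K" "open U" "K \<subseteq> U" for K U
  proof -
    have cover: "K \<subseteq> \<Union>{b\<in>B. b \<subseteq> U}"
      using topological_basisE[OF B(2) KU(2)] KU(3) by blast
    obtain F where "F \<subseteq> {b\<in>B. b \<subseteq> U}" "finite F" "K \<subseteq> \<Union>F"
      by (rule compactE[OF KU(1) cover]) (use topological_basis_open[OF B(2)] in auto)
    then show ?thesis unfolding \<W>_def by (intro bexI[of _ "\<Union>F"]) auto
  qed
  have "emeasure (pos_variation \<mu>) UNIV = (SUP W\<in>\<W>. ennreal (\<mu> W))" if \<mu>: "signed_measure \<mu>" for \<mu>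
  proof (rule antisym)
    interpret P: finite_measure "pos_variation \<mu>" by (rule finite_measure_pos_variation[OF \<mu>])
    interpret N: finite_measure "neg_variation \<mu>" by (rule finite_measure_neg_variation[OF \<mu>])
    show "(SUP W\<in>\<W>. ennreal (\<mu> W)) \<le> emeasure (pos_variation \<mu>) UNIV"
      unfolding emeasure_pos_variation[OF \<mu>, of UNIV, simplified] using oW by (intro SUP_subset_mono) auto
    show "emeasure (pos_variation \<mu>) UNIV \<le> (SUP W\<in>\<W>. ennreal (\<mu> W))"
    proof (subst emeasure_pos_variation[OF \<mu>], simp, rule SUP_least, rule ennreal_le_epsilon)
      fix A :: "'a set" and e :: real assume "A \<in> {A \<in> sets borel. A \<subseteq> UNIV}" and e: "0 < e"
      then have A: "A \<in> sets borel" by simp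
      have e4: "0 < e / 4" using e by simp
      obtain K1 U1 where 1: "compact K1" "open U1" "K1 \<subseteq> A" "A \<subseteq> U1" "measure (pos_variation \<mu>) (U1 - K1) < e / 4"
        by (rule finite_measure_compact_open_approx[OF P.finite_measure_axioms sets_pos_variation A e4])
      obtain K2 U2 where 2: "compact K2" "open U2" "K2 \<subseteq> A" "A \<subseteq> U2" "measure (neg_variation \<mu>) (U2 - K2) < e / 4"
        by (rule finite_measure_compact_open_approx[OF N.finite_measure_axioms sets_neg_variation A e4])
      have "K1 \<union> K2 \<subseteq> U1 \<inter> U2" using 1 2 by blast
      then obtain W where W: "W \<in> \<W>" "K1 \<union> K2 \<subseteq> W" "W \<subseteq> U1 \<inter> U2"
        using approx[OF compact_Un[OF 1(1) 2(1)] open_Int[OF 1(2) 2(2)]] by blast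
      have Wb: "W \<in> sets borel" using oW[OF W(1)] by simp
      have small: "\<bar>\<mu> E\<bar> \<le> e / 2" if E: "E \<in> sets borel" "E \<subseteq> U1 - K1" "E \<subseteq> U2 - K2" for E
      proof -
        have "measure (pos_variation \<mu>) E \<le> measure (pos_variation \<mu>) (U1 - K1)"
          using E 1 by (intro P.finite_measure_mono) (auto simp: borel_compact)
        moreover have "measure (neg_variation \<mu>) E \<le> measure (neg_variation \<mu>) (U2 - K2)"
          using E 2 by (intro N.finite_measure_mono) (auto simp: borel_compact)
        ultimately show ?thesis using abs_signed_measure_le[OF \<mu> E(1)] 1(5) 2(5) by linarith
      qed
      have "\<bar>\<mu> (A - W)\<bar> \<le> e / 2" "\<bar>\<mu> (W - A)\<bar> \<le> e / 2"
        using 1 2 W A Wb by (intro small; blast)+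
      moreover have "\<mu> A = \<mu> (A - W) + \<mu> (A \<inter> W)" "\<mu> W = \<mu> (W - A) + \<mu> (A \<inter> W)"
        using signed_measure_Diff[OF \<mu>, of A "A \<inter> W"] signed_measure_Diff[OF \<mu>, of W "A \<inter> W"] A Wb
        by (auto simp: Diff_Int)
      ultimately have "\<mu> A \<le> \<mu> W + e" by linarith
      also have "\<dots> \<le> max 0 (\<mu> W) + e" by simp
      finally have "ennreal (\<mu> A) \<le> ennreal (max 0 (\<mu> W) + e)" by (rule ennreal_leI)
      also have "\<dots> = ennreal (max 0 (\<mu> W)) + ennreal e" using e by (intro ennreal_plus) auto
      also have "ennreal (max 0 (\<mu> W)) = ennreal (\<mu> W)"
        by (simp add: max_def ennreal_neg)
      finally have "ennreal (\<mu> A) \<le> ennreal (\<mu> W) + ennreal e" .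
      also have "\<dots> \<le> (SUP W\<in>\<W>. ennreal (\<mu> W)) + ennreal e"
        using W(1) by (intro add_right_mono SUP_upper)
      finally show "ennreal (\<mu> A) \<le> (SUP W\<in>\<W>. ennreal (\<mu> W)) + ennreal e" .
    qed
  qed
  moreover have "\<W> \<subseteq> sets borel" using oW by auto
  ultimately show thesis using cW that by blast
qed

lemma signed_kernel_tv_norm_measurable:
  fixes F :: "'b \<Rightarrow> 'a::euclidean_space set \<Rightarrow> real"
  assumes F: "signed_kernel M F"
  shows "(\<lambda>\<tau>. tv_norm (F \<tau>)) \<in> borel_measurable M"
proof -
  obtain \<W> :: "'a set set" where W: "countable \<W>" "\<W> \<subseteq> sets borel"
    "\<And>\<mu>. signed_measure \<mu> \<Longrightarrow> emeasure (pos_variation \<mu>) UNIV = (SUP W\<in>\<W>. ennreal (\<mu> W))"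
    using pos_variation_eq_countable_SUP by blast
  have m: "(\<lambda>\<tau>. F \<tau> W) \<in> borel_measurable M" if "W \<in> \<W>" for W
  proof -
    have "(\<lambda>\<tau>. signed_integral (F \<tau>) (indicator W)) \<in> borel_measurable M"
      using that W(2) by (intro signed_kernel_integral_measurable[OF F, of _ 1]) (auto simp: indicator_def)
    then show ?thesis
      using that W(2) signed_kernelD[OF F]
      by (subst measurable_cong[where g="\<lambda>\<tau>. signed_integral (F \<tau>) (indicator W)"])
         (auto simp: signed_integral_indicator)
  qed
  have "(\<lambda>\<tau>. (SUP W\<in>\<W>. ennreal (F \<tau> W)) + (SUP W\<in>\<W>. ennreal (- F \<tau> W))) \<in> borel_measurable M"
    using W(1) m by (intro borel_measurable_add borel_measurable_SUP) auto
  then show ?thesis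
    by (rule measurable_cong[THEN iffD1, rotated])
       (simp add: tv_norm_def neg_variation_def W(3) signed_measure_uminus signed_kernelD[OF F])
qed

section \<open>The mass of the convolution kernel\<close>

lemma continuous_AE_eq_imp_eq:
  fixes f g :: "real \<Rightarrow> real"
  assumes "continuous_on {0<..} f" "continuous_on {0<..} g"
    and AE: "AE t in lborel. 0 < t \<longrightarrow> f t = g t" and t: "0 < t"
  shows "f t = g t"
proof (rule ccontr)
  assume "f t \<noteq> g t"
  have "continuous_on {0<..} (\<lambda>t. f t - g t)" using assms by (intro continuous_intros)
  then have "open ({0<..} \<inter> (\<lambda>t. f t - g t) -` (- {0}))"
    by (rule continuous_open_preimage) auto
  moreover have "t \<in> {0<..} \<inter> (\<lambda>t. f t - g t) -` (- {0})" using t \<open>f t \<noteq> g t\<close> by simp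
  ultimately obtain e where e: "0 < e" "ball t e \<subseteq> {0<..} \<inter> (\<lambda>t. f t - g t) -` (- {0})"
    by (meson open_contains_ball)
  have "AE s in lborel. s \<notin> ball t e"
    using AE by eventually_elim (use e(2) in auto)
  then have "emeasure lborel (ball t e) = 0"
    by (subst (asm) AE_iff_measurable[OF _ refl]) (auto simp: ball_def)
  with e(1) show False by (simp add: ball_eq_greaterThanLessThan)
qed

text \<open>Tilting by \<open>e\<^sup>-\<^sup>t\<close> turns the functions into multiples of probability densities, and the Laplace
  transform on the line \<open>Re z = 1\<close> is their characteristic function.\<close>

lemma continuous_density_eqI_Laplace:
  fixes f g :: "real \<Rightarrow> real"
  assumes cont: "continuous_on {0<..} f" "continuous_on {0<..} g"
    and nonneg: "\<And>t. 0 < t \<Longrightarrow> 0 \<le> f t" "\<And>t. 0 < t \<Longrightarrow> 0 \<le> g t"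
    and int: "\<And>z. Re z = 1 \<Longrightarrow> set_integrable lborel {0<..} (\<lambda>t. exp (- z * complex_of_real t) * complex_of_real (f t))"
      "\<And>z. Re z = 1 \<Longrightarrow> set_integrable lborel {0<..} (\<lambda>t. exp (- z * complex_of_real t) * complex_of_real (g t))"
    and eq: "\<And>z. Re z = 1 \<Longrightarrow> (LINT t:{0<..}|lborel. exp (- z * complex_of_real t) * complex_of_real (f t)) =
        (LINT t:{0<..}|lborel. exp (- z * complex_of_real t) * complex_of_real (g t))"
    and nz: "(LINT t:{0<..}|lborel. exp (- 1 * complex_of_real t) * complex_of_real (f t)) \<noteq> 0"
    and t: "0 < t"
  shows "f t = g t"
proof -
  define q where "q k t = indicator {0<..} t * (exp (- t) * k t)" for k :: "real \<Rightarrow> real" and t :: real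
  define m where "m = (\<integral>t. q f t \<partial>lborel)"
  define M where "M k = density lborel (\<lambda>t. ennreal (q k t / m))" for k
  have q_complex: "indicator {0<..} t *\<^sub>R (exp (- z * complex_of_real t) * complex_of_real (k t)) =
      iexp (- Im z * t) * complex_of_real (q k t)" if "Re z = 1" for z k t
  proof -
    have "z = 1 + \<i> * complex_of_real (Im z)" using that by (simp add: complex_eq_iff)
    then have "- z * complex_of_real t = \<i> * complex_of_real (- Im z * t) + complex_of_real (- t)"
      by (simp add: complex_eq_iff that)
    then have "exp (- z * complex_of_real t) = iexp (- Im z * t) * complex_of_real (exp (- t))"
      by (simp only: exp_add exp_of_real)
    then show ?thesis by (simp add: q_def indicator_def)
  qed
  have q_complex1: "indicator {0<..} t *\<^sub>R (exp (- 1 * complex_of_real t) * complex_of_real (k t)) =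
      complex_of_real (q k t)" for k t
    using q_complex[of 1 t k] by simp
  have props: "integrable lborel (q k)" "q k \<in> borel_measurable borel" "\<And>t. 0 \<le> q k t"
    if "k = f \<or> k = g" for k
  proof -
    have "set_integrable lborel {0<..} (\<lambda>t. exp (- 1 * complex_of_real t) * complex_of_real (k t))"
      using that int[of 1] by auto
    then have "integrable lborel (\<lambda>t. complex_of_real (q k t))"
      unfolding set_integrable_def q_complex1 .
    then show *: "integrable lborel (q k)"
      by (simp only: complex_of_real_integrable_eq)
    then show "q k \<in> borel_measurable borel" by auto
    show "0 \<le> q k t" for t using that nonneg by (auto simp: q_def indicator_def)
  qed
  have mass: "(\<integral>t. q k t \<partial>lborel) = m" if "k = f \<or> k = g" for k
  proof -
    have "complex_of_real (\<integral>t. q g t \<partial>lborel) = complex_of_real (\<integral>t. q f t \<partial>lborel)"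
      using eq[of 1] unfolding set_lebesgue_integral_def by (simp only: q_complex1 integral_complex_of_real one_complex.simps)
    then show ?thesis using that by (auto simp: m_def)
  qed
  have "complex_of_real m \<noteq> 0"
    using nz unfolding set_lebesgue_integral_def by (simp only: q_complex1 integral_complex_of_real m_def) simp
  moreover have "0 \<le> m" unfolding m_def using props(3)[of f] by simp
  ultimately have m: "0 < m" by simp
  have dist: "real_distribution (M k)" if k: "k = f \<or> k = g" for k
  proof (intro real_distribution.intro real_distribution_axioms.intro prob_spaceI)
    have "emeasure (M k) (space (M k)) = (\<integral>\<^sup>+t. ennreal (q k t / m) \<partial>lborel)"
      using props(2)[OF k] by (simp add: M_def emeasure_density)
    also have "\<dots> = ennreal (\<integral>t. q k t / m \<partial>lborel)"
      using props[OF k] m by (intro nn_integral_eq_integral) auto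
    also have "\<dots> = 1" using mass[OF k] m by simp
    finally show "emeasure (M k) (space (M k)) = 1" .
  qed (simp add: M_def)
  have char: "char (M k) y = (LINT t:{0<..}|lborel. exp (- (1 - \<i> * complex_of_real y) * complex_of_real t) * complex_of_real (k t)) / m"
    if k: "k = f \<or> k = g" for k y
  proof -
    have "char (M k) y = (\<integral>t. (q k t / m) *\<^sub>R iexp (y * t) \<partial>lborel)"
      unfolding char_def M_def using props[OF k] m by (subst integral_density) auto
    also have "\<dots> = (\<integral>t. iexp (y * t) * complex_of_real (q k t) / m \<partial>lborel)"
      by (intro Bochner_Integration.integral_cong) (auto simp: scaleR_conv_of_real)
    also have "\<dots> = (\<integral>t. iexp (y * t) * complex_of_real (q k t) \<partial>lborel) / m" by simp
    also have "(\<lambda>t. iexp (y * t) * complex_of_real (q k t)) =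
        (\<lambda>t. indicator {0<..} t *\<^sub>R (exp (- (1 - \<i> * complex_of_real y) * complex_of_real t) * complex_of_real (k t)))"
      by (subst q_complex) auto
    finally show ?thesis unfolding set_lebesgue_integral_def .
  qed
  have "char (M f) = char (M g)"
  proof
    fix y show "char (M f) y = char (M g) y"
      using char[of f y] char[of g y] eq[of "1 - \<i> * complex_of_real y"] by simp
  qed
  then have "M f = M g" by (intro Levy_uniqueness dist) auto
  then have "AE t in lborel. ennreal (q f t / m) = ennreal (q g t / m)"
    using props(2)[of f] props(2)[of g] unfolding M_def by (subst (asm) sigma_finite_measure.density_unique_iff[OF sigma_finite_lborel]) auto
  then have "AE t in lborel. 0 < t \<longrightarrow> f t = g t"
  proof eventually_elim
    case (elim t)
    then have "q f t / m = q g t / m"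
      using props(3)[of f t] props(3)[of g t] m by (subst (asm) ennreal_inj) auto
    then show ?case using m by (auto simp: q_def)
  qed
  then show ?thesis using continuous_AE_eq_imp_eq[OF cont _ t] by blast
qed

text \<open>Both sides have the Laplace transform \<open>exp (- r z\<^sup>\<alpha>)\<close>, and continuity upgrades equality almost
  everywhere to equality.\<close>

lemma stable_density_scaling:
  assumes h: "stable_subordinator_density \<alpha> h" and c: "0 < c" and r: "0 < r" and t: "0 < t"
  shows "h t r = c * h (c * t) (c powr \<alpha> * r)"
proof -
  define R where "R = c powr \<alpha> * r"
  have R: "0 < R" using c r by (simp add: R_def)
  have nonneg: "0 \<le> h t r" if "0 < t" "0 < r" for t r
    using h that by (simp add: stable_subordinator_density_def)
  have cont: "continuous_on ({0<..} \<times> {0<..}) (\<lambda>(t, r). h t r)"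
    using h by (simp add: stable_subordinator_density_def)
  have cont_sec: "continuous_on {0<..} (\<lambda>t. h (a * t) r)" if "0 < r" "0 < a" for r a
  proof -
    have "continuous_on {0<..} (\<lambda>t. (a * t, r))" by (intro continuous_intros)
    from continuous_on_compose2[OF cont this] that show ?thesis by (force simp: image_subset_iff)
  qed
  have int: "set_integrable lborel {0<..} (\<lambda>t. exp (- z * complex_of_real t) * complex_of_real (h t r))"
    and val: "(LINT t:{0<..}|lborel. exp (- z * complex_of_real t) * complex_of_real (h t r)) =
        exp (- complex_of_real r * z powr complex_of_real \<alpha>)" if "0 < r" "0 < Re z" for r z
    using h that by (auto simp: stable_subordinator_density_def)
  have scaled: "(\<lambda>t. indicator {0<..} t *\<^sub>R (exp (- z * complex_of_real t) * complex_of_real (c * h (c * t) R))) =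
      (\<lambda>t. c *\<^sub>R (\<lambda>s. indicator {0<..} s *\<^sub>R (exp (- (z / c) * complex_of_real s) * complex_of_real (h s R))) (0 + c * t))" for z
    using c by (auto simp: fun_eq_iff indicator_def scaleR_conv_of_real zero_less_mult_iff)
  have Re: "0 < Re (z / complex_of_real c)" if "Re z = 1" for z using that c by simp
  have powr: "complex_of_real R * (z / complex_of_real c) powr complex_of_real \<alpha> = complex_of_real r * z powr complex_of_real \<alpha>"
    if "Re z = 1" for z
  proof -
    have nz: "z / complex_of_real c \<noteq> 0" "z \<noteq> 0" using that c by auto
    have "Ln z = complex_of_real (ln c) + Ln (z / complex_of_real c)"
      using Ln_times_of_real[OF c nz(1)] c by (simp add: Ln_of_real)
    then have "z powr complex_of_real \<alpha> = complex_of_real (c powr \<alpha>) * (z / complex_of_real c) powr complex_of_real \<alpha>"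
      using nz c by (simp add: powr_def exp_add[symmetric] exp_of_real[symmetric] distrib_left)
    then show ?thesis by (simp add: R_def)
  qed
  have "h (1 * t) r = c * h (c * t) R"
  proof (rule continuous_density_eqI_Laplace[where f="\<lambda>t. h (1 * t) r" and g="\<lambda>t. c * h (c * t) R"])
    fix z :: complex assume z: "Re z = 1"
    show "set_integrable lborel {0<..} (\<lambda>t. exp (- z * complex_of_real t) * complex_of_real (h (1 * t) r))"
      using int[OF r, of z] z by simp
    show "set_integrable lborel {0<..} (\<lambda>t. exp (- z * complex_of_real t) * complex_of_real (c * h (c * t) R))"
      unfolding set_integrable_def scaled using int[OF R Re[OF z]] c
      by (intro integrable_scaleR_right lborel_integrable_real_affine) (auto simp: set_integrable_def)
    have "(LINT t:{0<..}|lborel. exp (- z * complex_of_real t) * complex_of_real (c * h (c * t) R)) =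
        (LINT s:{0<..}|lborel. exp (- (z / c) * complex_of_real s) * complex_of_real (h s R))"
      unfolding set_lebesgue_integral_def scaled
      using lborel_integral_real_affine[of c "\<lambda>s. indicator {0<..} s *\<^sub>R (exp (- (z / c) * complex_of_real s) * complex_of_real (h s R))" 0] c
      by (simp only: integral_scaleR_right abs_of_pos)
    then show "(LINT t:{0<..}|lborel. exp (- z * complex_of_real t) * complex_of_real (h (1 * t) r)) =
        (LINT t:{0<..}|lborel. exp (- z * complex_of_real t) * complex_of_real (c * h (c * t) R))"
      using val[OF r, of z] val[OF R Re[OF z]] powr[OF z] z by simp
  next
    show "(LINT t:{0<..}|lborel. exp (- 1 * complex_of_real t) * complex_of_real (h (1 * t) r)) \<noteq> 0"
      using val[OF r, of 1] by simp
  qed (use cont_sec[of r 1] cont_sec[OF R c] nonneg r R c t in \<open>auto intro!: continuous_intros\<close>)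
  then show ?thesis by (simp add: R_def)
qed

lemma stable_density_measurable:
  assumes h: "stable_subordinator_density \<alpha> h"
  shows "(\<lambda>(t, r). indicator {0<..} t * (indicator {0<..} r * h t r)) \<in> borel_measurable (borel \<Otimes>\<^sub>M borel)"
proof -
  have "continuous_on ({0<..} \<times> {0<..}) (\<lambda>(t, r). h t r)"
    using h by (simp add: stable_subordinator_density_def)
  then have "(\<lambda>p. indicator ({0<..} \<times> {0<..}) p *\<^sub>R (case p of (t, r) \<Rightarrow> h t r)) \<in> borel_measurable borel"
    by (intro borel_measurable_continuous_on_indicator) (auto intro!: borel_open open_Times)
  moreover have "(\<lambda>p. indicator ({0<..} \<times> {0<..}) p *\<^sub>R (case p of (t, r) \<Rightarrow> h t r)) =
      (\<lambda>(t, r). indicator {0<..} t * (indicator {0<..} r * h t r))"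
    by (auto simp: indicator_def fun_eq_iff)
  ultimately show ?thesis by (simp add: borel_prod)
qed

text \<open>By scaling, the integral \<open>H t\<close> equals \<open>t\<^bsup>\<alpha>-1\<^esup> H 1\<close>. The constant comes from evaluating
  \<open>\<integral> e\<^sup>-\<^sup>t H t dt\<close> in two ways: it is \<open>H 1 * \<Gamma> \<alpha>\<close>, and by Tonelli and the Laplace transform at \<open>1\<close> it is
  \<open>\<integral> e\<^sup>-\<^sup>r dr = 1\<close>.\<close>

lemma stable_density_nn_integral:
  assumes h: "stable_subordinator_density \<alpha> h" and \<alpha>: "0 < \<alpha>" and t: "0 < t"
  shows "(\<integral>\<^sup>+r\<in>{0<..}. ennreal (h t r) \<partial>lborel) = ennreal (t powr (\<alpha> - 1) / Gamma \<alpha>)"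
proof -
  define k where "k t r = indicator {0<..} t * (indicator {0<..} r * h t r)" for t r
  have nonneg: "0 \<le> k t r" for t r
    using h by (auto simp: stable_subordinator_density_def k_def indicator_def)
  have k_meas: "(\<lambda>(t, r). k t r) \<in> borel_measurable (borel \<Otimes>\<^sub>M borel)"
    unfolding k_def by (rule stable_density_measurable[OF h])
  note [measurable] = measurable_compose[OF _ k_meas, where f="\<lambda>x. (u x, v x)" for u v, simplified]
  define H where "H t = (\<integral>\<^sup>+r. ennreal (k t r) \<partial>lborel)" for t
  have H_power: "H c = ennreal (c powr (\<alpha> - 1)) * H 1" if c: "0 < c" for c
  proof -
    have "H c = ennreal (c powr \<alpha>) * (\<integral>\<^sup>+r. ennreal (k c (0 + c powr \<alpha> * r)) \<partial>lborel)"
      unfolding H_def using c by (subst nn_integral_real_affine[where c="c powr \<alpha>" and t=0]) auto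
    also have "(\<integral>\<^sup>+r. ennreal (k c (0 + c powr \<alpha> * r)) \<partial>lborel) = (\<integral>\<^sup>+r. ennreal (1 / c) * ennreal (k 1 r) \<partial>lborel)"
      using c stable_density_scaling[OF h c, of _ 1]
      by (intro nn_integral_cong) (auto simp: k_def indicator_def zero_less_mult_iff simp flip: ennreal_mult')
    also have "\<dots> = ennreal (1 / c) * H 1"
      unfolding H_def by (rule nn_integral_cmult) measurable
    also have "ennreal (c powr \<alpha>) * (ennreal (1 / c) * H 1) = ennreal (c powr (\<alpha> - 1)) * H 1"
      using c by (simp add: mult.assoc[symmetric] ennreal_mult[symmetric] powr_diff)
    finally show ?thesis .
  qed
  (* The Laplace transform at 1, with 1 powr \<alpha> = 1. *)
  have expint: "(\<integral>\<^sup>+t. ennreal (exp (- t)) * ennreal (k t r) \<partial>lborel) = indicator {0<..} r * ennreal (exp (- r))" for r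
  proof (cases "0 < r")
    case True
    have int: "set_integrable lborel {0<..} (\<lambda>t. exp (- 1 * complex_of_real t) * complex_of_real (h t r))"
      and val: "(LINT t:{0<..}|lborel. exp (- 1 * complex_of_real t) * complex_of_real (h t r)) =
        exp (- complex_of_real r * 1 powr complex_of_real \<alpha>)"
      using h True unfolding stable_subordinator_density_def by (metis one_complex.simps(1) zero_less_one)+
    have eq: "indicator {0<..} t *\<^sub>R (exp (- 1 * complex_of_real t) * complex_of_real (h t r)) =
        complex_of_real (exp (- t) * k t r)" for t
      using True by (auto simp: k_def indicator_def exp_of_real[symmetric])
    have int': "integrable lborel (\<lambda>t. exp (- t) * k t r)"
      using int unfolding set_integrable_def eq by (simp only: complex_of_real_integrable_eq)
    have "complex_of_real (\<integral>t. exp (- t) * k t r \<partial>lborel) = complex_of_real (exp (- r))"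
      using val unfolding set_lebesgue_integral_def eq by (simp add: exp_of_real[symmetric] del: of_real_mult)
    then have "(\<integral>t. exp (- t) * k t r \<partial>lborel) = exp (- r)"
      by (simp only: of_real_eq_iff)
    moreover have "(\<integral>\<^sup>+t. ennreal (exp (- t)) * ennreal (k t r) \<partial>lborel) = ennreal (\<integral>t. exp (- t) * k t r \<partial>lborel)"
      using nonneg int' by (subst nn_integral_eq_integral[symmetric]) (auto simp: ennreal_mult)
    ultimately show ?thesis using True by simp
  qed (simp add: k_def)
  have exp1: "(\<integral>\<^sup>+t. indicator {0<..} t * ennreal (exp (- t) * t powr (a - 1)) \<partial>lborel) = ennreal (Gamma a)" if "0 < a" for a
    unfolding Gamma_conv_nn_integral_real[OF that]
    by (intro nn_integral_cong_AE AE_I[of _ _ "{0}"]) (auto simp: indicator_def exp_minus field_simps)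
  have "H 1 * ennreal (Gamma \<alpha>) = H 1 * (\<integral>\<^sup>+t. indicator {0<..} t * ennreal (exp (- t) * t powr (\<alpha> - 1)) \<partial>lborel)"
    by (simp only: exp1[OF \<alpha>])
  also have "\<dots> = (\<integral>\<^sup>+t. H 1 * (indicator {0<..} t * ennreal (exp (- t) * t powr (\<alpha> - 1))) \<partial>lborel)"
    by (rule nn_integral_cmult[symmetric]) measurable
  also have "\<dots> = (\<integral>\<^sup>+t. ennreal (exp (- t)) * H t \<partial>lborel)"
  proof (rule nn_integral_cong)
    fix t :: real
    show "H 1 * (indicator {0<..} t * ennreal (exp (- t) * t powr (\<alpha> - 1))) = ennreal (exp (- t)) * H t"
    proof (cases "0 < t")
      case True
      then show ?thesis using H_power[OF True] by (simp add: ennreal_mult ac_simps)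
    next
      case False
      then have "H t = 0" by (simp add: H_def k_def)
      then show ?thesis using False by simp
    qed
  qed
  also have "\<dots> = (\<integral>\<^sup>+t. \<integral>\<^sup>+r. ennreal (exp (- t)) * ennreal (k t r) \<partial>lborel \<partial>lborel)"
    unfolding H_def by (intro nn_integral_cong nn_integral_cmult[symmetric]) measurable
  also have "\<dots> = (\<integral>\<^sup>+r. \<integral>\<^sup>+t. ennreal (exp (- t)) * ennreal (k t r) \<partial>lborel \<partial>lborel)"
    by (rule lborel_pair.Fubini') measurable
  also have "\<dots> = (\<integral>\<^sup>+r. indicator {0<..} r * ennreal (exp (- r)) \<partial>lborel)"
    by (simp only: expint)
  also have "\<dots> = (\<integral>\<^sup>+t. indicator {0<..} t * ennreal (exp (- t) * t powr (1 - 1)) \<partial>lborel)"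
    by (intro nn_integral_cong) (auto simp: indicator_def)
  also have "\<dots> = 1" by (subst exp1) auto
  finally have "H 1 * ennreal (Gamma \<alpha>) = 1" .
  moreover have G: "0 < Gamma \<alpha>" using \<alpha> by (rule Gamma_real_pos)
  ultimately have H1: "H 1 = ennreal (1 / Gamma \<alpha>)"
    by (cases "H 1" rule: ennreal_cases)
       (auto simp: ennreal_mult[symmetric] field_simps ennreal_top_mult simp flip: ennreal_1)
  have "(\<integral>\<^sup>+r\<in>{0<..}. ennreal (h t r) \<partial>lborel) = H t"
    unfolding H_def k_def using t by (intro nn_integral_cong) (auto simp: indicator_def)
  also have "\<dots> = ennreal (t powr (\<alpha> - 1) / Gamma \<alpha>)"
    using H_power[OF t] G by (simp add: H1 ennreal_mult[symmetric])
  finally show ?thesis .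
qed

text \<open>The conditional laws are probability measures on \<open>cball 0 t\<close>, so dividing by the mass of the
  density leaves a mixture of them. The kernel enters all later arguments only through this
  factorisation into a scalar weight and a measurable family of probability measures.\<close>

lemma convolution_kernel_normalized:
  fixes G :: "real \<Rightarrow> (real ^ 'd) measure"
  assumes \<alpha>: "0 < \<alpha>" and G: "convolution_kernel \<alpha> \<Lambda> G"
  obtains K where "K \<in> borel \<rightarrow>\<^sub>M prob_algebra borel"
    "\<And>s. 0 < s \<Longrightarrow> emeasure (K s) (cball 0 s) = 1"
    "\<And>s. 0 < s \<Longrightarrow> G s = density (K s) (\<lambda>_. ennreal (s powr (\<alpha> - 1) / Gamma \<alpha>))"
proof -
  obtain \<mu> h \<nu> where h: "stable_subordinator_density \<alpha> h" and dis: "disintegrates \<mu> h \<nu>"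
    and G_def: "\<And>t. 0 < t \<Longrightarrow> G t = measure_of UNIV (sets borel)
      (\<lambda>A. \<integral>\<^sup>+r\<in>{0<..}. ennreal (h t r) * emeasure (\<nu> r t) (A \<inter> cball 0 t) \<partial>lborel)"
    using G unfolding convolution_kernel_def by blast
  (* Extending the conditional laws by a point mass makes them measurable on the whole plane. *)
  define N :: "real \<times> real \<Rightarrow> (real ^ 'd) measure"
    where "N p = (if p \<in> {0<..} \<times> {0<..} then (case p of (r, t) \<Rightarrow> \<nu> r t) else return borel 0)" for p
  have N_meas: "N \<in> borel \<Otimes>\<^sub>M borel \<rightarrow>\<^sub>M prob_algebra borel"
  proof -
    have "(\<lambda>(r, t). \<nu> r t) \<in> restrict_space borel ({0<..} \<times> {0<..}) \<rightarrow>\<^sub>M prob_algebra borel"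
      using dis by (simp add: disintegrates_def)
    moreover have "({0<..} \<times> {0<..} :: (real \<times> real) set) \<in> sets borel"
      by (intro borel_open open_Times) auto
    moreover have "return borel 0 \<in> space (prob_algebra (borel :: (real ^ 'd) measure))"
      by (simp add: space_prob_algebra prob_space_return)
    ultimately show ?thesis
      unfolding borel_prod N_def[abs_def]
      by (subst (asm) measurable_restrict_space_iff[where c="return borel 0"]) auto
  qed
  have N_prob: "prob_space (N p)" and N_sets: "sets (N p) = sets borel" for p
    using measurable_space[OF N_meas, of p] by (simp_all add: space_prob_algebra space_pair_measure)
  have N_meas': "(\<lambda>p. emeasure (N p) A) \<in> borel_measurable (borel \<Otimes>\<^sub>M borel)" if "A \<in> sets borel" for A
    using measurable_compose[OF measurable_prob_algebraD[OF N_meas] measurable_emeasure_subprob_algebra[OF that]] .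
  define k where "k t r = indicator {0<..} t * (indicator {0<..} r * h t r)" for t r
  have k_meas: "(\<lambda>(t, r). k t r) \<in> borel_measurable (borel \<Otimes>\<^sub>M borel)"
    unfolding k_def by (rule stable_density_measurable[OF h])
  define g where "g A t = (\<integral>\<^sup>+r. ennreal (k t r) * emeasure (N (r, t)) A \<partial>lborel)" for A t
  have integrand: "(\<lambda>(t, r). ennreal (k t r) * emeasure (N (r, t)) A) \<in> borel_measurable (borel \<Otimes>\<^sub>M lborel)"
    if "A \<in> sets borel" for A
  proof -
    have "(\<lambda>p. emeasure (N (snd p, fst p)) A) \<in> borel_measurable (borel \<Otimes>\<^sub>M borel)"
      by (rule measurable_compose[OF _ N_meas'[OF that]]) measurable
    then have "(\<lambda>p. ennreal (case p of (t, r) \<Rightarrow> k t r) * emeasure (N (snd p, fst p)) A) \<in> borel_measurable (borel \<Otimes>\<^sub>M borel)"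
      using k_meas by measurable
    then show ?thesis by (simp add: case_prod_beta' cong: measurable_cong_sets sets_pair_measure_cong)
  qed
  have g_meas: "g A \<in> borel_measurable borel" if "A \<in> sets borel" for A
    unfolding g_def[abs_def] using lborel.borel_measurable_nn_integral[OF integrand[OF that]] .
  have integrand_r: "(\<lambda>r. ennreal (k t r) * emeasure (N (r, t)) A) \<in> borel_measurable lborel" if "A \<in> sets borel" for A t
    using measurable_compose[OF measurable_Pair1' integrand[OF that], of t] by simp
  have N_ball: "emeasure (N (r, t)) (A \<inter> cball 0 t) = emeasure (N (r, t)) A" 
    if "0 < t" "0 < r" "A \<in> sets borel" for A t r
  proof -
    interpret prob_space "N (r, t)" by (rule N_prob)
    have "emeasure (N (r, t)) (cball 0 t) = 1"
      using dis that by (simp add: disintegrates_def N_def)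
    then have "AE x in N (r, t). x \<in> cball 0 t"
      by (subst AE_in_set_eq_1) (auto simp: emeasure_eq_measure N_sets)
    then show ?thesis
      using that by (intro emeasure_eq_AE) (auto simp: N_sets)
  qed
  have G_eq: "emeasure (G t) A = g A t" and G_sets: "sets (G t) = sets borel"
    if t: "0 < t" and A: "A \<in> sets borel" for t A
  proof -
    have eq: "(\<integral>\<^sup>+r\<in>{0<..}. ennreal (h t r) * emeasure (\<nu> r t) (B \<inter> cball 0 t) \<partial>lborel) = g B t"
      if "B \<in> sets borel" for B
      unfolding g_def
    proof (intro nn_integral_cong)
      fix r
      show "ennreal (h t r) * emeasure (\<nu> r t) (B \<inter> cball 0 t) * indicator {0<..} r = ennreal (k t r) * emeasure (N (r, t)) B"
        using N_ball[OF t _ that, of r] t by (auto simp: k_def N_def indicator_def)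
    qed
    show "sets (G t) = sets borel"
      unfolding G_def[OF t] by (simp add: sets_measure_of_conv sets.sigma_sets_eq[of borel, simplified])
    have "emeasure (G t) A = (\<integral>\<^sup>+r\<in>{0<..}. ennreal (h t r) * emeasure (\<nu> r t) (A \<inter> cball 0 t) \<partial>lborel)"
      unfolding G_def[OF t]
    proof (rule emeasure_measure_of_sigma[OF _ _ _ A])
      show "sigma_algebra UNIV (sets (borel :: (real ^ 'd) measure))"
        using sets.sigma_algebra_axioms[of "borel :: (real ^ 'd) measure"] by simp
      show "positive (sets borel) (\<lambda>A. \<integral>\<^sup>+r\<in>{0<..}. ennreal (h t r) * emeasure (\<nu> r t) (A \<inter> cball 0 t) \<partial>lborel)"
        by (simp add: positive_def)
      show "countably_additive (sets borel) (\<lambda>A. \<integral>\<^sup>+r\<in>{0<..}. ennreal (h t r) * emeasure (\<nu> r t) (A \<inter> cball 0 t) \<partial>lborel)"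
        unfolding countably_additive_def
      proof (intro allI impI)
        fix B :: "nat \<Rightarrow> (real ^ 'd) set" assume B: "range B \<subseteq> sets borel" "disjoint_family B" and UB: "\<Union> (range B) \<in> sets borel"
        then have Bi: "B i \<in> sets borel" for i by auto
        have "(\<Sum>i. g (B i) t) = (\<integral>\<^sup>+r. (\<Sum>i. ennreal (k t r) * emeasure (N (r, t)) (B i)) \<partial>lborel)"
          unfolding g_def by (rule nn_integral_suminf[symmetric]) (rule integrand_r[OF Bi])
        also have "\<dots> = g (\<Union> (range B)) t"
          unfolding g_def
        proof (intro nn_integral_cong)
          fix r
          have "(\<Sum>i. emeasure (N (r, t)) (B i)) = emeasure (N (r, t)) (\<Union> (range B))"
            using B by (intro suminf_emeasure) (auto simp: N_sets)
          then show "(\<Sum>i. ennreal (k t r) * emeasure (N (r, t)) (B i)) = ennreal (k t r) * emeasure (N (r, t)) (\<Union> (range B))"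
            by simp
        qed
        finally show "(\<Sum>i. \<integral>\<^sup>+r\<in>{0<..}. ennreal (h t r) * emeasure (\<nu> r t) (B i \<inter> cball 0 t) \<partial>lborel) =
            (\<integral>\<^sup>+r\<in>{0<..}. ennreal (h t r) * emeasure (\<nu> r t) (\<Union> (range B) \<inter> cball 0 t) \<partial>lborel)"
          by (simp only: eq[OF Bi] eq[OF UB])
      qed
    qed
    then show "emeasure (G t) A = g A t" by (simp only: eq[OF A])
  qed
  have \<Gamma>: "0 < Gamma \<alpha>" using \<alpha> by (rule Gamma_real_pos)
  define w where "w s = s powr (\<alpha> - 1) / Gamma \<alpha>" for s
  have w: "0 < w s" if "0 < s" for s using that \<Gamma> by (simp add: w_def)
  have winv: "ennreal (1 / w s) * ennreal (w s) = 1" "ennreal (w s) * ennreal (1 / w s) = 1" if "0 < s" for s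
    using w[OF that] by (simp_all flip: ennreal_mult')
  have mass: "g A s = ennreal (w s)" if "0 < s" "A = UNIV \<or> A = cball 0 s" for s A
  proof -
    have "emeasure (N (r, s)) A = 1" if "0 < r" for r
      using N_ball[OF \<open>0 < s\<close> that, of UNIV] prob_space.emeasure_space_1[OF N_prob, of "(r, s)"] 
        sets_eq_imp_space_eq[OF N_sets, of "(r, s)"] \<open>A = UNIV \<or> A = cball 0 s\<close> by auto
    then have "g A s = (\<integral>\<^sup>+r\<in>{0<..}. ennreal (h s r) \<partial>lborel)"
      unfolding g_def using \<open>0 < s\<close> by (intro nn_integral_cong) (auto simp: k_def indicator_def)
    then show ?thesis using stable_density_nn_integral[OF h \<alpha> \<open>0 < s\<close>] by (simp add: w_def)
  qed
  (* The value for s \<le> 0 only makes K a total family of probability measures. *)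
  define K where "K s = (if 0 < s then density (G s) (\<lambda>_. ennreal (1 / w s)) else return borel 0)" for s
  have K_sets: "sets (K s) = sets borel" for s
    using G_sets[of s "{}"] by (simp add: K_def)
  have K_pos: "emeasure (K s) A = ennreal (1 / w s) * g A s" if "0 < s" "A \<in> sets borel" for s A
    using that G_eq[OF that] G_sets[OF that] by (simp add: K_def emeasure_density nn_integral_cmult_indicator)
  have one: "emeasure (K s) A = 1" if "0 < s" "A = UNIV \<or> A = cball 0 s" for s A
  proof -
    have "A \<in> sets borel" using that by auto
    then show ?thesis using K_pos[OF that(1)] mass[OF that] winv[OF that(1)] by simp
  qed
  have K_prob: "prob_space (K s)" for s
  proof (cases "0 < s")
    case True
    have "space (K s) = UNIV" using sets_eq_imp_space_eq[OF K_sets, of s] by simp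
    then show ?thesis using one[OF True] by (intro prob_spaceI) simp
  qed (simp add: K_def prob_space_return)
  have "K \<in> borel \<rightarrow>\<^sub>M prob_algebra borel"
  proof (intro measurable_prob_algebraI measurable_subprob_algebra K_prob prob_space_imp_subprob_space K_sets)
    fix A :: "(real ^ 'd) set" assume A: "A \<in> sets borel"
    note [measurable] = g_meas[OF A]
    have "(\<lambda>s. if 0 < s then ennreal (1 / w s) * g A s else indicator A 0) \<in> borel_measurable borel"
      unfolding w_def by measurable
    moreover have "(\<lambda>s. emeasure (K s) A) = (\<lambda>s. if 0 < s then ennreal (1 / w s) * g A s else indicator A 0)"
    proof
      fix s show "emeasure (K s) A = (if 0 < s then ennreal (1 / w s) * g A s else indicator A 0)"
        using K_pos[OF _ A, of s] A by (cases "0 < s") (simp_all add: K_def)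
    qed
    ultimately show "(\<lambda>s. emeasure (K s) A) \<in> borel_measurable borel" by simp
  qed
  moreover have "G s = density (K s) (\<lambda>_. ennreal (w s))" if s: "0 < s" for s
  proof (rule measure_eqI)
    show "sets (G s) = sets (density (K s) (\<lambda>_. ennreal (w s)))" using K_sets G_sets[OF s, of "{}"] by simp
    fix A assume "A \<in> sets (G s)"
    then have A: "A \<in> sets borel" using G_sets[OF s, of "{}"] by simp
    have "emeasure (density (K s) (\<lambda>_. ennreal (w s))) A = ennreal (w s) * emeasure (K s) A"
      using A by (simp add: emeasure_density K_sets nn_integral_cmult_indicator)
    also have "\<dots> = g A s" using winv(2)[OF s] by (simp add: K_pos[OF s A] mult.assoc[symmetric])
    finally show "emeasure (G s) A = emeasure (density (K s) (\<lambda>_. ennreal (w s))) A"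
      by (simp add: G_eq[OF s A])
  qed
  ultimately show thesis using one that by (simp add: w_def)
qed

section \<open>The Abel integral equation\<close>

text \<open>This is the convolution of \<open>t\<^bsup>-\<beta>\<^esup>\<close> and \<open>t\<^bsup>\<beta>-1\<^esup>\<close>, which is constant in \<open>b - a\<close>.\<close>

lemma Beta_kernel_integral:
  fixes \<beta> a b :: real
  assumes \<beta>: "0 < \<beta>" "\<beta> < 1" and ab: "a < b"
  shows "has_bochner_integral lborel
    (\<lambda>t. indicator {a<..<b} t * ((b - t) powr (- \<beta>) * (t - a) powr (\<beta> - 1))) (Gamma \<beta> * Gamma (1 - \<beta>))"
proof (rule has_bochner_integral_nn_integral)
  let ?f = "\<lambda>t. ennreal (indicator {a<..<b} t * ((b - t) powr (- \<beta>) * (t - a) powr (\<beta> - 1)))"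
  have I: "((\<lambda>s. s powr (\<beta> - 1) * (1 - s) powr (1 - \<beta> - 1)) has_integral Beta \<beta> (1 - \<beta>)) {0..1}"
    using \<beta> by (intro has_integral_Beta_real) auto
  (* The substitution t = a + (b - a) * s leads to the Beta integral on the unit interval. *)
  have "integral\<^sup>N lborel ?f = ennreal \<bar>b - a\<bar> * (\<integral>\<^sup>+s. ?f (a + (b - a) * s) \<partial>lborel)"
    using ab by (intro nn_integral_real_affine) auto
  also have "\<dots> = (\<integral>\<^sup>+s. ennreal \<bar>b - a\<bar> * ?f (a + (b - a) * s) \<partial>lborel)"
    by (rule nn_integral_cmult[symmetric]) measurable
  also have "\<dots> = (\<integral>\<^sup>+s. ennreal (indicator {0..1} s * (s powr (\<beta> - 1) * (1 - s) powr (1 - \<beta> - 1))) \<partial>lborel)"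
  proof (rule nn_integral_cong)
    fix s :: real
    show "ennreal \<bar>b - a\<bar> * ?f (a + (b - a) * s) = ennreal (indicator {0..1} s * (s powr (\<beta> - 1) * (1 - s) powr (1 - \<beta> - 1)))"
    proof (cases "0 < s \<and> s < 1")
      case True
      have "0 < (b - a) * s" "(b - a) * s < b - a" using True ab by simp_all
      then have mem: "a + (b - a) * s \<in> {a<..<b}" by auto
      have "b - (a + (b - a) * s) = (b - a) * (1 - s)" by (simp add: algebra_simps)
      moreover have "(b - a) * ((b - a) powr (- \<beta>) * (b - a) powr (\<beta> - 1)) = 1"
      proof -
        have "(b - a) powr (- \<beta>) * (b - a) powr (\<beta> - 1) = (b - a) powr (- 1)"
          by (simp flip: powr_add)
        then show ?thesis using ab by (simp add: powr_minus)
      qed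
      ultimately have "(b - a) * ((b - (a + (b - a) * s)) powr (- \<beta>) * (a + (b - a) * s - a) powr (\<beta> - 1)) =
          s powr (\<beta> - 1) * (1 - s) powr (- \<beta>)"
        using True ab by (simp add: powr_mult ac_simps)
      then show ?thesis using mem True ab by (simp add: ennreal_mult'[symmetric])
    next
      case False
      then have "(b - a) * s \<le> 0 \<or> b - a \<le> (b - a) * s"
        using ab by (auto simp: mult_le_0_iff not_less)
      then have "a + (b - a) * s \<notin> {a<..<b}" by auto
      moreover have "indicator {0..1} s * (s powr (\<beta> - 1) * (1 - s) powr (1 - \<beta> - 1)) = (0 :: real)"
        using False by (cases "s = 0 \<or> s = 1") (auto simp: indicator_def)
      ultimately show ?thesis by simp
    qed
  qed
  also have "\<dots> = ennreal (Beta \<beta> (1 - \<beta>))"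
    by (rule nn_integral_has_integral_lebesgue[OF _ I]) simp
  also have "Beta \<beta> (1 - \<beta>) = Gamma \<beta> * Gamma (1 - \<beta>)" by (simp add: Beta_def)
  finally show "integral\<^sup>N lborel ?f = ennreal (Gamma \<beta> * Gamma (1 - \<beta>))" .
qed (use \<beta> Gamma_real_pos[of \<beta>] Gamma_real_pos[of "1 - \<beta>"] in auto)

text \<open>The positive and the negative part of \<open>v\<close> on \<open>(0, n)\<close> are densities of finite measures with
  the same distribution function.\<close>

lemma AE_zero_of_zero_primitive:
  fixes v :: "real \<Rightarrow> real"
  assumes int: "\<And>T. 0 < T \<Longrightarrow> set_integrable lborel {0<..<T} v"
    and zero: "\<And>T. 0 < T \<Longrightarrow> (LINT \<tau>:{0<..<T}|lborel. v \<tau>) = 0"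
  shows "AE \<tau> in lborel. 0 < \<tau> \<longrightarrow> v \<tau> = 0"
proof -
  have "AE \<tau> in lborel. 0 < \<tau> \<and> \<tau> < real n \<longrightarrow> v \<tau> = 0" if n: "0 < n" for n :: nat
  proof -
    define g where "g \<tau> = indicator {0<..<real n} \<tau> * v \<tau>" for \<tau>
    have g: "integrable lborel g" using int[of "real n"] n by (simp add: set_integrable_def g_def[abs_def])
    then have [measurable]: "g \<in> borel_measurable borel" by auto
    define M where "M s = density lborel (\<lambda>\<tau>. ennreal (s * g \<tau>))" for s
    have fin: "finite_borel_measure (M s)" for s
    proof (intro finite_borel_measure.intro finite_borel_measure_axioms.intro finite_measureI)
      have "emeasure (M s) (space (M s)) = (\<integral>\<^sup>+\<tau>. ennreal (s * g \<tau>) \<partial>lborel)"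
        by (simp add: M_def emeasure_density)
      also have "\<dots> \<le> (\<integral>\<^sup>+\<tau>. ennreal (norm (s * g \<tau>)) \<partial>lborel)" by (intro nn_integral_mono ennreal_leI) auto
      also have "\<dots> < \<infinity>" using integrable_mult_right[OF g, of s] unfolding integrable_iff_bounded by (rule conjunct2)
      finally show "emeasure (M s) (space (M s)) \<noteq> \<infinity>" by simp
    qed (simp add: M_def)
    have "cdf (M 1) = cdf (M (-1))"
    proof
      fix x
      have pos: "integrable lborel (\<lambda>\<tau>. max 0 (s * g \<tau>) * indicator {..x} \<tau>)" for s
        using g by (intro integrable_real_mult_indicator integrable_max) auto
      have m: "cdf (M s) x = (\<integral>\<tau>. max 0 (s * g \<tau>) * indicator {..x} \<tau> \<partial>lborel)" for s
      proof -
        have "emeasure (M s) {..x} = (\<integral>\<^sup>+\<tau>. ennreal (max 0 (s * g \<tau>) * indicator {..x} \<tau>) \<partial>lborel)"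
          unfolding M_def by (simp add: emeasure_density, intro nn_integral_cong) (auto simp: indicator_def max_def ennreal_neg)
        also have "\<dots> = ennreal (\<integral>\<tau>. max 0 (s * g \<tau>) * indicator {..x} \<tau> \<partial>lborel)"
          using pos by (intro nn_integral_eq_integral) auto
        finally show ?thesis
          unfolding cdf_def measure_def by (simp add: integral_nonneg)
      qed
      have "(\<integral>\<tau>. g \<tau> * indicator {..x} \<tau> \<partial>lborel) = 0"
      proof (cases "0 < x")
        case True
        have "integrable lborel (\<lambda>\<tau>. indicator {0<..<min x (real n)} \<tau> *\<^sub>R v \<tau>)"
          using int[of "min x (real n)"] True n by (simp add: set_integrable_def)
        then have "(\<lambda>\<tau>. indicator {0<..<min x (real n)} \<tau> *\<^sub>R v \<tau>) \<in> borel_measurable lborel"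
          by (rule borel_measurable_integrable)
        (* The two sides may differ at the right end point x. *)
        moreover have "AE \<tau> in lborel. g \<tau> * indicator {..x} \<tau> = indicator {0<..<min x (real n)} \<tau> *\<^sub>R v \<tau>"
          using AE_lborel_singleton[of x] by eventually_elim (auto simp: g_def indicator_def)
        ultimately have "(\<integral>\<tau>. g \<tau> * indicator {..x} \<tau> \<partial>lborel) = (\<integral>\<tau>. indicator {0<..<min x (real n)} \<tau> *\<^sub>R v \<tau> \<partial>lborel)"
          by (intro integral_cong_AE) auto
        then show ?thesis using zero[of "min x (real n)"] True n by (simp add: set_lebesgue_integral_def)
      next
        case False
        then have "(\<lambda>\<tau>. g \<tau> * indicator {..x} \<tau>) = (\<lambda>\<tau>. 0)" by (auto simp: g_def indicator_def fun_eq_iff)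
        then show ?thesis by simp
      qed
      moreover have "(\<integral>\<tau>. g \<tau> * indicator {..x} \<tau> \<partial>lborel) =
          (\<integral>\<tau>. max 0 (1 * g \<tau>) * indicator {..x} \<tau> - max 0 (- 1 * g \<tau>) * indicator {..x} \<tau> \<partial>lborel)"
        by (intro Bochner_Integration.integral_cong) (auto simp: max_def indicator_def)
      ultimately show "cdf (M 1) x = cdf (M (-1)) x"
        using pos[of 1] pos[of "-1"] by (simp only: m Bochner_Integration.integral_diff)
    qed
    then have "M 1 = M (-1)" by (rule cdf_unique'[OF fin fin])
    then have "AE \<tau> in lborel. ennreal (1 * g \<tau>) = ennreal (- 1 * g \<tau>)"
      unfolding M_def by (subst (asm) sigma_finite_measure.density_unique_iff[OF sigma_finite_lborel]) auto
    then show ?thesis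
    proof eventually_elim
      case (elim \<tau>)
      then have "g \<tau> = 0" by (cases "0 \<le> g \<tau>") (auto simp: ennreal_neg)
      then show ?case by (auto simp: g_def)
    qed
  qed
  then have "AE \<tau> in lborel. \<forall>n::nat. 0 < n \<longrightarrow> 0 < \<tau> \<and> \<tau> < real n \<longrightarrow> v \<tau> = 0"
    by (simp add: AE_all_countable)
  then show ?thesis
  proof eventually_elim
    case (elim \<tau>)
    obtain n :: nat where "\<tau> < real n" using reals_Archimedean2 by blast
    then show ?case using elim by (cases n) auto
  qed
qed

text \<open>Integrating the equation against \<open>(T - t)\<^bsup>-\<alpha>\<^esup>\<close> over \<open>0 < t < T\<close> and exchanging the integrals
  produces the constant Beta integral, and hence \<open>\<integral>\<^sub>0\<^sup>T w = 0\<close> for every \<open>T\<close>.\<close>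

lemma Abel_equation_unique:
  fixes w :: "real \<Rightarrow> real"
  assumes \<alpha>: "0 < \<alpha>" "\<alpha> < 1"
    and meas: "w \<in> borel_measurable (lebesgue_on {0<..})"
    and int: "\<And>t. 0 < t \<Longrightarrow> set_integrable lebesgue {0<..<t} (\<lambda>\<tau>. (t - \<tau>) powr (\<alpha> - 1) * w \<tau>)"
    and zero: "\<And>t. 0 < t \<Longrightarrow> (LINT \<tau>:{0<..<t}|lebesgue. (t - \<tau>) powr (\<alpha> - 1) * w \<tau>) = 0"
  shows "AE \<tau> in lebesgue. 0 < \<tau> \<longrightarrow> w \<tau> = 0"
proof -
  have "(\<lambda>\<tau>. indicator {0<..} \<tau> *\<^sub>R w \<tau>) \<in> borel_measurable lebesgue"
    using meas by (subst (asm) borel_measurable_restrict_space_iff) auto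
  (* A Borel version of w brings the problem to lborel, where Fubini applies. *)
  from completion_ex_borel_measurable_real[OF this]
  obtain v where "v \<in> borel_measurable lborel"
    and v: "AE \<tau> in lborel. indicator {0<..} \<tau> *\<^sub>R w \<tau> = v \<tau>" by blast
  then have [measurable]: "v \<in> borel_measurable borel" by simp
  let ?A = "\<lambda>t \<tau>. indicator {0<..<t} \<tau> * ((t - \<tau>) powr (\<alpha> - 1) * v \<tau>)"
  have A_int: "integrable lborel (?A t)" and A_zero: "(\<integral>\<tau>. ?A t \<tau> \<partial>lborel) = 0" if t: "0 < t" for t
  proof -
    have m: "?A t \<in> borel_measurable lborel" by measurable
    have "AE \<tau> in lborel. indicator {0<..<t} \<tau> *\<^sub>R ((t - \<tau>) powr (\<alpha> - 1) * w \<tau>) = ?A t \<tau>"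
      using v by eventually_elim (auto simp: indicator_def)
    then have ae: "AE \<tau> in lebesgue. indicator {0<..<t} \<tau> *\<^sub>R ((t - \<tau>) powr (\<alpha> - 1) * w \<tau>) = ?A t \<tau>"
      by (rule AE_completion)
    have l: "integrable lebesgue (\<lambda>\<tau>. indicator {0<..<t} \<tau> *\<^sub>R ((t - \<tau>) powr (\<alpha> - 1) * w \<tau>))"
      using int[OF t] by (simp add: set_integrable_def)
    have "integrable lebesgue (?A t)"
      by (rule integrable_cong_AE_imp[OF l measurable_completion[OF m]]) (use ae in \<open>simp only: eq_commute\<close>)
    then show "integrable lborel (?A t)" using m by (simp add: integrable_completion)
    have "(\<integral>\<tau>. ?A t \<tau> \<partial>lebesgue) = (\<integral>\<tau>. indicator {0<..<t} \<tau> *\<^sub>R ((t - \<tau>) powr (\<alpha> - 1) * w \<tau>) \<partial>lebesgue)"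
      by (rule integral_cong_AE[OF measurable_completion[OF m] borel_measurable_integrable[OF l] AE_symmetric[OF ae]])
    then show "(\<integral>\<tau>. ?A t \<tau> \<partial>lborel) = 0"
      using zero[OF t] unfolding set_lebesgue_integral_def integral_completion[OF m] by simp
  qed
  define c where "c = Gamma \<alpha> * Gamma (1 - \<alpha>)"
  have c: "0 < c" using \<alpha> by (simp add: c_def Gamma_real_pos)
  have v_int: "set_integrable lborel {0<..<T} v" if T: "0 < T" for T
    unfolding set_integrable_def
  proof (rule Bochner_Integration.integrable_bound)
    show "integrable lborel (\<lambda>\<tau>. T powr (1 - \<alpha>) * ?A T \<tau>)"
      by (rule integrable_mult_right[OF A_int[OF T]])
    show "AE \<tau> in lborel. norm (indicator {0<..<T} \<tau> *\<^sub>R v \<tau>) \<le> norm (T powr (1 - \<alpha>) * ?A T \<tau>)"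
    proof (intro AE_I2)
      fix \<tau>
      have "1 \<le> T powr (1 - \<alpha>) * (T - \<tau>) powr (\<alpha> - 1)" if "0 < \<tau>" "\<tau> < T"
      proof -
        have "T powr (\<alpha> - 1) \<le> (T - \<tau>) powr (\<alpha> - 1)" using that \<alpha> by (intro powr_mono2') auto
        from mult_left_mono[OF this, of "T powr (1 - \<alpha>)"] show ?thesis
          using T by (simp flip: powr_add)
      qed
      from mult_right_mono[OF this, of "\<bar>v \<tau>\<bar>"]
      show "norm (indicator {0<..<T} \<tau> *\<^sub>R v \<tau>) \<le> norm (T powr (1 - \<alpha>) * ?A T \<tau>)"
        by (auto simp: indicator_def abs_mult mult.assoc)
    qed
  qed measurable
  have v_zero: "(LINT \<tau>:{0<..<T}|lborel. v \<tau>) = 0" if T: "0 < T" for T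
  proof -
    define \<Phi> where "\<Phi> \<tau> t = indicator {\<tau><..<T} t * ((T - t) powr (- \<alpha>) * (t - \<tau>) powr (\<alpha> - 1))" for \<tau> t
    define F where "F = (\<lambda>(\<tau>, t). (indicator {0<..<T} \<tau> * v \<tau>) * \<Phi> \<tau> t)"
    have \<Phi>: "integrable lborel (\<Phi> \<tau>)" "(\<integral>t. \<Phi> \<tau> t \<partial>lborel) = c" if "\<tau> < T" for \<tau>
      using Beta_kernel_integral[OF \<alpha> that] by (auto simp: has_bochner_integral_iff \<Phi>_def[abs_def] c_def)
    have \<Phi>_nonneg: "0 \<le> \<Phi> \<tau> t" for \<tau> t by (simp add: \<Phi>_def)
    have F_meas: "F \<in> borel_measurable (lborel \<Otimes>\<^sub>M lborel)"
    proof -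
      have "(\<lambda>p. (indicator {0<..<T} (fst p) * v (fst p)) * ((if fst p < snd p \<and> snd p < T then 1 else 0) *
          ((T - snd p) powr (- \<alpha>) * (snd p - fst p) powr (\<alpha> - 1)))) \<in> borel_measurable (lborel \<Otimes>\<^sub>M lborel)"
        by measurable
      moreover have "F = (\<lambda>p. (indicator {0<..<T} (fst p) * v (fst p)) * ((if fst p < snd p \<and> snd p < T then 1 else 0) *
          ((T - snd p) powr (- \<alpha>) * (snd p - fst p) powr (\<alpha> - 1))))"
        by (auto simp: F_def \<Phi>_def fun_eq_iff indicator_def)
      ultimately show ?thesis by simp
    qed
    have F_int: "integrable (lborel \<Otimes>\<^sub>M lborel) F"
    proof (rule lborel_pair.Fubini_integrable[OF F_meas])
      have "(\<integral>t. norm (F (\<tau>, t)) \<partial>lborel) = c * norm (indicator {0<..<T} \<tau> *\<^sub>R v \<tau>)" for \<tau>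
        using \<Phi>(2)[of \<tau>] \<Phi>_nonneg by (auto simp: F_def abs_mult indicator_def)
      then show "integrable lborel (\<lambda>\<tau>. \<integral>t. norm (F (\<tau>, t)) \<partial>lborel)"
        using v_int[OF T] by (simp only: set_integrable_def) (intro integrable_mult_right integrable_norm)
      show "AE \<tau> in lborel. integrable lborel (\<lambda>t. F (\<tau>, t))"
        using \<Phi>(1) by (auto simp: F_def indicator_def)
    qed
    have "c * (LINT \<tau>:{0<..<T}|lborel. v \<tau>) = (\<integral>\<tau>. indicator {0<..<T} \<tau> * v \<tau> * (\<integral>t. \<Phi> \<tau> t \<partial>lborel) \<partial>lborel)"
      unfolding set_lebesgue_integral_def integral_mult_right_zero[symmetric]
      by (intro Bochner_Integration.integral_cong) (auto simp: \<Phi>(2) indicator_def)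
    also have "\<dots> = (\<integral>\<tau>. \<integral>t. F (\<tau>, t) \<partial>lborel \<partial>lborel)" by (simp add: F_def)
    also have "\<dots> = (\<integral>t. \<integral>\<tau>. F (\<tau>, t) \<partial>lborel \<partial>lborel)"
      using lborel_pair.Fubini_integral[of "\<lambda>\<tau> t. F (\<tau>, t)"] F_int by simp
    also have "\<dots> = (\<integral>t. 0 \<partial>(lborel :: real measure))"
    proof (rule Bochner_Integration.integral_cong[OF refl])
      fix t :: real
      show "(\<integral>\<tau>. F (\<tau>, t) \<partial>lborel) = 0"
      proof (cases "0 < t \<and> t < T")
        case True
        then have "(\<integral>\<tau>. F (\<tau>, t) \<partial>lborel) = (\<integral>\<tau>. (T - t) powr (- \<alpha>) * ?A t \<tau> \<partial>lborel)"
          by (intro Bochner_Integration.integral_cong) (auto simp: F_def \<Phi>_def indicator_def)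
        then show ?thesis using A_zero[of t] True by simp
      next
        case False
        then have "F (\<tau>, t) = 0" for \<tau> by (auto simp: F_def \<Phi>_def indicator_def)
        then show ?thesis by simp
      qed
    qed
    finally show ?thesis using c by simp
  qed
  have "AE \<tau> in lborel. 0 < \<tau> \<longrightarrow> v \<tau> = 0"
    by (rule AE_zero_of_zero_primitive[OF v_int v_zero])
  with v have "AE \<tau> in lborel. 0 < \<tau> \<longrightarrow> w \<tau> = 0"
    by eventually_elim auto
  then show ?thesis by (rule AE_completion)
qed

lemma Beta_set_integral:
  fixes \<alpha> t :: real
  assumes \<alpha>: "0 < \<alpha>" "\<alpha> < 1" and t: "0 < t"
  shows "set_integrable lebesgue {0<..<t} (\<lambda>\<tau>. (t - \<tau>) powr (\<alpha> - 1) * (\<tau> powr (- \<alpha>) / Gamma (1 - \<alpha>)))"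
    and "(LINT \<tau>:{0<..<t}|lebesgue. (t - \<tau>) powr (\<alpha> - 1) * (\<tau> powr (- \<alpha>) / Gamma (1 - \<alpha>))) = Gamma \<alpha>"
proof -
  let ?f = "\<lambda>\<tau>. indicator {0<..<t} \<tau> *\<^sub>R ((t - \<tau>) powr (\<alpha> - 1) * (\<tau> powr (- \<alpha>) / Gamma (1 - \<alpha>)))"
  have "has_bochner_integral lborel
      (\<lambda>\<tau>. indicator {0<..<t} \<tau> * ((t - \<tau>) powr (- (1 - \<alpha>)) * (\<tau> - 0) powr (1 - \<alpha> - 1)) / Gamma (1 - \<alpha>))
      (Gamma (1 - \<alpha>) * Gamma (1 - (1 - \<alpha>)) / Gamma (1 - \<alpha>))"
    using \<alpha> t by (intro has_bochner_integral_divide_zero Beta_kernel_integral) auto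
  moreover have "Gamma (1 - \<alpha>) * Gamma (1 - (1 - \<alpha>)) / Gamma (1 - \<alpha>) = Gamma \<alpha>"
    using Gamma_real_pos[of "1 - \<alpha>"] \<alpha> by (simp add: less_imp_neq[symmetric])
  moreover have "(\<lambda>\<tau>. indicator {0<..<t} \<tau> * ((t - \<tau>) powr (- (1 - \<alpha>)) * (\<tau> - 0) powr (1 - \<alpha> - 1)) / Gamma (1 - \<alpha>)) = ?f"
    by (auto simp: fun_eq_iff)
  ultimately have "has_bochner_integral lborel ?f (Gamma \<alpha>)" by simp
  then have "integrable lborel ?f" "integral\<^sup>L lborel ?f = Gamma \<alpha>"
    by (simp_all add: has_bochner_integral_iff)
  moreover from this have m: "?f \<in> borel_measurable lborel" by blast
  ultimately show "set_integrable lebesgue {0<..<t} (\<lambda>\<tau>. (t - \<tau>) powr (\<alpha> - 1) * (\<tau> powr (- \<alpha>) / Gamma (1 - \<alpha>)))"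
    and "(LINT \<tau>:{0<..<t}|lebesgue. (t - \<tau>) powr (\<alpha> - 1) * (\<tau> powr (- \<alpha>) / Gamma (1 - \<alpha>))) = Gamma \<alpha>"
    unfolding set_integrable_def set_lebesgue_integral_def
    by (simp_all only: integrable_completion[OF m] integral_completion[OF m])
qed

section \<open>The Duhamel integral\<close>

text \<open>Here \<open>K\<close> is the normalised kernel; the factor \<open>weight\<close> below restores the mass of \<open>G\<close>.\<close>

locale causal_convolution =
  fixes \<alpha> :: real and K :: "real \<Rightarrow> 'a::euclidean_space measure" and f :: "real \<Rightarrow> 'a set \<Rightarrow> real"
  assumes \<alpha>: "0 < \<alpha>"
    and K: "K \<in> borel \<rightarrow>\<^sub>M prob_algebra borel"
    and f: "signed_kernel (lebesgue_on {0<..}) f"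
    and f_int: "\<And>t. 0 < t \<Longrightarrow>
      (\<integral>\<^sup>+\<tau>\<in>{0<..<t}. ennreal ((t - \<tau>) powr (\<alpha> - 1)) * tv_norm (f \<tau>) \<partial>lebesgue) < \<infinity>"
begin

definition weight :: "real \<Rightarrow> real" where
  "weight s = s powr (\<alpha> - 1) / Gamma \<alpha>"

definition average :: "('a \<Rightarrow> real) \<Rightarrow> real \<Rightarrow> 'a \<Rightarrow> real" where
  "average \<phi> s y = (\<integral>x. \<phi> (x + y) \<partial>K s)"

text \<open>The value at \<open>\<phi>\<close> of the weak-* integral that defines the solution.\<close>

definition pairing :: "real \<Rightarrow> ('a \<Rightarrow> real) \<Rightarrow> real" where
  "pairing t \<phi> = (LINT \<tau>:{0<..<t}|lebesgue. weight (t - \<tau>) * signed_integral (f \<tau>) (average \<phi> (t - \<tau>)))"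

definition solution :: "real \<Rightarrow> 'a set \<Rightarrow> real" where
  "solution t A = (if A \<in> sets borel then pairing t (indicator A) else 0)"

lemma weight_nonneg: "0 \<le> weight s"
  using Gamma_real_pos[OF \<alpha>] by (simp add: weight_def)

lemma weight_measurable [measurable]: "weight \<in> borel_measurable borel"
  unfolding weight_def[abs_def] by measurable

lemma prob_K: "prob_space (K s)" and sets_K [measurable_cong, simp]: "sets (K s) = sets borel"
  using measurable_space[OF K, of s] by (simp_all add: space_prob_algebra)

lemma finite_K: "finite_measure (K s)"
  using prob_K[of s] by (rule prob_space.finite_measure)

lemma space_K [simp]: "space (K s) = UNIV"
  using sets_eq_imp_space_eq[OF sets_K] by simp

lemma measure_K_UNIV [simp]: "measure (K s) UNIV = 1"
  using prob_space.prob_space[OF prob_K, of s] by simp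

lemma f_signed: "0 < \<tau> \<Longrightarrow> signed_measure (f \<tau>)"
  using signed_kernelD[OF f, of \<tau>] by simp

lemma average_section_measurable:
  "\<phi> \<in> borel_measurable borel \<Longrightarrow> average \<phi> s \<in> borel_measurable borel"
  unfolding average_def[abs_def] by (rule translation_average_measurable[OF finite_K sets_K])

lemma average_bounded:
  assumes "\<phi> \<in> borel_measurable borel" "\<And>x. \<bar>\<phi> x\<bar> \<le> C"
  shows "\<bar>average \<phi> s y\<bar> \<le> C"
  using translation_average_bounded(2)[OF finite_K sets_K assms] by (simp add: average_def)

lemma average_measurable:
  assumes \<phi>: "\<phi> \<in> borel_measurable borel" "\<And>x. \<bar>\<phi> x\<bar> \<le> C"
  shows "(\<lambda>p. average \<phi> (fst p) (snd p)) \<in> borel_measurable borel"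
proof -
  have F: "signed_kernel borel (\<lambda>p :: real \<times> 'a. measure (K (fst p)))"
    unfolding signed_kernel_def
  proof (intro conjI ballI)
    show "signed_measure (measure (K (fst p)))" for p :: "real \<times> 'a"
      by (rule signed_measure_of_finite_measure[OF finite_K sets_K])
    fix \<psi> :: "'a \<Rightarrow> real" assume "\<psi> \<in> C0"
    then have "(\<lambda>M. integral\<^sup>L M \<psi>) \<in> borel_measurable (subprob_algebra borel)"
      by (intro integral_measurable_subprob_algebra C0_measurable)
    from measurable_compose[OF measurable_prob_algebraD[OF K] this]
    have "(\<lambda>s. \<integral>x. \<psi> x \<partial>K s) \<in> borel_measurable borel" .
    then have "(\<lambda>p :: real \<times> 'a. \<integral>x. \<psi> x \<partial>K (fst p)) \<in> borel_measurable borel"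
      by (rule measurable_compose[rotated]) (intro borel_measurable_continuous_onI continuous_intros)
    then show "(\<lambda>p :: real \<times> 'a. signed_integral (measure (K (fst p))) \<psi>) \<in> borel_measurable borel"
      by (simp add: signed_integral_finite_measure[OF finite_K sets_K])
  qed
  have "(\<lambda>p :: real \<times> 'a. signed_integral (measure (K (fst p))) (\<lambda>x. \<phi> (snd (snd p, x) + fst (snd p, x)))) \<in> borel_measurable borel"
  proof (rule signed_kernel_integral_measurable_param[OF F, of snd "\<lambda>q. \<phi> (snd q + fst q)" C])
    show "(snd :: real \<times> 'a \<Rightarrow> 'a) \<in> borel_measurable borel"
      by (intro borel_measurable_continuous_onI continuous_intros)
    show "(\<lambda>q. \<phi> (snd q + fst q)) \<in> borel_measurable borel"
      by (rule measurable_compose[OF _ \<phi>(1)]) (intro borel_measurable_continuous_onI continuous_intros)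
  qed (rule \<phi>(2))
  then show ?thesis
    by (simp add: average_def signed_integral_finite_measure[OF finite_K sets_K])
qed

lemma signed_integral_average_measurable:
  assumes \<phi>: "\<phi> \<in> borel_measurable borel" "\<And>x. \<bar>\<phi> x\<bar> \<le> C"
  shows "(\<lambda>\<tau>. signed_integral (f \<tau>) (average \<phi> (t - \<tau>))) \<in> borel_measurable (lebesgue_on {0<..})"
proof -
  have "(\<lambda>\<tau>. t - \<tau>) \<in> borel_measurable (lebesgue_on {0<..})"
    by (intro measurable_restrict_space1 measurable_completion) measurable
  from signed_kernel_integral_measurable_param[OF f this average_measurable[OF \<phi>] average_bounded[OF \<phi>]]
  show ?thesis by simp
qed

lemma set_measurable_of_kernel:
  fixes g :: "real \<Rightarrow> real"
  assumes "g \<in> borel_measurable (lebesgue_on {0<..})"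
  shows "(\<lambda>\<tau>. indicator {0<..<t} \<tau> *\<^sub>R (weight (t - \<tau>) * g \<tau>)) \<in> borel_measurable lebesgue"
proof -
  have "(\<lambda>\<tau>. indicator {0<..} \<tau> *\<^sub>R g \<tau>) \<in> borel_measurable lebesgue"
    using assms by (subst (asm) borel_measurable_restrict_space_iff) auto
  moreover have "(\<lambda>\<tau>. indicator {0<..<t} \<tau> * weight (t - \<tau>)) \<in> borel_measurable lebesgue"
    by (rule measurable_completion) measurable
  ultimately have "(\<lambda>\<tau>. indicator {0<..<t} \<tau> * weight (t - \<tau>) * (indicator {0<..} \<tau> *\<^sub>R g \<tau>)) \<in> borel_measurable lebesgue"
    by (rule borel_measurable_times[rotated])
  moreover have "(\<lambda>\<tau>. indicator {0<..<t} \<tau> * weight (t - \<tau>) * (indicator {0<..} \<tau> *\<^sub>R g \<tau>)) =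
      (\<lambda>\<tau>. indicator {0<..<t} \<tau> *\<^sub>R (weight (t - \<tau>) * g \<tau>))"
    by (auto simp: indicator_def fun_eq_iff)
  ultimately show ?thesis by simp
qed

text \<open>The nonnegative integral of a nonmeasurable function is only a lower integral; measurability of
  the total variation is what turns \<open>f_int\<close> into integrability.\<close>

lemma tv_integrable:
  assumes t: "0 < t"
  shows "set_integrable lebesgue {0<..<t} (\<lambda>\<tau>. weight (t - \<tau>) * enn2real (tv_norm (f \<tau>)))"
  unfolding set_integrable_def
proof (rule integrableI_bounded)
  show "(\<lambda>\<tau>. indicator {0<..<t} \<tau> *\<^sub>R (weight (t - \<tau>) * enn2real (tv_norm (f \<tau>)))) \<in> borel_measurable lebesgue"
    by (intro set_measurable_of_kernel borel_measurable_enn2real signed_kernel_tv_norm_measurable f)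
  have "(\<integral>\<^sup>+\<tau>. ennreal (norm (indicator {0<..<t} \<tau> *\<^sub>R (weight (t - \<tau>) * enn2real (tv_norm (f \<tau>))))) \<partial>lebesgue) =
    (\<integral>\<^sup>+\<tau>. ennreal (1 / Gamma \<alpha>) * (ennreal ((t - \<tau>) powr (\<alpha> - 1)) * tv_norm (f \<tau>) * indicator {0<..<t} \<tau>) \<partial>lebesgue)"
  proof (rule nn_integral_cong)
    fix \<tau>
    show "ennreal (norm (indicator {0<..<t} \<tau> *\<^sub>R (weight (t - \<tau>) * enn2real (tv_norm (f \<tau>))))) =
        ennreal (1 / Gamma \<alpha>) * (ennreal ((t - \<tau>) powr (\<alpha> - 1)) * tv_norm (f \<tau>) * indicator {0<..<t} \<tau>)"
    proof (cases "\<tau> \<in> {0<..<t}")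
      case True
      then have "tv_norm (f \<tau>) = ennreal (enn2real (tv_norm (f \<tau>)))"
        using tv_norm_finite[OF f_signed, of \<tau>] by (simp add: less_top)
      moreover have "ennreal (weight (t - \<tau>) * x) = ennreal (1 / Gamma \<alpha>) * (ennreal ((t - \<tau>) powr (\<alpha> - 1)) * ennreal x)"
        if "0 \<le> x" for x
        using Gamma_real_pos[OF \<alpha>] that
        by (simp add: weight_def ennreal_mult[symmetric] field_simps)
      ultimately show ?thesis using True weight_nonneg[of "t - \<tau>"] by (simp add: abs_mult)
    qed simp
  qed
  also have "\<dots> = ennreal (1 / Gamma \<alpha>) *
      (\<integral>\<^sup>+\<tau>\<in>{0<..<t}. ennreal ((t - \<tau>) powr (\<alpha> - 1)) * tv_norm (f \<tau>) \<partial>lebesgue)"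
  proof (rule nn_integral_cmult)
    have "(\<lambda>\<tau>. indicator {0<..} \<tau> * tv_norm (f \<tau>)) \<in> borel_measurable lebesgue"
      using signed_kernel_tv_norm_measurable[OF f]
      by (subst (asm) borel_measurable_restrict_space_iff_ennreal) (auto simp: mult.commute)
    moreover have "(\<lambda>\<tau>. indicator {0<..<t} \<tau> * ennreal ((t - \<tau>) powr (\<alpha> - 1))) \<in> borel_measurable lebesgue"
      by (rule measurable_completion) measurable
    ultimately have "(\<lambda>\<tau>. indicator {0<..<t} \<tau> * ennreal ((t - \<tau>) powr (\<alpha> - 1)) * (indicator {0<..} \<tau> * tv_norm (f \<tau>))) \<in> borel_measurable lebesgue"
      by (rule borel_measurable_times_ennreal[rotated])
    moreover have "(\<lambda>\<tau>. indicator {0<..<t} \<tau> * ennreal ((t - \<tau>) powr (\<alpha> - 1)) * (indicator {0<..} \<tau> * tv_norm (f \<tau>))) =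
      (\<lambda>\<tau>. ennreal ((t - \<tau>) powr (\<alpha> - 1)) * tv_norm (f \<tau>) * indicator {0<..<t} \<tau>)"
      by (auto simp: indicator_def fun_eq_iff)
    ultimately show "(\<lambda>\<tau>. ennreal ((t - \<tau>) powr (\<alpha> - 1)) * tv_norm (f \<tau>) * indicator {0<..<t} \<tau>) \<in> borel_measurable lebesgue"
      by simp
  qed
  also have "\<dots> < \<infinity>" using f_int[OF t] by (simp add: ennreal_mult_less_top)
  finally show "(\<integral>\<^sup>+\<tau>. ennreal (norm (indicator {0<..<t} \<tau> *\<^sub>R (weight (t - \<tau>) * enn2real (tv_norm (f \<tau>))))) \<partial>lebesgue) < \<infinity>" .
qed

lemma pairing_integrand_bound:
  assumes \<phi>: "\<phi> \<in> borel_measurable borel" "\<And>x. \<bar>\<phi> x\<bar> \<le> C" and \<tau>: "0 < \<tau>"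
  shows "\<bar>weight (t - \<tau>) * signed_integral (f \<tau>) (average \<phi> (t - \<tau>))\<bar> \<le>
    C * (weight (t - \<tau>) * enn2real (tv_norm (f \<tau>)))"
proof -
  have "\<bar>signed_integral (f \<tau>) (average \<phi> (t - \<tau>))\<bar> \<le> C * enn2real (tv_norm (f \<tau>))"
    by (rule abs_signed_integral_le[OF f_signed[OF \<tau>] average_section_measurable[OF \<phi>(1)] average_bounded[OF \<phi>]])
  from mult_left_mono[OF this weight_nonneg[of "t - \<tau>"]] show ?thesis
    using weight_nonneg[of "t - \<tau>"] by (simp add: abs_mult ac_simps)
qed

lemma pairing_integrable:
  assumes t: "0 < t" and \<phi>: "\<phi> \<in> borel_measurable borel" "\<And>x. \<bar>\<phi> x\<bar> \<le> C"
  shows "set_integrable lebesgue {0<..<t} (\<lambda>\<tau>. weight (t - \<tau>) * signed_integral (f \<tau>) (average \<phi> (t - \<tau>)))"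
  unfolding set_integrable_def
proof (rule Bochner_Integration.integrable_bound)
  show "integrable lebesgue (\<lambda>\<tau>. C * (indicator {0<..<t} \<tau> *\<^sub>R (weight (t - \<tau>) * enn2real (tv_norm (f \<tau>)))))"
    using tv_integrable[OF t] by (simp add: set_integrable_def)
  show "(\<lambda>\<tau>. indicator {0<..<t} \<tau> *\<^sub>R (weight (t - \<tau>) * signed_integral (f \<tau>) (average \<phi> (t - \<tau>)))) \<in> borel_measurable lebesgue"
    by (rule set_measurable_of_kernel[OF signed_integral_average_measurable[OF \<phi>]])
  show "AE \<tau> in lebesgue. norm (indicator {0<..<t} \<tau> *\<^sub>R (weight (t - \<tau>) * signed_integral (f \<tau>) (average \<phi> (t - \<tau>)))) \<le>
      norm (C * (indicator {0<..<t} \<tau> *\<^sub>R (weight (t - \<tau>) * enn2real (tv_norm (f \<tau>)))))"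
  proof (intro AE_I2)
    fix \<tau>
    show "norm (indicator {0<..<t} \<tau> *\<^sub>R (weight (t - \<tau>) * signed_integral (f \<tau>) (average \<phi> (t - \<tau>)))) \<le>
      norm (C * (indicator {0<..<t} \<tau> *\<^sub>R (weight (t - \<tau>) * enn2real (tv_norm (f \<tau>)))))"
      using pairing_integrand_bound[OF \<phi>, of \<tau> t] by (auto simp: indicator_def intro: order_trans[OF _ abs_ge_self])
  qed
qed

lemma average_add:
  assumes "\<phi> \<in> borel_measurable borel" "\<And>x. \<bar>\<phi> x\<bar> \<le> C" "\<psi> \<in> borel_measurable borel" "\<And>x. \<bar>\<psi> x\<bar> \<le> D"
  shows "average (\<lambda>x. \<phi> x + \<psi> x) s = (\<lambda>y. average \<phi> s y + average \<psi> s y)"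
  unfolding average_def fun_eq_iff
  using translation_average_bounded(1)[OF finite_K sets_K assms(1,2)] translation_average_bounded(1)[OF finite_K sets_K assms(3,4)]
  by (auto intro: Bochner_Integration.integral_add)

lemma average_cmult: "average (\<lambda>x. c * \<phi> x) s = (\<lambda>y. c * average \<phi> s y)"
  unfolding average_def fun_eq_iff by simp

lemma average_const: "average (\<lambda>x. c) s = (\<lambda>y. c)"
  by (simp add: average_def fun_eq_iff)

lemma average_tendsto:
  assumes \<Phi>: "\<And>n::nat. \<Phi> n \<in> borel_measurable borel" "\<And>n x. \<bar>\<Phi> n x\<bar> \<le> C" "\<And>x. (\<lambda>n. \<Phi> n x) \<longlonglongrightarrow> \<phi> x"
  shows "(\<lambda>n. average (\<Phi> n) s y) \<longlonglongrightarrow> average \<phi> s y"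
proof -
  interpret finite_measure "K s" by (rule finite_K)
  have [measurable]: "\<phi> \<in> borel_measurable borel"
    using borel_measurable_LIMSEQ_real[of borel \<Phi> \<phi>] \<Phi> by auto
  note [measurable] = \<Phi>(1)
  show ?thesis
    unfolding average_def using \<Phi>(2,3)
    by (intro integral_dominated_convergence[where w="\<lambda>_. C"]) auto
qed

lemma pairing_add:
  assumes t: "0 < t" and \<phi>: "\<phi> \<in> borel_measurable borel" "\<And>x. \<bar>\<phi> x\<bar> \<le> C"
    and \<psi>: "\<psi> \<in> borel_measurable borel" "\<And>x. \<bar>\<psi> x\<bar> \<le> D"
  shows "pairing t (\<lambda>x. \<phi> x + \<psi> x) = pairing t \<phi> + pairing t \<psi>"
proof -
  have "pairing t (\<lambda>x. \<phi> x + \<psi> x) = (LINT \<tau>:{0<..<t}|lebesgue.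
      weight (t - \<tau>) * signed_integral (f \<tau>) (average \<phi> (t - \<tau>)) +
      weight (t - \<tau>) * signed_integral (f \<tau>) (average \<psi> (t - \<tau>)))"
    unfolding pairing_def
  proof (rule set_lebesgue_integral_cong)
    show "\<forall>\<tau>. \<tau> \<in> {0<..<t} \<longrightarrow> weight (t - \<tau>) * signed_integral (f \<tau>) (average (\<lambda>x. \<phi> x + \<psi> x) (t - \<tau>)) =
      weight (t - \<tau>) * signed_integral (f \<tau>) (average \<phi> (t - \<tau>)) +
      weight (t - \<tau>) * signed_integral (f \<tau>) (average \<psi> (t - \<tau>))"
      using signed_integral_add[OF f_signed average_section_measurable[OF \<phi>(1)] average_bounded[OF \<phi>]
          average_section_measurable[OF \<psi>(1)] average_bounded[OF \<psi>]]
      by (simp add: average_add[OF \<phi> \<psi>] distrib_left)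
  qed simp
  also have "\<dots> = pairing t \<phi> + pairing t \<psi>"
    unfolding pairing_def by (intro set_integral_add pairing_integrable[OF t \<phi>] pairing_integrable[OF t \<psi>])
  finally show ?thesis .
qed

lemma pairing_cmult: "pairing t (\<lambda>x. c * \<phi> x) = c * pairing t \<phi>"
  unfolding pairing_def average_cmult signed_integral_cmult
  by (simp add: mult.left_commute)

lemma pairing_tendsto:
  assumes t: "0 < t"
    and \<Phi>: "\<And>n::nat. \<Phi> n \<in> borel_measurable borel" "\<And>n x. \<bar>\<Phi> n x\<bar> \<le> C" "\<And>x. (\<lambda>n. \<Phi> n x) \<longlonglongrightarrow> \<phi> x"
  shows "(\<lambda>n. pairing t (\<Phi> n)) \<longlonglongrightarrow> pairing t \<phi>"
  unfolding pairing_def set_lebesgue_integral_def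
proof (rule integral_dominated_convergence)
  have \<phi>: "\<phi> \<in> borel_measurable borel"
    using borel_measurable_LIMSEQ_real[of borel \<Phi> \<phi>] \<Phi> by auto
  have bd: "\<bar>\<phi> x\<bar> \<le> C" for x
    by (rule LIMSEQ_le_const2[OF tendsto_rabs[OF \<Phi>(3)]]) (use \<Phi>(2) in auto)
  show "integrable lebesgue (\<lambda>\<tau>. C * (indicator {0<..<t} \<tau> *\<^sub>R (weight (t - \<tau>) * enn2real (tv_norm (f \<tau>)))))"
    using tv_integrable[OF t] by (simp add: set_integrable_def)
  show "(\<lambda>\<tau>. indicator {0<..<t} \<tau> *\<^sub>R (weight (t - \<tau>) * signed_integral (f \<tau>) (average \<phi> (t - \<tau>)))) \<in> borel_measurable lebesgue"
    by (rule set_measurable_of_kernel[OF signed_integral_average_measurable[OF \<phi> bd]])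
  show "(\<lambda>\<tau>. indicator {0<..<t} \<tau> *\<^sub>R (weight (t - \<tau>) * signed_integral (f \<tau>) (average (\<Phi> n) (t - \<tau>)))) \<in> borel_measurable lebesgue" for n
    by (rule set_measurable_of_kernel[OF signed_integral_average_measurable[OF \<Phi>(1,2)]])
  show "AE \<tau> in lebesgue. norm (indicator {0<..<t} \<tau> *\<^sub>R (weight (t - \<tau>) * signed_integral (f \<tau>) (average (\<Phi> n) (t - \<tau>)))) \<le>
      C * (indicator {0<..<t} \<tau> *\<^sub>R (weight (t - \<tau>) * enn2real (tv_norm (f \<tau>))))" for n
    using pairing_integrand_bound[OF \<Phi>(1,2)] by (intro AE_I2) (auto simp: indicator_def)
  show "AE \<tau> in lebesgue. (\<lambda>n. indicator {0<..<t} \<tau> *\<^sub>R (weight (t - \<tau>) * signed_integral (f \<tau>) (average (\<Phi> n) (t - \<tau>)))) \<longlonglongrightarrow>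
      indicator {0<..<t} \<tau> *\<^sub>R (weight (t - \<tau>) * signed_integral (f \<tau>) (average \<phi> (t - \<tau>)))"
  proof (intro AE_I2)
    fix \<tau>
    show "(\<lambda>n. indicator {0<..<t} \<tau> *\<^sub>R (weight (t - \<tau>) * signed_integral (f \<tau>) (average (\<Phi> n) (t - \<tau>)))) \<longlonglongrightarrow>
      indicator {0<..<t} \<tau> *\<^sub>R (weight (t - \<tau>) * signed_integral (f \<tau>) (average \<phi> (t - \<tau>)))"
    proof (cases "\<tau> \<in> {0<..<t}")
      case True
      then have "signed_measure (f \<tau>)" by (simp add: f_signed)
      from signed_integral_tendsto[OF this average_section_measurable[OF \<Phi>(1)] average_bounded[OF \<Phi>(1,2)] average_tendsto[OF \<Phi>]]
      show ?thesis by (intro tendsto_intros)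
    qed simp
  qed
qed

lemma
  assumes t: "0 < t"
  shows signed_measure_solution: "signed_measure (solution t)"
    and signed_integral_solution: "\<And>\<phi> C. \<phi> \<in> borel_measurable borel \<Longrightarrow> (\<And>x. \<bar>\<phi> x\<bar> \<le> C) \<Longrightarrow>
      signed_integral (solution t) \<phi> = pairing t \<phi>"
proof -
  show "signed_measure (solution t)"
    unfolding solution_def[abs_def]
    by (rule signed_measure_of_continuous_functional(1)[of "pairing t"])
       (fact pairing_add[OF t], rule pairing_cmult, fact pairing_tendsto[OF t])
  show "signed_integral (solution t) \<phi> = pairing t \<phi>"
    if "\<phi> \<in> borel_measurable borel" "\<And>x. \<bar>\<phi> x\<bar> \<le> C" for \<phi> C
    unfolding solution_def[abs_def]
    by (rule signed_measure_of_continuous_functional(2)[of "pairing t"])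
       (fact pairing_add[OF t], rule pairing_cmult, fact pairing_tendsto[OF t], fact that(1), fact that(2))
qed

lemma solution_UNIV:
  "solution t UNIV = 1 / Gamma \<alpha> * (LINT \<tau>:{0<..<t}|lebesgue. (t - \<tau>) powr (\<alpha> - 1) * f \<tau> UNIV)"
proof -
  have "solution t UNIV = (LINT \<tau>:{0<..<t}|lebesgue. 1 / Gamma \<alpha> * ((t - \<tau>) powr (\<alpha> - 1) * f \<tau> UNIV))"
    unfolding solution_def pairing_def if_P[OF sets.top[of borel, unfolded space_borel]]
  proof (intro set_lebesgue_integral_cong allI impI)
    fix \<tau> assume \<tau>: "\<tau> \<in> {0<..<t}"
    have "average (indicator UNIV) (t - \<tau>) = (\<lambda>y. 1)"
    proof -
      have "(indicator UNIV :: 'a \<Rightarrow> real) = (\<lambda>x. 1)" by auto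
      then show ?thesis by (simp only: average_const)
    qed
    then have "signed_integral (f \<tau>) (average (indicator UNIV) (t - \<tau>)) = f \<tau> UNIV"
      using \<tau> by (simp add: signed_integral_const f_signed)
    then show "weight (t - \<tau>) * signed_integral (f \<tau>) (average (indicator UNIV) (t - \<tau>)) =
        1 / Gamma \<alpha> * ((t - \<tau>) powr (\<alpha> - 1) * f \<tau> UNIV)"
      by (simp add: weight_def)
  qed simp
  then show ?thesis by simp
qed

lemma signed_integral_convolution:
  assumes G: "\<And>s. 0 < s \<Longrightarrow> G s = density (K s) (\<lambda>_. ennreal (weight s))"
    and \<tau>: "0 < \<tau>" "\<tau> < t" and \<phi>: "\<phi> \<in> borel_measurable borel" "\<And>x. \<bar>\<phi> x\<bar> \<le> C"
  shows "signed_integral (signed_convolution (measure (G (t - \<tau>))) (f \<tau>)) \<phi> =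
    weight (t - \<tau>) * signed_integral (f \<tau>) (average \<phi> (t - \<tau>))"
proof -
  note [measurable] = \<phi>(1)
  have Gs: "G (t - \<tau>) = density (K (t - \<tau>)) (\<lambda>_. ennreal (weight (t - \<tau>)))"
    using \<tau> by (intro G) simp
  have "finite_measure (G (t - \<tau>))"
  proof
    have "emeasure (G (t - \<tau>)) (space (G (t - \<tau>))) = ennreal (weight (t - \<tau>))"
      unfolding Gs using prob_space.emeasure_space_1[OF prob_K, of "t - \<tau>"]
      by (simp add: emeasure_density)
    then show "emeasure (G (t - \<tau>)) (space (G (t - \<tau>))) \<noteq> \<infinity>" by simp
  qed
  moreover have "sets (G (t - \<tau>)) = sets borel" by (simp add: Gs)
  moreover have "(\<integral>x. \<phi> (x + y) \<partial>G (t - \<tau>)) = weight (t - \<tau>) * average \<phi> (t - \<tau>) y" for y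
    unfolding Gs average_def by (subst integral_density) (auto simp: weight_nonneg)
  ultimately show ?thesis
    using signed_convolution(2)[OF _ _ f_signed[OF \<tau>(1)] \<phi>] by (simp add: signed_integral_cmult)
qed

lemma has_weak_star_integral_solution:
  assumes G: "\<And>s. 0 < s \<Longrightarrow> G s = density (K s) (\<lambda>_. ennreal (weight s))" and t: "0 < t"
  shows "has_weak_star_integral (\<lambda>\<tau>. signed_convolution (measure (G (t - \<tau>))) (f \<tau>)) (solution t) {0<..<t}"
  unfolding has_weak_star_integral_def
proof (intro conjI ballI)
  show "signed_measure (solution t)" by (rule signed_measure_solution[OF t])
  fix \<phi> :: "'a \<Rightarrow> real" assume C0: "\<phi> \<in> C0"
  obtain C where C: "0 \<le> C" "\<And>x. \<bar>\<phi> x\<bar> \<le> C" using C0_bounded[OF C0] by blast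
  note \<phi> = C0_measurable[OF C0] C(2)
  have eq: "\<forall>\<tau>. \<tau> \<in> {0<..<t} \<longrightarrow> weight (t - \<tau>) * signed_integral (f \<tau>) (average \<phi> (t - \<tau>)) =
      signed_integral (signed_convolution (measure (G (t - \<tau>))) (f \<tau>)) \<phi>"
    using signed_integral_convolution[OF G _ _ \<phi>] by simp
  show "signed_integral (solution t) \<phi> =
      (LINT \<tau>:{0<..<t}|lebesgue. signed_integral (signed_convolution (measure (G (t - \<tau>))) (f \<tau>)) \<phi>)"
    unfolding signed_integral_solution[OF t \<phi>] pairing_def using eq
    by (intro set_lebesgue_integral_cong) auto
  show "set_integrable lebesgue {0<..<t} (\<lambda>\<tau>. signed_integral (signed_convolution (measure (G (t - \<tau>))) (f \<tau>)) \<phi>)"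
    using pairing_integrable[OF t \<phi>] eq
    by (subst (asm) set_integrable_cong[OF refl refl]) auto
qed

lemma weak_star_integral_eq_solution:
  assumes G: "\<And>s. 0 < s \<Longrightarrow> G s = density (K s) (\<lambda>_. ennreal (weight s))" and t: "0 < t"
  shows "weak_star_integral {0<..<t} (\<lambda>\<tau>. signed_convolution (measure (G (t - \<tau>))) (f \<tau>)) = solution t"
  unfolding weak_star_integral_def
proof (rule the_equality)
  note sol = has_weak_star_integral_solution[OF G t]
  then show "has_weak_star_integral (\<lambda>\<tau>. signed_convolution (measure (G (t - \<tau>))) (f \<tau>)) (solution t) {0<..<t}" .
  fix \<mu> assume "has_weak_star_integral (\<lambda>\<tau>. signed_convolution (measure (G (t - \<tau>))) (f \<tau>)) \<mu> {0<..<t}"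
  then show "\<mu> = solution t"
    using sol by (intro signed_measure_eqI_C0) (auto simp: has_weak_star_integral_def)
qed

lemma positive_measure_solution:
  assumes pos: "AE \<tau> in lebesgue. 0 < \<tau> \<longrightarrow> positive_measure (f \<tau>)" and t: "0 < t"
  shows "positive_measure (solution t)"
  unfolding positive_measure_def
proof (intro conjI ballI)
  show "signed_measure (solution t)" by (rule signed_measure_solution[OF t])
  fix A :: "'a set" assume A: "A \<in> sets borel"
  have "0 \<le> pairing t (indicator A)"
    unfolding pairing_def set_lebesgue_integral_def
  proof (rule integral_nonneg_AE)
    show "AE \<tau> in lebesgue. 0 \<le> indicator {0<..<t} \<tau> *\<^sub>R (weight (t - \<tau>) * signed_integral (f \<tau>) (average (indicator A) (t - \<tau>)))"
      using pos
    proof eventually_elim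
      case (elim \<tau>)
      have "0 \<le> signed_integral (f \<tau>) (average (indicator A) (t - \<tau>))" if "0 < \<tau>"
        using elim that by (intro signed_integral_nonneg) (auto simp: average_def)
      then show ?case by (auto simp: indicator_def weight_nonneg)
    qed
  qed
  then show "0 \<le> solution t A" using A by (simp add: solution_def)
qed

section \<open>Mass of the solution\<close>

lemma f_UNIV_measurable: "(\<lambda>\<tau>. f \<tau> UNIV) \<in> borel_measurable (lebesgue_on {0<..})"
proof -
  have "(\<lambda>\<tau>. signed_integral (f \<tau>) (\<lambda>_. 1)) \<in> borel_measurable (lebesgue_on {0<..})"
    by (rule signed_kernel_integral_measurable[OF f, of _ 1]) auto
  then show ?thesis
    by (rule measurable_cong[THEN iffD1, rotated]) (simp add: signed_integral_const f_signed)
qed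

lemma f_UNIV_integrable:
  assumes t: "0 < t"
  shows "set_integrable lebesgue {0<..<t} (\<lambda>\<tau>. (t - \<tau>) powr (\<alpha> - 1) * f \<tau> UNIV)"
proof -
  have "set_integrable lebesgue {0<..<t} (\<lambda>\<tau>. Gamma \<alpha> * (weight (t - \<tau>) * signed_integral (f \<tau>) (average (\<lambda>_. 1) (t - \<tau>))))"
    by (intro set_integrable_mult_right pairing_integrable[OF t, of _ 1]) auto
  then show ?thesis
    using Gamma_real_pos[OF \<alpha>]
    by (subst (asm) set_integrable_cong[OF refl refl, of _ _ "\<lambda>\<tau>. (t - \<tau>) powr (\<alpha> - 1) * f \<tau> UNIV"])
       (auto simp: average_const signed_integral_const f_signed weight_def)
qed

text \<open>Mass \<open>1\<close> at all times is an Abel equation for \<open>f \<tau> UNIV\<close>. The function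
  \<open>\<tau> powr (- \<alpha>) / Gamma (1 - \<alpha>)\<close> solves it, and solutions are unique up to null sets.\<close>

lemma solution_mass_one_iff:
  assumes \<alpha>1: "\<alpha> < 1"
  shows "(\<forall>t>0. solution t UNIV = 1) \<longleftrightarrow>
    (AE \<tau> in lebesgue. 0 < \<tau> \<longrightarrow> f \<tau> UNIV = \<tau> powr (- \<alpha>) / Gamma (1 - \<alpha>))"
proof
  assume one: "\<forall>t>0. solution t UNIV = 1"
  define w where "w \<tau> = f \<tau> UNIV - \<tau> powr (- \<alpha>) / Gamma (1 - \<alpha>)" for \<tau>
  have eq: "(t - \<tau>) powr (\<alpha> - 1) * w \<tau> =
      (t - \<tau>) powr (\<alpha> - 1) * f \<tau> UNIV - (t - \<tau>) powr (\<alpha> - 1) * (\<tau> powr (- \<alpha>) / Gamma (1 - \<alpha>))" for t \<tau>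
    by (simp only: w_def right_diff_distrib)
  have "AE \<tau> in lebesgue. 0 < \<tau> \<longrightarrow> w \<tau> = 0"
  proof (rule Abel_equation_unique[OF \<alpha> \<alpha>1])
    show "w \<in> borel_measurable (lebesgue_on {0<..})"
      unfolding w_def[abs_def]
      by (intro borel_measurable_diff f_UNIV_measurable measurable_restrict_space1 measurable_completion) measurable
    fix t :: real assume t: "0 < t"
    note int = f_UNIV_integrable[OF t] Beta_set_integral(1)[OF \<alpha> \<alpha>1 t]
    show "set_integrable lebesgue {0<..<t} (\<lambda>\<tau>. (t - \<tau>) powr (\<alpha> - 1) * w \<tau>)"
      unfolding eq by (rule set_integral_diff(1)[OF int])
    have "(LINT \<tau>:{0<..<t}|lebesgue. (t - \<tau>) powr (\<alpha> - 1) * f \<tau> UNIV) = Gamma \<alpha>"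
      using one t Gamma_real_pos[OF \<alpha>] by (simp add: solution_UNIV field_simps)
    then show "(LINT \<tau>:{0<..<t}|lebesgue. (t - \<tau>) powr (\<alpha> - 1) * w \<tau>) = 0"
      unfolding eq set_integral_diff(2)[OF int] Beta_set_integral(2)[OF \<alpha> \<alpha>1 t] by simp
  qed
  then show "AE \<tau> in lebesgue. 0 < \<tau> \<longrightarrow> f \<tau> UNIV = \<tau> powr (- \<alpha>) / Gamma (1 - \<alpha>)"
    by (simp add: w_def)
next
  assume mass: "AE \<tau> in lebesgue. 0 < \<tau> \<longrightarrow> f \<tau> UNIV = \<tau> powr (- \<alpha>) / Gamma (1 - \<alpha>)"
  show "\<forall>t>0. solution t UNIV = 1"
  proof (intro allI impI)
    fix t :: real assume t: "0 < t"
    note int = f_UNIV_integrable[OF t] Beta_set_integral(1)[OF \<alpha> \<alpha>1 t]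
    have "(LINT \<tau>:{0<..<t}|lebesgue. (t - \<tau>) powr (\<alpha> - 1) * f \<tau> UNIV) =
        (LINT \<tau>:{0<..<t}|lebesgue. (t - \<tau>) powr (\<alpha> - 1) * (\<tau> powr (- \<alpha>) / Gamma (1 - \<alpha>)))"
      unfolding set_lebesgue_integral_def
    proof (rule integral_cong_AE)
      show "AE \<tau> in lebesgue. indicator {0<..<t} \<tau> *\<^sub>R ((t - \<tau>) powr (\<alpha> - 1) * f \<tau> UNIV) =
          indicator {0<..<t} \<tau> *\<^sub>R ((t - \<tau>) powr (\<alpha> - 1) * (\<tau> powr (- \<alpha>) / Gamma (1 - \<alpha>)))"
        using mass by eventually_elim (auto simp: indicator_def)
    qed (use int in \<open>simp_all only: set_integrable_def borel_measurable_integrable\<close>)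
    then show "solution t UNIV = 1"
      using Gamma_real_pos[OF \<alpha>] Beta_set_integral(2)[OF \<alpha> \<alpha>1 t] by (simp add: solution_UNIV)
  qed
qed

section \<open>Concentration at the origin as time tends to zero\<close>

text \<open>Put \<open>\<psi> = \<phi> - \<phi> 0\<close> and let \<open>\<bar>\<psi>\<bar> < e1\<close> on the ball of radius \<open>2 \<delta>\<close>. Since \<open>K s\<close> lives on the ball
  of radius \<open>s < \<delta>\<close>, the average of \<open>\<psi>\<close> is bounded by \<open>e1 + D * min 1 (norm y / \<delta>)\<close>. The last
  function is continuous and bounded, so its \<open>\<nu>\<^sub>\<tau>\<close>-integral is small for small \<open>\<tau>\<close>, and the remaining
  integral over \<open>\<tau>\<close> is the Beta integral with total mass \<open>1\<close>.\<close>

lemma solution_tendsto_dirac: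
  assumes \<alpha>1: "\<alpha> < 1"
    and K_ball: "\<And>s. 0 < s \<Longrightarrow> emeasure (K s) (cball 0 s) = 1"
    and mass: "AE \<tau> in lebesgue. 0 < \<tau> \<longrightarrow> f \<tau> UNIV = \<tau> powr (- \<alpha>) / Gamma (1 - \<alpha>)"
    and f': "AE \<tau> in lebesgue. 0 < \<tau> \<longrightarrow> f' \<tau> = f \<tau>"
    and signed: "\<And>\<tau>. 0 < \<tau> \<Longrightarrow> signed_measure (f' \<tau>)"
    and prob: "\<And>\<tau>. 0 < \<tau> \<Longrightarrow> probability_measure (\<lambda>A. Gamma (1 - \<alpha>) * \<tau> powr \<alpha> * f' \<tau> A)"
    and lim: "weakly_converges (\<lambda>\<tau> A. Gamma (1 - \<alpha>) * \<tau> powr \<alpha> * f' \<tau> A) dirac0 (at_right 0)"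
  shows "weakly_converges solution dirac0 (at_right 0)"
  unfolding weakly_converges_def
proof (intro allI impI, elim conjE)
  fix \<phi> :: "'a \<Rightarrow> real" assume cont: "continuous_on UNIV \<phi>" and "bounded (range \<phi>)"
  then obtain B where B: "\<And>x. \<bar>\<phi> x\<bar> \<le> B" by (auto simp: bounded_iff)
  have \<phi>: "\<phi> \<in> borel_measurable borel" by (rule borel_measurable_continuous_onI[OF cont])
  have dirac: "signed_integral dirac0 \<psi> = \<psi> (0::'a)" if "\<psi> \<in> borel_measurable borel" for \<psi>
    using that
    by (subst signed_integral_finite_measure) (auto simp: prob_space.finite_measure prob_space_return integral_return)
  (* D bounds \<psi>; the summand 1 makes it positive, so that e2 may be divided by it. *)
  define D where "D = 2 * B + 1"
  have D: "0 < D" using B[of 0] by (simp add: D_def)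
  define \<psi> where "\<psi> x = \<phi> x - \<phi> 0" for x
  have \<psi>: "\<psi> \<in> borel_measurable borel" "\<And>x. \<bar>\<psi> x\<bar> \<le> D"
  proof -
    show "\<psi> \<in> borel_measurable borel" unfolding \<psi>_def[abs_def] using \<phi> by measurable
    show "\<bar>\<psi> x\<bar> \<le> D" for x using B[of x] B[of 0] by (auto simp: \<psi>_def D_def)
  qed
  have \<Gamma>: "0 < Gamma (1 - \<alpha>)" using \<alpha>1 by (simp add: Gamma_real_pos)
  show "((\<lambda>t. signed_integral (solution t) \<phi>) \<longlongrightarrow> signed_integral dirac0 \<phi>) (at_right 0)"
    unfolding dirac[OF \<phi>]
  proof (rule tendstoI)
    fix e :: real assume e: "0 < e"
    (* The error at the end is e1 + D * e2 = 2 * e / 3. *)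
    define e1 where "e1 = e / 3"
    define e2 where "e2 = e / (3 * D)"
    have e12: "0 < e1" "0 < e2" "e1 + D * e2 < e" using e D by (auto simp: e1_def e2_def field_simps)
    obtain d where d: "0 < d" "\<And>z. norm z < d \<Longrightarrow> \<bar>\<psi> z\<bar> < e1"
      using cont[unfolded continuous_on_iff] e12(1) by (force simp: \<psi>_def dist_real_def)
    define \<delta> where "\<delta> = d / 2"
    have \<delta>: "0 < \<delta>" using d by (simp add: \<delta>_def)
    define \<eta> where "\<eta> y = min 1 (norm y / \<delta>)" for y :: 'a
    have \<eta>_cont: "continuous_on UNIV \<eta>" unfolding \<eta>_def[abs_def] using \<delta> by (intro continuous_intros) auto
    have \<eta>: "\<eta> \<in> borel_measurable borel" "\<And>y. \<bar>\<eta> y\<bar> \<le> 1"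
      using borel_measurable_continuous_onI[OF \<eta>_cont] \<delta> by (auto simp: \<eta>_def min_def)
    have \<psi>_le: "\<bar>\<psi> (x + y)\<bar> \<le> e1 + D * \<eta> y" if "norm x < \<delta>" for x y
    proof (cases "norm y < \<delta>")
      case True
      have "norm (x + y) < d" using norm_triangle_ineq[of x y] that True by (simp add: \<delta>_def)
      moreover have "0 \<le> D * \<eta> y" using D \<delta> by (simp add: \<eta>_def)
      ultimately show ?thesis using d(2)[of "x + y"] by simp
    next
      case False
      then have "\<eta> y = 1" using \<delta> by (simp add: \<eta>_def)
      then show ?thesis using \<psi>(2)[of "x + y"] e12(1) by simp
    qed
    have average_le: "\<bar>average \<psi> s y\<bar> \<le> e1 + D * \<eta> y" if s: "0 < s" "s < \<delta>" for s y
    proof -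
      interpret Ks: prob_space "K s" by (rule prob_K)
      have "AE x in K s. x \<in> cball 0 s"
        using K_ball[OF s(1)] by (subst Ks.AE_in_set_eq_1) (auto simp: Ks.emeasure_eq_measure)
      then have "AE x in K s. \<bar>\<psi> (x + y)\<bar> \<le> e1 + D * \<eta> y"
        by eventually_elim (use s(2) in \<open>auto intro: \<psi>_le\<close>)
      moreover have int: "integrable (K s) (\<lambda>x. \<psi> (x + y))"
        by (rule translation_average_bounded(1)[OF finite_K sets_K \<psi>])
      ultimately have "(\<integral>x. \<bar>\<psi> (x + y)\<bar> \<partial>K s) \<le> (\<integral>x. e1 + D * \<eta> y \<partial>K s)"
        by (intro integral_mono_AE) auto
      then show ?thesis
        unfolding average_def by (intro order_trans[OF integral_abs_bound]) (simp add: Ks.prob_space)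
    qed
    have "((\<lambda>\<tau>. signed_integral (\<lambda>A. Gamma (1 - \<alpha>) * \<tau> powr \<alpha> * f' \<tau> A) \<eta>) \<longlongrightarrow> \<eta> 0) (at_right 0)"
      using lim \<eta>_cont \<eta>(2) unfolding weakly_converges_def dirac[OF \<eta>(1), symmetric]
      by (auto simp: bounded_iff)
    then have "eventually (\<lambda>\<tau>. signed_integral (\<lambda>A. Gamma (1 - \<alpha>) * \<tau> powr \<alpha> * f' \<tau> A) \<eta> < e2) (at_right 0)"
      using order_tendstoD(2)[of _ "\<eta> 0" _ e2] e12(2) by (simp add: \<eta>_def)
    then obtain t0 where t0: "0 < t0"
      "\<And>\<tau>. 0 < \<tau> \<Longrightarrow> \<tau> < t0 \<Longrightarrow> signed_integral (\<lambda>A. Gamma (1 - \<alpha>) * \<tau> powr \<alpha> * f' \<tau> A) \<eta> < e2"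
      by (auto simp: eventually_at_right_field)
    have small: "\<bar>signed_integral (solution t) \<phi> - \<phi> 0\<bar> < e" if t: "0 < t" "t < \<delta>" "t < t0" for t
    proof -
      have f_le: "\<bar>signed_integral (f' \<tau>) (average \<psi> (t - \<tau>))\<bar> \<le> (e1 + D * e2) * (\<tau> powr (- \<alpha>) / Gamma (1 - \<alpha>))"
        if \<tau>: "0 < \<tau>" "\<tau> < t" for \<tau>
      proof -
        define c where "c = Gamma (1 - \<alpha>) * \<tau> powr \<alpha>"
        have c: "0 < c" "1 / c = \<tau> powr (- \<alpha>) / Gamma (1 - \<alpha>)"
          using \<Gamma> \<tau> by (auto simp: c_def powr_minus field_simps)
        note pm = prob[OF \<tau>(1), folded c_def]
        let ?\<nu> = "\<lambda>A. c * f' \<tau> A"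
        have pos: "positive_measure ?\<nu>" and one: "?\<nu> UNIV = 1" using pm by (auto simp: probability_measure_def)
        then have sig: "signed_measure ?\<nu>" by (simp add: positive_measure_def)
        have avg: "average \<psi> (t - \<tau>) \<in> borel_measurable borel" "\<And>y. \<bar>average \<psi> (t - \<tau>) y\<bar> \<le> D"
          by (rule average_section_measurable[OF \<psi>(1)], rule average_bounded[OF \<psi>])
        have bound: "(\<lambda>y. e1 + D * \<eta> y) \<in> borel_measurable borel" "\<And>y. \<bar>e1 + D * \<eta> y\<bar> \<le> e1 + D"
          using \<eta> D e12(1) mult_left_mono[OF \<eta>(2), of D] \<delta> by (auto simp: \<eta>_def abs_of_nonneg)
        have nbound: "(\<lambda>y. - 1 * (e1 + D * \<eta> y)) \<in> borel_measurable borel" "\<And>y. \<bar>- 1 * (e1 + D * \<eta> y)\<bar> \<le> e1 + D"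
          by (intro borel_measurable_times bound(1), simp)
            (simp only: abs_mult abs_minus_cancel abs_one mult_1 bound(2))
        have val: "signed_integral ?\<nu> (\<lambda>y. e1 + D * \<eta> y) = e1 + D * signed_integral ?\<nu> \<eta>"
        proof -
          have "signed_integral ?\<nu> (\<lambda>y. e1 + D * \<eta> y) = signed_integral ?\<nu> (\<lambda>y. e1) + signed_integral ?\<nu> (\<lambda>y. D * \<eta> y)"
            using \<eta> D by (intro signed_integral_add[OF sig, where C="\<bar>e1\<bar>" and D=D]) (auto simp: abs_mult)
          then show ?thesis
            using signed_integral_const[OF sig, of e1] signed_integral_cmult[of ?\<nu> D \<eta>] one by simp
        qed
        have lt: "0 < t - \<tau>" "t - \<tau> < \<delta>" using \<tau> t by auto
        have upper: "average \<psi> (t - \<tau>) y \<le> e1 + D * \<eta> y" for y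
          using average_le[OF lt, of y] by linarith
        have lower: "- 1 * (e1 + D * \<eta> y) \<le> average \<psi> (t - \<tau>) y" for y
          unfolding mult_minus1 using average_le[OF lt, of y] by (simp only: abs_le_iff minus_le_iff)
        have "signed_integral ?\<nu> (average \<psi> (t - \<tau>)) \<le> e1 + D * signed_integral ?\<nu> \<eta>"
          using signed_integral_mono_positive[OF pos avg bound upper] by (simp only: val)
        moreover have "- (e1 + D * signed_integral ?\<nu> \<eta>) \<le> signed_integral ?\<nu> (average \<psi> (t - \<tau>))"
          using signed_integral_mono_positive[OF pos nbound avg lower, unfolded signed_integral_cmult val]
          by (simp only: mult_minus1)
        moreover have "D * signed_integral ?\<nu> \<eta> \<le> D * e2"
          using t0(2)[of \<tau>] \<tau> t D by (intro mult_left_mono) (simp_all add: c_def)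
        ultimately have "\<bar>signed_integral ?\<nu> (average \<psi> (t - \<tau>))\<bar> \<le> e1 + D * e2"
          by linarith
        then have "c * \<bar>signed_integral (f' \<tau>) (average \<psi> (t - \<tau>))\<bar> \<le> e1 + D * e2"
          using signed_integral_scale[OF signed[OF \<tau>(1)] avg, of c] c(1) by (simp add: abs_mult)
        then have "\<bar>signed_integral (f' \<tau>) (average \<psi> (t - \<tau>))\<bar> \<le> (e1 + D * e2) * (1 / c)"
          using c(1) by (simp add: field_simps)
        then show ?thesis unfolding c(2) .
      qed
      let ?k = "\<lambda>\<tau>. indicator {0<..<t} \<tau> *\<^sub>R ((t - \<tau>) powr (\<alpha> - 1) * (\<tau> powr (- \<alpha>) / Gamma (1 - \<alpha>)))"
      have k_int: "integrable lebesgue ?k"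
        using Beta_set_integral(1)[OF \<alpha> \<alpha>1 t(1)] by (simp add: set_integrable_def)
      have "\<bar>pairing t \<psi>\<bar> \<le> (\<integral>\<tau>. \<bar>indicator {0<..<t} \<tau> *\<^sub>R (weight (t - \<tau>) * signed_integral (f \<tau>) (average \<psi> (t - \<tau>)))\<bar> \<partial>lebesgue)"
        unfolding pairing_def set_lebesgue_integral_def by (rule integral_abs_bound)
      also have "\<dots> \<le> (\<integral>\<tau>. (e1 + D * e2) / Gamma \<alpha> * ?k \<tau> \<partial>lebesgue)"
      proof (rule integral_mono_AE)
        show "integrable lebesgue (\<lambda>\<tau>. \<bar>indicator {0<..<t} \<tau> *\<^sub>R (weight (t - \<tau>) * signed_integral (f \<tau>) (average \<psi> (t - \<tau>)))\<bar>)"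
          using pairing_integrable[OF t(1) \<psi>] by (intro integrable_abs) (simp add: set_integrable_def)
        show "integrable lebesgue (\<lambda>\<tau>. (e1 + D * e2) / Gamma \<alpha> * ?k \<tau>)"
          by (rule integrable_mult_right[OF k_int])
        show "AE \<tau> in lebesgue. \<bar>indicator {0<..<t} \<tau> *\<^sub>R (weight (t - \<tau>) * signed_integral (f \<tau>) (average \<psi> (t - \<tau>)))\<bar> \<le>
            (e1 + D * e2) / Gamma \<alpha> * ?k \<tau>"
          using f'
        proof eventually_elim
          case (elim \<tau>)
          show ?case
          proof (cases "\<tau> \<in> {0<..<t}")
            case True
            then have "weight (t - \<tau>) * \<bar>signed_integral (f \<tau>) (average \<psi> (t - \<tau>))\<bar> \<le>
                weight (t - \<tau>) * ((e1 + D * e2) * (\<tau> powr (- \<alpha>) / Gamma (1 - \<alpha>)))"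
              using f_le[of \<tau>] elim weight_nonneg by (intro mult_left_mono) auto
            then show ?thesis using True Gamma_real_pos[OF \<alpha>]
              by (simp add: abs_mult weight_def ac_simps)
          qed simp
        qed
      qed
      also have "\<dots> = (e1 + D * e2) / Gamma \<alpha> * (\<integral>\<tau>. ?k \<tau> \<partial>lebesgue)" by (rule integral_mult_right_zero)
      also have "\<dots> = e1 + D * e2"
        using Beta_set_integral(2)[OF \<alpha> \<alpha>1 t(1)] Gamma_real_pos[OF \<alpha>] by (simp add: set_lebesgue_integral_def)
      finally have "\<bar>pairing t \<psi>\<bar> < e" using e12(3) by simp
      moreover have "signed_integral (solution t) \<phi> = pairing t \<psi> + \<phi> 0"
      proof -
        have "signed_integral (solution t) (\<lambda>x. \<psi> x + \<phi> 0) = signed_integral (solution t) \<psi> + signed_integral (solution t) (\<lambda>_. \<phi> 0)"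
          by (rule signed_integral_add[OF signed_measure_solution[OF t(1)] \<psi>, of _ "\<bar>\<phi> 0\<bar>"]) auto
        moreover have "(\<lambda>x. \<psi> x + \<phi> 0) = \<phi>" by (simp add: \<psi>_def)
        moreover have "solution t UNIV = 1" using solution_mass_one_iff[OF \<alpha>1] mass t(1) by blast
        ultimately show ?thesis
          using signed_integral_solution[OF t(1) \<psi>] signed_integral_const[OF signed_measure_solution[OF t(1)]]
          by simp
      qed
      ultimately show ?thesis by simp
    qed
    have "0 < min \<delta> t0" using \<delta> t0(1) by simp
    with small show "eventually (\<lambda>t. dist (signed_integral (solution t) \<phi>) (\<phi> 0) < e) (at_right 0)"
      unfolding eventually_at_right_field dist_real_def by (intro exI[of _ "min \<delta> t0"]) auto
  qed
qed

end

section \<open>The proposition\<close>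

theorem proposition5:
  fixes \<alpha> :: real
    and \<Lambda> :: "(real ^ 'd) measure"
    and G :: "real \<Rightarrow> (real ^ 'd) measure"
    and f u :: "real \<Rightarrow> (real ^ 'd) set \<Rightarrow> real"
  assumes \<alpha>: "0 < \<alpha>" "\<alpha> < 1"
    and \<Lambda>: "sphere_probability \<Lambda>"
    and G: "convolution_kernel \<alpha> \<Lambda> G"
    and f_signed: "\<And>t. 0 < t \<Longrightarrow> signed_measure (f t)"
    and f_meas: "weak_star_measurable {0<..} f"
    and f_int: "\<And>t. 0 < t \<Longrightarrow>
      (\<integral>\<^sup>+\<tau>\<in>{0<..<t}. ennreal ((t - \<tau>) powr (\<alpha> - 1)) * tv_norm (f \<tau>) \<partial>lebesgue) < \<infinity>"
    and u: "\<And>t. 0 < t \<Longrightarrow> u t =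
      weak_star_integral {0<..<t} (\<lambda>\<tau>. signed_convolution (measure (G (t - \<tau>))) (f \<tau>))"
  shows
    "\<comment> \<open>the weak-* integral defining \<open>u t\<close> exists\<close>
     (\<forall>t>0. has_weak_star_integral
        (\<lambda>\<tau>. signed_convolution (measure (G (t - \<tau>))) (f \<tau>)) (u t) {0<..<t}) \<and>
     \<comment> \<open>(a)\<close>
     (\<forall>t>0. u t UNIV =
        1 / Gamma \<alpha> * (LINT \<tau>:{0<..<t}|lebesgue. (t - \<tau>) powr (\<alpha> - 1) * f \<tau> UNIV)) \<and>
     \<comment> \<open>(b)\<close>
     ((\<forall>t>0. u t UNIV = 1) \<longleftrightarrow>
      (AE t in lebesgue. 0 < t \<longrightarrow> f t UNIV = t powr (- \<alpha>) / Gamma (1 - \<alpha>))) \<and>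
     \<comment> \<open>(c)\<close>
     ((AE t in lebesgue. 0 < t \<longrightarrow> positive_measure (f t)) \<longrightarrow>
      (\<forall>t>0. positive_measure (u t))) \<and>
     ((AE t in lebesgue. 0 < t \<longrightarrow> f t UNIV = t powr (- \<alpha>) / Gamma (1 - \<alpha>)) \<and>
      (AE t in lebesgue. 0 < t \<longrightarrow> positive_measure (f t)) \<longrightarrow>
      (\<forall>t>0. probability_measure (u t))) \<and>
     \<comment> \<open>(d)\<close>
     ((AE t in lebesgue. 0 < t \<longrightarrow> f t UNIV = t powr (- \<alpha>) / Gamma (1 - \<alpha>)) \<and>
      (AE t in lebesgue. 0 < t \<longrightarrow> positive_measure (f t)) \<longrightarrow>
      (\<exists>f'. (\<forall>t>0. signed_measure (f' t)) \<and> (AE t in lebesgue. 0 < t \<longrightarrow> f' t = f t) \<and>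
         (\<forall>t>0. probability_measure (\<lambda>A. Gamma (1 - \<alpha>) * t powr \<alpha> * f' t A))) \<and>
      (\<forall>f'. (\<forall>t>0. signed_measure (f' t)) \<and> (AE t in lebesgue. 0 < t \<longrightarrow> f' t = f t) \<and>
         (\<forall>t>0. probability_measure (\<lambda>A. Gamma (1 - \<alpha>) * t powr \<alpha> * f' t A)) \<and>
         weakly_converges (\<lambda>t A. Gamma (1 - \<alpha>) * t powr \<alpha> * f' t A) dirac0 (at_right 0)
         \<longrightarrow> weakly_converges u dirac0 (at_right 0)))"
proof -
  obtain K where K: "K \<in> borel \<rightarrow>\<^sub>M prob_algebra borel"
    and K_ball: "\<And>s. 0 < s \<Longrightarrow> emeasure (K s) (cball 0 s) = 1"
    and G_eq: "\<And>s. 0 < s \<Longrightarrow> G s = density (K s) (\<lambda>_. ennreal (s powr (\<alpha> - 1) / Gamma \<alpha>))"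
    using convolution_kernel_normalized[OF \<alpha>(1) G] by blast
  have kernel: "signed_kernel (lebesgue_on {0<..}) f"
    using f_signed f_meas by (simp add: signed_kernel_def weak_star_measurable_def)
  note \<alpha>1 = \<alpha>(2)
  interpret causal_convolution \<alpha> K f
    by unfold_locales (fact \<alpha>(1) K kernel f_int)+
  have G_weight: "\<And>s. 0 < s \<Longrightarrow> G s = density (K s) (\<lambda>_. ennreal (weight s))"
    using G_eq by (simp add: weight_def)
  have u_eq: "u t = solution t" if "0 < t" for t
    using u[OF that] weak_star_integral_eq_solution[OF G_weight that] by simp
  let ?mass = "AE t in lebesgue. 0 < t \<longrightarrow> f t UNIV = t powr (- \<alpha>) / Gamma (1 - \<alpha>)"
  let ?pos = "AE t in lebesgue. 0 < t \<longrightarrow> positive_measure (f t)"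
  have \<Gamma>: "0 < Gamma (1 - \<alpha>)" using \<alpha>1 by (simp add: Gamma_real_pos)
  have exists: "\<forall>t>0. has_weak_star_integral
        (\<lambda>\<tau>. signed_convolution (measure (G (t - \<tau>))) (f \<tau>)) (u t) {0<..<t}"
    using has_weak_star_integral_solution[OF G_weight] u_eq by simp
  have a: "\<forall>t>0. u t UNIV =
        1 / Gamma \<alpha> * (LINT \<tau>:{0<..<t}|lebesgue. (t - \<tau>) powr (\<alpha> - 1) * f \<tau> UNIV)"
    using solution_UNIV u_eq by simp
  have b: "(\<forall>t>0. u t UNIV = 1) \<longleftrightarrow> ?mass"
    using solution_mass_one_iff[OF \<alpha>1] u_eq by auto
  have c: "?pos \<longrightarrow> (\<forall>t>0. positive_measure (u t))"
    using positive_measure_solution u_eq by auto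
  have c': "?mass \<and> ?pos \<longrightarrow> (\<forall>t>0. probability_measure (u t))"
    using b c by (simp add: probability_measure_def)
  have d1: "\<exists>f'. (\<forall>t>0. signed_measure (f' t)) \<and> (AE t in lebesgue. 0 < t \<longrightarrow> f' t = f t) \<and>
         (\<forall>t>0. probability_measure (\<lambda>A. Gamma (1 - \<alpha>) * t powr \<alpha> * f' t A))" if "?mass" "?pos"
  proof -
    define good where "good t \<longleftrightarrow> f t UNIV = t powr (- \<alpha>) / Gamma (1 - \<alpha>) \<and> positive_measure (f t)" for t
    (* On the exceptional null set any positive measure with the prescribed mass serves. *)
    define f' where "f' t = (if good t then f t else (\<lambda>A. t powr (- \<alpha>) / Gamma (1 - \<alpha>) * dirac0 A))" for t
    have dirac: "positive_measure (dirac0 :: (real ^ 'd) set \<Rightarrow> real)"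
      by (intro positive_measure_of_finite_measure prob_space.finite_measure prob_space_return) auto
    have dirac_UNIV: "dirac0 (UNIV :: (real ^ 'd) set) = 1"
      by (simp add: measure_return)
    have pos: "positive_measure (f' t)" for t
      using positive_measure_cmult[OF dirac, of "t powr (- \<alpha>) / Gamma (1 - \<alpha>)"] \<Gamma>
      by (cases "good t") (simp_all add: f'_def good_def)
    have mass: "f' t UNIV = t powr (- \<alpha>) / Gamma (1 - \<alpha>)" for t
      using dirac_UNIV by (simp add: f'_def good_def)
    have "probability_measure (\<lambda>A. Gamma (1 - \<alpha>) * t powr \<alpha> * f' t A)" if "0 < t" for t
    proof -
      have "Gamma (1 - \<alpha>) * t powr \<alpha> * f' t UNIV = 1"
        using that \<Gamma> by (simp add: mass powr_minus)
      then show ?thesis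
        using positive_measure_cmult[OF pos, of "Gamma (1 - \<alpha>) * t powr \<alpha>" t] \<Gamma> by (simp add: probability_measure_def)
    qed
    moreover have "AE t in lebesgue. 0 < t \<longrightarrow> f' t = f t"
      using that by eventually_elim (auto simp: f'_def good_def)
    ultimately show ?thesis using pos by (intro exI[of _ f']) (auto simp: positive_measure_def)
  qed
  have d2: "weakly_converges u dirac0 (at_right 0)"
    if "?mass" "\<forall>t>0. signed_measure (f' t)" "AE t in lebesgue. 0 < t \<longrightarrow> f' t = f t"
      "\<forall>t>0. probability_measure (\<lambda>A. Gamma (1 - \<alpha>) * t powr \<alpha> * f' t A)"
      "weakly_converges (\<lambda>t A. Gamma (1 - \<alpha>) * t powr \<alpha> * f' t A) dirac0 (at_right 0)" for f'
  proof -
    have sol: "weakly_converges solution dirac0 (at_right 0)"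
      using that by (intro solution_tendsto_dirac[OF \<alpha>1 K_ball]) auto
    have ev: "eventually (\<lambda>t. solution t = u t) (at_right 0)"
      using u_eq by (auto simp: eventually_at_right_field intro: exI[of _ 1])
    show ?thesis
      unfolding weakly_converges_def
    proof (intro allI impI)
      fix \<phi> :: "real ^ 'd \<Rightarrow> real" assume "continuous_on UNIV \<phi> \<and> bounded (range \<phi>)"
      with sol have "((\<lambda>t. signed_integral (solution t) \<phi>) \<longlongrightarrow> signed_integral dirac0 \<phi>) (at_right 0)"
        by (simp add: weakly_converges_def)
      then show "((\<lambda>t. signed_integral (u t) \<phi>) \<longlongrightarrow> signed_integral dirac0 \<phi>) (at_right 0)"
        by (rule Lim_transform_eventually) (use ev in eventually_elim, simp)
    qed
  qed
  show ?thesis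
    using exists a b c c' d1 d2 by blast
qed

end
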